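(* Fix an integer $d\ge 1$ and positive reals $\alpha_1,\dots,\alpha_d$. For each positive integer $u$ let $N(u)=(n_1(u),\dots,n_d(u))$ be a $d$-tuple of positive integers such that $n_j(u)/u\to\alpha_j$ as $u\to\infty$ for each $j$. Then, as $u\to\infty$, $$\mathcal{H}_{N(u)}(0)=\log u^2-\zeta_A'(0)+o(1),$$ and equivalently $$\log\Big(\prod_{\Lambda_j\neq 0}\Lambda_j\Big)=V(N(u))\,\mathcal{I}_d(0)+\log u^2-\zeta_A'(0)+o(1),$$ where the product runs over the nonzero eigenvalues $\Lambda_j$ of the discrete torus with parameter $N(u)$ (with multiplicity), and $$\mathcal{I}_d(0)=-\int_0^\infty\left(e^{-2dt}I_0(2t)^d-e^{-t}\right)\frac{dt}{t}.$$
   Context: For a $d$-tuple $N=(n_1,\dots,n_d)$ of positive integers, the discrete torus $DT_N=\prod_{j=1}^d n_j\mathbf{Z}\backslash\mathbf{Z}$ carries the combinatorial Laplacian (the sum over coordinates of $f\mapsto 2f(x)-f(x+1)-f(x-1)$), whose eigenvalues, with multiplicity, are $\Lambda = 2d-2\cos(2\pi k_1/n_1)-\cdots-2\cos(2\pi k_d/n_d)$ for $0\le k_j<n_j$; exactly one of them (for $k=0$) is zero. Let $V(N)=n_1\cdots n_d$ and $\theta_N(t)=\sum_{\Lambda}e^{-\Lambda t}$ (sum over all eigenvalues with multiplicity). $I_x(t)$ denotes the modified ($I$-)Bessel function, $I_x(t)=\frac1\pi\int_0^\pi e^{t\cos\theta}\cos(x\theta)\,d\theta$ for integer $x$. Define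 $$\mathcal{H}_N(0)=-\int_0^\infty\left(\theta_N(t)-V(N)e^{-2dt}I_0(2t)^d-1+e^{-t}\right)\frac{dt}{t}.$$ Let $A$ be the diagonal matrix with diagonal entries $\alpha_1,\dots,\alpha_d$, and $V(A)=\alpha_1\cdots\alpha_d$. The Laplacian $-\sum\partial^2/\partial x_j^2$ on the real torus $A\mathbf{Z}^d\backslash\mathbf{R}^d$ has eigenvalues $(2\pi)^2\sum_j (m_j/\alpha_j)^2$, $m\in\mathbf{Z}^d$. Its spectral zeta function is $\zeta_A(w)=\sum_{m\in\mathbf{Z}^d\setminus\{0\}}\big((2\pi)^2\sum_j m_j^2/\alpha_j^2\big)^{-w}$ for $\mathrm{Re}(w)>d/2$, meromorphically continued to $\mathbf{C}$ (it is holomorphic at $w=0$); $-\zeta_A'(0)$ is the logarithm of the zeta-regularized determinant of the Laplacian on the real torus. *)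

theory Defs
  imports
    "HOL-Complex_Analysis.Complex_Analysis"
    "HOL-Library.Function_Algebras"
    "HOL-Library.Landau_Symbols"
begin

text \<open>
  The dimension $d$ is the cardinality of the finite index type \<open>'d\<close>. A complex function on the
  discrete torus with side lengths \<open>N\<close> is represented by an \<open>N\<close>-periodic function on
  $\mathbf{Z}^d$. Note that for a side length 1 or 2 the neighbours \<open>x + e\<^sub>j\<close> and \<open>x - e\<^sub>j\<close> coincide
  on the torus and are counted twice, as in the formula for the Laplacian.
\<close>

definition torus_functions :: "nat ^ 'd::finite \<Rightarrow> (int ^ 'd \<Rightarrow> complex) set" where
  "torus_functions N = {f. \<forall>x j. f (x + axis j (int (N $ j))) = f x}"

definition lattice_laplacian :: "(int ^ 'd::finite \<Rightarrow> complex) \<Rightarrow> int ^ 'd \<Rightarrow> complex" where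
  "lattice_laplacian f x = (\<Sum>j\<in>UNIV. 2 * f x - f (x + axis j 1) - f (x - axis j 1))"

definition laplace_eigenspace :: "nat ^ 'd::finite \<Rightarrow> real \<Rightarrow> (int ^ 'd \<Rightarrow> complex) set" where
  "laplace_eigenspace N \<Lambda> =
     {f \<in> torus_functions N. \<forall>x. lattice_laplacian f x = complex_of_real \<Lambda> * f x}"

text \<open>
  The Laplacian is self-adjoint, so that all its eigenvalues are real and the dimension of an
  eigenspace is also the algebraic multiplicity of the eigenvalue.
\<close>

definition laplace_spectrum :: "nat ^ 'd::finite \<Rightarrow> real set" where
  "laplace_spectrum N = {\<Lambda>. \<exists>f \<in> laplace_eigenspace N \<Lambda>. f \<noteq> (\<lambda>x. 0)}"

definition fun_scale :: "complex \<Rightarrow> ('a \<Rightarrow> complex) \<Rightarrow> 'a \<Rightarrow> complex" where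
  "fun_scale c f = (\<lambda>x. c * f x)"

lemma vector_space_fun_scale: "vector_space fun_scale"
  by unfold_locales (auto simp: fun_scale_def fun_eq_iff algebra_simps)

definition laplace_mult :: "nat ^ 'd::finite \<Rightarrow> real \<Rightarrow> nat" where
  "laplace_mult N \<Lambda> = vector_space.dim fun_scale (laplace_eigenspace N \<Lambda>)"

definition torus_volume :: "nat ^ 'd::finite \<Rightarrow> real" where
  "torus_volume N = (\<Prod>j\<in>UNIV. real (N $ j))"

definition torus_theta :: "nat ^ 'd::finite \<Rightarrow> real \<Rightarrow> real" where
  "torus_theta N t = (\<Sum>\<Lambda>\<in>laplace_spectrum N. real (laplace_mult N \<Lambda>) * exp (- \<Lambda> * t))"

definition torus_det :: "nat ^ 'd::finite \<Rightarrow> real" where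
  "torus_det N = (\<Prod>\<Lambda>\<in>laplace_spectrum N - {0}. \<Lambda> ^ laplace_mult N \<Lambda>)"

definition Bessel_I :: "int \<Rightarrow> real \<Rightarrow> real" where
  "Bessel_I n t = 1 / pi * (LBINT \<theta>:{0..pi}. exp (t * cos \<theta>) * cos (of_int n * \<theta>))"

definition torus_H0 :: "nat ^ 'd::finite \<Rightarrow> real" where
  "torus_H0 N =
     - (LBINT t:{0<..}.
          (torus_theta N t
           - torus_volume N * exp (- 2 * real CARD('d) * t) * Bessel_I 0 (2 * t) ^ CARD('d)
           - 1 + exp (- t)) / t)"

definition lattice_I0 :: "nat \<Rightarrow> real" where
  "lattice_I0 d =
     - (LBINT t:{0<..}. (exp (- 2 * real d * t) * Bessel_I 0 (2 * t) ^ d - exp (- t)) / t)"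

definition real_torus_eigenvalue :: "real ^ 'd::finite \<Rightarrow> int ^ 'd \<Rightarrow> real" where
  "real_torus_eigenvalue \<alpha> m = (2 * pi)\<^sup>2 * (\<Sum>j\<in>UNIV. (of_int (m $ j))\<^sup>2 / (\<alpha> $ j)\<^sup>2)"

definition real_torus_zeta_series :: "real ^ 'd::finite \<Rightarrow> complex \<Rightarrow> complex" where
  "real_torus_zeta_series \<alpha> w =
     (\<Sum>\<^sub>\<infinity>m\<in>UNIV - {0}. complex_of_real (real_torus_eigenvalue \<alpha> m) powr (- w))"

text \<open>
  The meromorphic continuation is unique as a function because \<open>nicely_meromorphic_on\<close> rules out
  removable singularities and prescribes the value 0 at the poles.
\<close>

definition real_torus_zeta :: "real ^ 'd::finite \<Rightarrow> complex \<Rightarrow> complex" where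
  "real_torus_zeta \<alpha> =
     (THE Z. Z nicely_meromorphic_on UNIV \<and>
             (\<forall>w. Re w > real CARD('d) / 2 \<longrightarrow> Z w = real_torus_zeta_series \<alpha> w))"

end

theory Submission
  imports
    Defs
    "HOL-Probability.Distributions"
    "HOL-Real_Asymp.Real_Asymp"
begin

text \<open>
  On the cycle of length $n$ put $D_n(t) = \theta_n(t) - n e^{-2t} I_0(2t)$. Expanding
  $e^{t(z + 1/z)}$ in powers of $z$, $D_n(t)$ is a sum over the walks on the infinite line
  that end at a nonzero multiple of $n$, so $D_n \ge 0$, and tilting the walk by $e^{rx}$ gives
  $D_n(t) \le 2 e^{2t(\cosh r - 1) - rn} \theta_n(t)$. With a good choice of $r$ this is
  $O((t/n^2)^K)$ for every $K$, uniformly in $n$. Since the theta function of the torus is a product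
  over the coordinates, this bound dominates the integrand of $\mathcal{H}_{N(u)}(0)$ after the
  substitution $t = u^2 s$, which also splits off $\log u^2$ as a Frullani integral. The integrand
  converges to $(\Theta_A(s) - c s^{-d/2} - 1 + e^{-s})/s$, where $\Theta_A$ is the theta function of
  the real torus.

  In the limit $n \to \infty$ the same bound shows $\Theta_A(s) - c s^{-d/2} = O(s^K)$ as
  $s \to 0$, so no Poisson summation is needed. Hence the Mellin transform of $\Theta_A$ yields the
  continuation of $\zeta_A$ to the whole plane and identifies the limit integral with
  $\zeta_A'(0)$; the constants match because $\int_0^\infty (e^{-s} - 1_{s \le 1})\,ds/s = \Gamma'(1)$.
  The second asymptotic differs from the first by the Frullani integrals
  $\log\Lambda = \int_0^\infty (e^{-t} - e^{-\Lambda t})\,dt/t$ over the nonzero eigenvalues.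
\<close>

no_notation fps_nth (infixl \<open>$\<close> 75)

text \<open>The obstacle is uniformity: after the substitution, a fixed range of \<open>s\<close>
  meets lattice times on every scale, so \<open>D_n\<close> must be controlled for all
  \<open>t > 0\<close> with a constant independent of \<open>n\<close>. For \<open>t\<close> at
  least 1 the walk is diffusive, and a suitable tilt costs only a constant factor. For
  \<open>t < 1\<close> the walk must make at least \<open>n\<close> rare steps, and
  \<open>D_n(t)\<close> is of order \<open>t^n\<close> as \<open>t\<close> tends to 0; a bound with
  exponent \<open>K\<close> is therefore possible only for \<open>n >= K\<close>. The exponent that
  is needed comes from the product: for small \<open>s\<close> each coordinate factor is bounded by
  a multiple of \<open>1/s\<close>, so comparing two products of \<open>d\<close> factors loses
  \<open>s^(-d)\<close>, and one more power pays for the measure \<open>ds/s\<close>. This is the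
  origin of the exponent \<open>d + 1\<close> and of the condition that all sides exceed
  \<open>d\<close>, which holds for large \<open>u\<close>. The continuation of the zeta function to
  the whole plane asks for every exponent instead; there \<open>n\<close> tends to infinity with
  \<open>K\<close> fixed.\<close>

definition cycle_theta :: "nat \<Rightarrow> real \<Rightarrow> real" where
  "cycle_theta n t = (\<Sum>k<n. exp (- (2 - 2 * cos (2 * pi * real k / real n)) * t))"

definition heat_return :: "real \<Rightarrow> real" where
  "heat_return t = exp (- 2 * t) * Bessel_I 0 (2 * t)"

section \<open>The spectrum of the discrete torus\<close>

interpretation FS: vector_space fun_scale
  by (rule vector_space_fun_scale)

lemma sum_fun_scale_apply: "(\<Sum>i\<in>A. fun_scale (c i) (f i)) x = (\<Sum>i\<in>A. c i * f i x)"
  by (induction A rule: infinite_finite_induct) (auto simp: fun_scale_def)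

text \<open>One root-of-unity sum serves twice: as orthogonality of the characters of the torus, and
  later as the filter that keeps, among all walks on the line, those whose endpoint is divisible by
  \<open>n\<close>.\<close>

lemma sum_cis_multiples:
  fixes m :: int
  assumes "n > 0"
  shows "(\<Sum>k<n. cis (2 * pi * real k * of_int m / real n)) =
           (if int n dvd m then of_nat n else 0)"
proof -
  define z where "z = cis (2 * pi * of_int m / real n)"
  have zk: "cis (2 * pi * real k * of_int m / real n) = z ^ k" for k
    unfolding z_def by (simp add: Complex.DeMoivre mult_ac)
  have z1: "z = 1 \<longleftrightarrow> int n dvd m"
  proof
    assume "z = 1"
    then have "cos (2 * pi * of_int m / real n) = 1"
      unfolding z_def by (simp add: complex_eq_iff)
    then obtain j :: int where "2 * pi * of_int m / real n = of_int j * 2 * pi"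
      unfolding cos_one_2pi_int by blast
    then have "(of_int m :: real) = of_int (j * int n)"
      using assms by (simp add: field_simps)
    then have "m = j * int n" by linarith
    then show "int n dvd m" by simp
  next
    assume "int n dvd m"
    then obtain j where "m = int n * j" by blast
    then show "z = 1" using assms unfolding z_def
      using cis_multiple_2pi[of "of_int j"] by (simp add: mult.assoc)
  qed
  show ?thesis
  proof (cases "z = 1")
    case True
    then show ?thesis using z1 by (simp add: zk)
  next
    case False
    have "z ^ n = 1"
      using assms using cis_multiple_2pi[of "of_int m"] unfolding z_def
      by (simp add: Complex.DeMoivre)
    then have "(\<Sum>k<n. z ^ k) = 0"
      using False by (simp add: geometric_sum)
    then show ?thesis using z1 False by (simp add: zk)
  qed
qed

section \<open>Characters of the discrete torus and Fourier inversion\<close>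

definition dual_box :: "nat ^ 'd::finite \<Rightarrow> ('d \<Rightarrow> nat) set" where
  "dual_box N = PiE UNIV (\<lambda>j. {..<N $ j})"

definition torus_char :: "nat ^ 'd::finite \<Rightarrow> ('d \<Rightarrow> nat) \<Rightarrow> int ^ 'd \<Rightarrow> complex" where
  "torus_char N k x = (\<Prod>j\<in>UNIV. cis (2 * pi * real (k j) * of_int (x $ j) / real (N $ j)))"

definition torus_eigenvalue :: "nat ^ 'd::finite \<Rightarrow> ('d \<Rightarrow> nat) \<Rightarrow> real" where
  "torus_eigenvalue N k = (\<Sum>j\<in>UNIV. 2 - 2 * cos (2 * pi * real (k j) / real (N $ j)))"

lemma finite_dual_box [simp]: "finite (dual_box N)"
  unfolding dual_box_def by (intro finite_PiE) auto

lemma torus_char_add: "torus_char N k (x + y) = torus_char N k x * torus_char N k y"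
  unfolding torus_char_def prod.distrib[symmetric]
  by (intro prod.cong refl) (simp add: cis_mult add_divide_distrib ring_distribs)

lemma torus_char_axis:
  "torus_char N k (axis j m) = cis (2 * pi * real (k j) * of_int m / real (N $ j))"
proof -
  have "torus_char N k (axis j m) =
      (\<Prod>i\<in>UNIV. if i = j then cis (2 * pi * real (k j) * of_int m / real (N $ j)) else 1)"
    unfolding torus_char_def by (intro prod.cong refl) (auto simp: axis_def)
  then show ?thesis by simp
qed

lemma torus_char_minus_axis: "torus_char N k (x - axis j m) = torus_char N k x
    * torus_char N k (axis j (-m))"
proof -
  have "- axis j m = (axis j (-m) :: int ^ 'a)"
    by (simp add: vec_eq_iff axis_def)
  then show ?thesis
    by (metis diff_conv_add_uminus torus_char_add)
qed

lemma torus_char_periodic: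
  assumes "\<And>j. N $ j > 0"
  shows "torus_char N k \<in> torus_functions N"
proof -
  have "cis (2 * pi * real (k j) * real (N $ j) / real (N $ j)) = 1" for j
    using assms[of j] cis_multiple_2pi[of "real (k j)"] by simp
  then show ?thesis
    by (simp add: torus_functions_def torus_char_add torus_char_axis)
qed

lemma lattice_laplacian_torus_char:
  "lattice_laplacian (torus_char N k) x = complex_of_real (torus_eigenvalue N k) * torus_char N k x"
proof -
  have "2 * torus_char N k x - torus_char N k (x + axis j 1) - torus_char N k (x - axis j 1)
      = complex_of_real (2 - 2 * cos (2 * pi * real (k j) / real (N $ j))) * torus_char N k x" for j
    unfolding torus_char_add torus_char_minus_axis torus_char_axis
    by (simp add: complex_eq_iff algebra_simps)
  then show ?thesis
    unfolding lattice_laplacian_def torus_eigenvalue_def by (simp add: sum_distrib_right)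
qed

lemma torus_char_orthogonality:
  assumes "\<And>j. N $ j > 0"
  shows "(\<Sum>k\<in>dual_box N. torus_char N k x) =
           (if \<forall>j. int (N $ j) dvd x $ j then complex_of_real (torus_volume N) else 0)"
proof -
  have "(\<Sum>k\<in>dual_box N. torus_char N k x) =
     (\<Prod>j\<in>UNIV. \<Sum>k<N $ j. cis (2 * pi * real k * of_int (x $ j) / real (N $ j)))"
    unfolding torus_char_def dual_box_def by (subst prod_sum_PiE) auto
  also have "\<dots> = (\<Prod>j\<in>UNIV. if int (N $ j) dvd x $ j then of_nat (N $ j) else 0)"
    using assms by (intro prod.cong refl sum_cis_multiples)
  also have "\<dots> = (if \<forall>j. int (N $ j) dvd x $ j then complex_of_real (torus_volume N) else 0)"
    by (auto simp: torus_volume_def prod_zero_iff)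
  finally show ?thesis .
qed

text \<open>Positions and characters are indexed by the same box because the torus is isomorphic to
  its dual group; this map reads an index as a lattice point.\<close>

definition box_point :: "('d::finite \<Rightarrow> nat) \<Rightarrow> int ^ 'd" where
  "box_point k = (\<chi> j. int (k j))"

lemma torus_functions_shift:
  assumes f: "f \<in> torus_functions N"
  shows "f (x + (\<Sum>j\<in>S. axis j (int (N $ j) * c j))) = f x"
proof -
  have nat: "f (x + axis j (int (N $ j) * int m)) = f x" for x j m
  proof (induction m)
    case 0
    have "axis j 0 = (0 :: int ^ 'a)" by (simp add: axis_eq_0_iff)
    then show ?case by (simp only: of_nat_0 mult_zero_right add_0_right)
  next
    case (Suc m)
    have "x + axis j (int (N $ j) * int (Suc m))
        = (x + axis j (int (N $ j) * int m)) + axis j (int (N $ j))"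
      by (simp add: vec_eq_iff axis_def algebra_simps)
    then show ?case using f Suc by (simp only: torus_functions_def mem_Collect_eq)
  qed
  have int: "f (x + axis j (int (N $ j) * c)) = f x" for x j c
  proof (cases "c \<ge> 0")
    case True
    then show ?thesis using nat[of x j "nat c"] by simp
  next
    case False
    have "x = (x + axis j (int (N $ j) * c)) + axis j (int (N $ j) * int (nat (- c)))"
      using False by (simp add: vec_eq_iff axis_def)
    then show ?thesis using nat[of "x + axis j (int (N $ j) * c)" j "nat (- c)"] by metis
  qed
  show ?thesis
  proof (induction S arbitrary: x rule: infinite_finite_induct)
    case (insert j S)
    have "f (x + (\<Sum>j\<in>insert j S. axis j (int (N $ j) * c j)))
       = f ((x + axis j (int (N $ j) * c j)) + (\<Sum>j\<in>S. axis j (int (N $ j) * c j)))"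
      using insert by (simp add: add.assoc)
    then show ?case using insert int by simp
  qed auto
qed

lemma torus_functions_cong:
  assumes f: "f \<in> torus_functions N" and "\<And>j. int (N $ j) dvd x $ j - y $ j"
  shows "f x = f y"
proof -
  obtain c where c: "\<And>j. x $ j - y $ j = int (N $ j) * c j"
    using assms(2) unfolding dvd_def by metis
  have comp: "(\<Sum>j\<in>UNIV. axis j (int (N $ j) * c j)) $ i = int (N $ i) * c i" for i
    by (simp add: sum_component axis_def if_distrib[of "\<lambda>z. z = _"] cong: if_cong)
  have "x = y + (\<Sum>j\<in>UNIV. axis j (int (N $ j) * c j))"
    unfolding vec_eq_iff vector_add_component comp using c by (simp add: algebra_simps)
  then show ?thesis using torus_functions_shift[OF f, of y c UNIV] by simp
qed

definition fourier_coeff :: "nat ^ 'd::finite \<Rightarrow> (int ^ 'd \<Rightarrow> complex) \<Rightarrow> ('d \<Rightarrow> nat) \<Rightarrow> complex" where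
  "fourier_coeff N f k =
     (\<Sum>y\<in>dual_box N. f (box_point y) * torus_char N k (- box_point y)) / torus_volume N"

lemma torus_volume_pos: "(\<And>j. N $ j > 0) \<Longrightarrow> torus_volume N > 0"
  unfolding torus_volume_def by (intro prod_pos) auto

text \<open>After the sums are exchanged, the inner sum over characters is the volume at the one box
  point congruent to \<open>x\<close> and zero at all others; periodicity then replaces that point
  by \<open>x\<close>.\<close>

lemma fourier_expansion:
  assumes N: "\<And>j. N $ j > 0" and f: "f \<in> torus_functions N"
  shows "f = (\<Sum>k\<in>dual_box N. fun_scale (fourier_coeff N f k) (torus_char N k))"
proof
  fix x :: "int ^ 'a"
  define y0 where "y0 = (\<lambda>j. nat (x $ j mod int (N $ j)))"
  have y0: "y0 \<in> dual_box N"
    using N by (auto simp: y0_def dual_box_def nat_less_iff)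
  have uniq: "(\<forall>j. int (N $ j) dvd x $ j - box_point y $ j) \<longleftrightarrow> y = y0" if "y \<in> dual_box N" for y
  proof
    assume h: "\<forall>j. int (N $ j) dvd x $ j - box_point y $ j"
    show "y = y0"
    proof
      fix j
      have "x $ j mod int (N $ j) = int (y j) mod int (N $ j)"
        using h by (simp add: box_point_def mod_eq_dvd_iff)
      also have "\<dots> = int (y j)" using that by (auto simp: dual_box_def PiE_iff)
      finally show "y j = y0 j" by (simp add: y0_def)
    qed
  next
    assume "y = y0"
    then show "\<forall>j. int (N $ j) dvd x $ j - box_point y $ j"
      using N by (auto simp: y0_def box_point_def minus_mod_eq_mult_div)
  qed
  have "(\<Sum>k\<in>dual_box N. fun_scale (fourier_coeff N f k) (torus_char N k)) x
      = (\<Sum>k\<in>dual_box N. \<Sum>y\<in>dual_box N. f (box_point y) * torus_char N k (x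
          - box_point y)) / torus_volume N"
    unfolding sum_fun_scale_apply fourier_coeff_def
    by (simp add: sum_distrib_right sum_distrib_left sum_divide_distrib
        torus_char_add[of N _ x "- box_point _", simplified] mult_ac)
  also have "\<dots> = (\<Sum>y\<in>dual_box N. f (box_point y) * (\<Sum>k\<in>dual_box N. torus_char N k (x
      - box_point y))) / torus_volume N"
    by (subst sum.swap) (simp add: sum_distrib_left)
  also have "\<dots> = (\<Sum>y\<in>dual_box N. if y = y0 then f (box_point y0)
      * torus_volume N else 0) / torus_volume N"
    unfolding torus_char_orthogonality[OF N]
    by (intro arg_cong2[where f = "(/)"] sum.cong refl) (use uniq in auto)
  also have "\<dots> = f (box_point y0)"
    using y0 torus_volume_pos[OF N] by simp
  also have "\<dots> = f x"
    using uniq[OF y0] by (intro torus_functions_cong[OF f]) (metis dvd_minus_iff minus_diff_eq)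
  finally show "f x = (\<Sum>k\<in>dual_box N. fun_scale (fourier_coeff N f k) (torus_char N k)) x" ..
qed

text \<open>The phase is symmetric in position and frequency, so the sum over positions splits into
  the same root-of-unity sums; two indices below \<open>N $ j\<close> are congruent modulo
  \<open>N $ j\<close> only if they are equal.\<close>

lemma fourier_coeff_torus_char:
  assumes N: "\<And>j. N $ j > 0" and "k \<in> dual_box N" "l \<in> dual_box N"
  shows "fourier_coeff N (torus_char N k) l = (if k = l then 1 else 0)"
proof -
  have "torus_char N k (box_point y) * torus_char N l (- box_point y)
      = (\<Prod>j\<in>UNIV. cis (2 * pi * real (y j) * of_int (int (k j) - int (l j)) / real (N $ j)))" for y
    unfolding torus_char_def prod.distrib[symmetric] box_point_def
    by (intro prod.cong refl) (simp add: cis_mult diff_divide_distrib[symmetric] algebra_simps)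
  then have "(\<Sum>y\<in>dual_box N. torus_char N k (box_point y) * torus_char N l (- box_point y))
      = (\<Prod>j\<in>UNIV. \<Sum>y<N $ j. cis (2 * pi * real y * of_int (int (k j) - int (l j)) / real (N $ j)))"
    unfolding dual_box_def by (subst prod_sum_PiE) auto
  also have "\<dots> = (\<Prod>j\<in>UNIV. if int (N $ j) dvd int (k j) - int (l j) then of_nat (N $ j) else 0)"
    using N by (intro prod.cong refl sum_cis_multiples)
  also have "\<dots> = (\<Prod>j\<in>UNIV. if k j = l j then of_nat (N $ j) else 0)"
  proof (intro prod.cong refl if_cong)
    fix j
    have "int (k j) mod int (N $ j) = int (k j)" "int (l j) mod int (N $ j) = int (l j)"
      using assms by (auto simp: dual_box_def PiE_iff)
    then show "(int (N $ j) dvd int (k j) - int (l j)) = (k j = l j)"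
      by (metis mod_eq_dvd_iff of_nat_eq_iff)
  qed
  also have "\<dots> = (if k = l then complex_of_real (torus_volume N) else 0)"
    by (auto simp: torus_volume_def prod_zero_iff fun_eq_iff)
  finally show ?thesis
    using torus_volume_pos[OF N] by (auto simp: fourier_coeff_def)
qed

lemma fourier_coeff_sum:
  "fourier_coeff N (\<Sum>k\<in>A. fun_scale (c k) (g k)) l = (\<Sum>k\<in>A. c k * fourier_coeff N (g k) l)"
  unfolding fourier_coeff_def sum_fun_scale_apply sum_distrib_right
  by (subst sum.swap) (simp add: sum_divide_distrib sum_distrib_left mult.assoc)

lemma fourier_coeff_combination:
  assumes N: "\<And>j. N $ j > 0" and A: "A \<subseteq> dual_box N" and l: "l \<in> dual_box N"
  shows "fourier_coeff N (\<Sum>k\<in>A. fun_scale (c k) (torus_char N k)) l = (if l \<in> A then c l else 0)"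
proof -
  have fin: "finite A" using A finite_subset finite_dual_box by blast
  have "fourier_coeff N (\<Sum>k\<in>A. fun_scale (c k) (torus_char N k)) l
     = (\<Sum>k\<in>A. c k * (if k = l then 1 else 0))"
    unfolding fourier_coeff_sum
    by (intro sum.cong refl) (use A fourier_coeff_torus_char[OF N _ l] in auto)
  then show ?thesis using fin by (simp add: if_distrib cong: if_cong)
qed

lemma inj_on_torus_char:
  assumes N: "\<And>j. N $ j > 0"
  shows "inj_on (torus_char N) (dual_box N)"
  by (rule inj_onI) (metis fourier_coeff_torus_char[OF N] zero_neq_one)

section \<open>Eigenspaces, multiplicities and the product formulas\<close>

definition eigen_indices :: "nat ^ 'd::finite \<Rightarrow> real \<Rightarrow> ('d \<Rightarrow> nat) set" where
  "eigen_indices N \<Lambda> = {k \<in> dual_box N. torus_eigenvalue N k = \<Lambda>}"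

lemma lattice_laplacian_sum:
  "lattice_laplacian (\<Sum>k\<in>A. fun_scale (c k) (g k)) x = (\<Sum>k\<in>A. c k * lattice_laplacian (g k) x)"
proof -
  have "lattice_laplacian (\<Sum>k\<in>A. fun_scale (c k) (g k)) x
    = (\<Sum>j\<in>UNIV. \<Sum>k\<in>A. c k * (2 * g k x - g k (x + axis j 1) - g k (x - axis j 1)))"
    unfolding lattice_laplacian_def sum_fun_scale_apply
    by (intro sum.cong refl)
      (simp add: right_diff_distrib sum_subtractf sum_distrib_left mult.left_commute)
  also have "\<dots> = (\<Sum>k\<in>A. c k * lattice_laplacian (g k) x)"
    unfolding lattice_laplacian_def by (subst sum.swap) (simp add: sum_distrib_left)
  finally show ?thesis .
qed

text \<open>For the inclusion into the span: the Laplacian minus \<Lambda> multiplies the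
  coefficient at \<open>k\<close> by \<open>torus_eigenvalue N k\<close> minus \<Lambda>. It
  annihilates an eigenfunction, so by uniqueness of the coefficients only indices with eigenvalue
  \<Lambda> survive.\<close>

lemma laplace_eigenspace_eq_span:
  assumes N: "\<And>j. N $ j > 0"
  shows "laplace_eigenspace N \<Lambda> = FS.span (torus_char N ` eigen_indices N \<Lambda>)"
proof
  show "laplace_eigenspace N \<Lambda> \<subseteq> FS.span (torus_char N ` eigen_indices N \<Lambda>)"
  proof
    fix f assume "f \<in> laplace_eigenspace N \<Lambda>"
    then have f: "f \<in> torus_functions N" and ev: "\<And>x. lattice_laplacian f x = \<Lambda> * f x"
      by (auto simp: laplace_eigenspace_def)
    define c where "c = fourier_coeff N f"
    have exp: "f = (\<Sum>k\<in>dual_box N. fun_scale (c k) (torus_char N k))"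
      unfolding c_def by (rule fourier_expansion[OF N f])
    have "(\<Sum>k\<in>dual_box N. fun_scale (c k * (complex_of_real (torus_eigenvalue N k)
        - \<Lambda>)) (torus_char N k))
        = (\<lambda>x. lattice_laplacian f x - \<Lambda> * f x)"
    proof
      fix x
      have "lattice_laplacian f x = (\<Sum>k\<in>dual_box N. c k * (torus_eigenvalue N k * torus_char N k x))"
        by (subst exp) (simp only: lattice_laplacian_sum lattice_laplacian_torus_char)
      moreover have "f x = (\<Sum>k\<in>dual_box N. c k * torus_char N k x)"
        by (subst exp) (simp only: sum_fun_scale_apply)
      ultimately show "(\<Sum>k\<in>dual_box N. fun_scale (c k * (complex_of_real (torus_eigenvalue N k)
          - \<Lambda>)) (torus_char N k)) x
         = lattice_laplacian f x - \<Lambda> * f x"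
        by (simp only: sum_fun_scale_apply) (simp add: sum_distrib_left sum_subtractf algebra_simps)
    qed
    then have z: "(\<Sum>k\<in>dual_box N. fun_scale (c k * (complex_of_real (torus_eigenvalue N k)
        - \<Lambda>)) (torus_char N k)) = (\<lambda>_. 0)"
      using ev by (simp add: fun_eq_iff)
    have c0: "c l = 0" if "l \<in> dual_box N" "l \<notin> eigen_indices N \<Lambda>" for l
    proof -
      have "c l * (complex_of_real (torus_eigenvalue N l) - \<Lambda>) = fourier_coeff N (\<lambda>_. 0) l"
        using fourier_coeff_combination[OF N subset_refl that(1), of "\<lambda>k. c k
            * (complex_of_real (torus_eigenvalue N k) - \<Lambda>)"]
        unfolding z using that by simp
      then show ?thesis using that by (auto simp: fourier_coeff_def eigen_indices_def)
    qed
    have "f = (\<Sum>k\<in>eigen_indices N \<Lambda>. fun_scale (c k) (torus_char N k))"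
      unfolding exp
      by (rule sum.mono_neutral_right) (use c0 in \<open>auto simp: eigen_indices_def fun_scale_def
          fun_eq_iff\<close>)
    then show "f \<in> FS.span (torus_char N ` eigen_indices N \<Lambda>)"
      by (metis (no_types, lifting) FS.span_sum FS.span_scale FS.span_base imageI)
  qed
next
  have sub: "FS.subspace (laplace_eigenspace N \<Lambda>)"
    by (auto simp: FS.subspace_def laplace_eigenspace_def torus_functions_def lattice_laplacian_def
        fun_scale_def algebra_simps sum.distrib sum_subtractf sum_distrib_left)
  have "torus_char N ` eigen_indices N \<Lambda> \<subseteq> laplace_eigenspace N \<Lambda>"
    using torus_char_periodic[OF N]
    by (auto simp: laplace_eigenspace_def eigen_indices_def lattice_laplacian_torus_char)
  then show "FS.span (torus_char N ` eigen_indices N \<Lambda>) \<subseteq> laplace_eigenspace N \<Lambda>"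
    using sub FS.span_minimal by blast
qed

lemma independent_torus_char:
  assumes N: "\<And>j. N $ j > 0" and A: "A \<subseteq> dual_box N"
  shows "FS.independent (torus_char N ` A)"
proof -
  have fin: "finite A" using A finite_subset finite_dual_box by blast
  have inj: "inj_on (torus_char N) A" using inj_on_torus_char[OF N] A inj_on_subset by blast
  show ?thesis
  proof (rule FS.independent_if_scalars_zero)
    show "finite (torus_char N ` A)" using fin by simp
    fix c g assume z: "(\<Sum>x\<in>torus_char N ` A. fun_scale (c x) x) = 0" and "g \<in> torus_char N ` A"
    then obtain l where l: "l \<in> A" "g = torus_char N l" by blast
    have "(\<Sum>k\<in>A. fun_scale (c (torus_char N k)) (torus_char N k)) = 0"
      using z by (subst (asm) sum.reindex[OF inj]) (simp add: o_def)
    then have "c (torus_char N l) = fourier_coeff N 0 l"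
      using fourier_coeff_combination[OF N A, of l "\<lambda>k. c (torus_char N k)"] l A by auto
    then show "c g = 0" using l by (simp add: fourier_coeff_def)
  qed
qed

lemma laplace_mult_eq_card:
  assumes N: "\<And>j. N $ j > 0"
  shows "laplace_mult N \<Lambda> = card (eigen_indices N \<Lambda>)"
proof -
  have sub: "eigen_indices N \<Lambda> \<subseteq> dual_box N" by (auto simp: eigen_indices_def)
  have "laplace_mult N \<Lambda> = card (torus_char N ` eigen_indices N \<Lambda>)"
    unfolding laplace_mult_def laplace_eigenspace_eq_span[OF N]
    by (rule FS.dim_span_eq_card_independent[OF independent_torus_char[OF N sub]])
  also have "\<dots> = card (eigen_indices N \<Lambda>)"
    using inj_on_torus_char[OF N] sub by (intro card_image) (rule inj_on_subset)
  finally show ?thesis .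
qed

lemma laplace_spectrum_eq:
  assumes N: "\<And>j. N $ j > 0"
  shows "laplace_spectrum N = torus_eigenvalue N ` dual_box N"
proof (intro equalityI subsetI)
  fix \<Lambda> assume "\<Lambda> \<in> laplace_spectrum N"
  then obtain f where f: "f \<in> FS.span (torus_char N ` eigen_indices N \<Lambda>)" "f \<noteq> (\<lambda>_. 0)"
    unfolding laplace_spectrum_def laplace_eigenspace_eq_span[OF N] by auto
  have "eigen_indices N \<Lambda> \<noteq> {}"
  proof
    assume "eigen_indices N \<Lambda> = {}"
    then show False using f by (simp add: zero_fun_def)
  qed
  then show "\<Lambda> \<in> torus_eigenvalue N ` dual_box N" by (auto simp: eigen_indices_def)
next
  fix \<Lambda> assume "\<Lambda> \<in> torus_eigenvalue N ` dual_box N"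
  then obtain k where k: "k \<in> eigen_indices N \<Lambda>" by (auto simp: eigen_indices_def)
  have "torus_char N k 0 = 1" by (simp add: torus_char_def)
  then have "torus_char N k \<noteq> (\<lambda>_. 0)" by (metis zero_neq_one)
  moreover have "torus_char N k \<in> laplace_eigenspace N \<Lambda>"
    unfolding laplace_eigenspace_eq_span[OF N] using k by (intro FS.span_base) simp
  ultimately show "\<Lambda> \<in> laplace_spectrum N" by (auto simp: laplace_spectrum_def)
qed

lemma torus_theta_eq_sum:
  assumes N: "\<And>j. N $ j > 0"
  shows "torus_theta N t = (\<Sum>k\<in>dual_box N. exp (- torus_eigenvalue N k * t))"
proof -
  have "torus_theta N t = (\<Sum>\<Lambda>\<in>torus_eigenvalue N ` dual_box N. \<Sum>k\<in>eigen_indices N \<Lambda>. exp (- \<Lambda> * t))"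
    unfolding torus_theta_def laplace_spectrum_eq[OF N] laplace_mult_eq_card[OF N] by simp
  also have "\<dots> = (\<Sum>\<Lambda>\<in>torus_eigenvalue N ` dual_box N. \<Sum>k\<in>{k \<in> dual_box N. torus_eigenvalue N k
      = \<Lambda>}. exp (- torus_eigenvalue N k * t))"
    by (intro sum.cong refl) (auto simp: eigen_indices_def)
  also have "\<dots> = (\<Sum>k\<in>dual_box N. exp (- torus_eigenvalue N k * t))"
    by (rule sum.image_gen[symmetric]) simp
  finally show ?thesis .
qed

lemma torus_theta_eq_prod:
  assumes N: "\<And>j. N $ j > 0"
  shows "torus_theta N t = (\<Prod>j\<in>UNIV. cycle_theta (N $ j) t)"
  unfolding torus_theta_eq_sum[OF N] cycle_theta_def torus_eigenvalue_def dual_box_def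
  by (subst prod_sum_PiE)
    (auto simp: exp_sum[symmetric] sum_distrib_right sum_negf[symmetric] left_diff_distrib)

lemma torus_eigenvalue_eq_0_iff:
  assumes N: "\<And>j. N $ j > 0" and k: "k \<in> dual_box N"
  shows "torus_eigenvalue N k = 0 \<longleftrightarrow> k = (\<lambda>_. 0)"
proof
  assume "torus_eigenvalue N k = 0"
  then have "\<forall>j\<in>UNIV. 2 - 2 * cos (2 * pi * real (k j) / real (N $ j)) = 0"
    unfolding torus_eigenvalue_def by (subst (asm) sum_nonneg_eq_0_iff) auto
  then have c: "cos (2 * pi * real (k j) / real (N $ j)) = 1" for j by auto
  show "k = (\<lambda>_. 0)"
  proof
    fix j
    obtain m :: int where "2 * pi * real (k j) / real (N $ j) = of_int m * 2 * pi"
      using c[of j] unfolding cos_one_2pi_int by blast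
    then have "real_of_int (int (k j)) = of_int (m * int (N $ j))" using N[of j]
        by (simp add: field_simps)
    then have "int (k j) = m * int (N $ j)" by linarith
    then have "int (k j) mod int (N $ j) = 0" by simp
    moreover have "k j < N $ j" using k by (auto simp: dual_box_def)
    ultimately show "k j = 0" by simp
  qed
qed (simp add: torus_eigenvalue_def)

lemma torus_eigenvalue_nonneg: "torus_eigenvalue N k \<ge> 0"
  unfolding torus_eigenvalue_def by (intro sum_nonneg) simp

lemma torus_det_eq_prod:
  assumes N: "\<And>j. N $ j > 0"
  shows "torus_det N = (\<Prod>k\<in>dual_box N - {\<lambda>_. 0}. torus_eigenvalue N k)"
proof -
  define B where "B = dual_box N - {\<lambda>_. 0}"
  have im: "torus_eigenvalue N ` B = laplace_spectrum N - {0}"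
    unfolding B_def laplace_spectrum_eq[OF N] using torus_eigenvalue_eq_0_iff[OF N]
    by (auto simp: torus_eigenvalue_def)
  have "torus_det N = (\<Prod>\<Lambda>\<in>torus_eigenvalue N ` B. \<Prod>k\<in>eigen_indices N \<Lambda>. \<Lambda>)"
    unfolding torus_det_def im laplace_mult_eq_card[OF N] by simp
  also have "\<dots> = (\<Prod>\<Lambda>\<in>torus_eigenvalue N ` B. \<Prod>k\<in>{k \<in> B. torus_eigenvalue N k
      = \<Lambda>}. torus_eigenvalue N k)"
  proof (intro prod.cong refl)
    fix \<Lambda> assume "\<Lambda> \<in> torus_eigenvalue N ` B"
    then have "\<Lambda> \<noteq> 0" unfolding im by auto
    moreover have "torus_eigenvalue N (\<lambda>_. 0) = 0" by (simp add: torus_eigenvalue_def)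
    ultimately show "eigen_indices N \<Lambda> = {k \<in> B. torus_eigenvalue N k = \<Lambda>}"
      by (auto simp: eigen_indices_def B_def)
  qed auto
  also have "\<dots> = (\<Prod>k\<in>B. torus_eigenvalue N k)"
    by (rule prod.image_gen[symmetric]) (simp add: B_def)
  finally show ?thesis unfolding B_def .
qed

lemma card_dual_box: "real (card (dual_box N)) = torus_volume N"
  unfolding dual_box_def torus_volume_def by (simp add: card_PiE)

lemma zero_in_dual_box: "(\<And>j. N $ j > 0) \<Longrightarrow> (\<lambda>_. 0) \<in> dual_box N"
  by (auto simp: dual_box_def)

section \<open>Walks on the cycle and on the line\<close>

lemma add_inverse_power:
  fixes z :: complex
  assumes "z \<noteq> 0"
  shows "(z + inverse z) ^ k = (\<Sum>a\<le>k. of_nat (k choose a) * z powi (2 * int a - int k))"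
  unfolding binomial_ring
proof (intro sum.cong refl)
  fix a assume "a \<in> {..k}"
  then have e: "2 * int a - int k = int a - int (k - a)" by auto
  have "z powi (2 * int a - int k) = z ^ a * inverse z ^ (k - a)"
    unfolding e using assms by (simp add: power_int_diff power_inverse divide_inverse)
  then show "of_nat (k choose a) * z ^ a * inverse z ^ (k - a)
      = of_nat (k choose a) * z powi (2 * int a - int k)" by simp
qed

text \<open>A walk of \<open>k\<close> steps on the line, \<open>a\<close> of them to the right,
  ends at \<open>2 * a - k\<close>, and \<open>k choose a\<close> walks do so. The divisibility
  selects the walks that close up on the cycle; \<open>r\<close> is the tilt.\<close>

definition cycle_walks :: "nat \<Rightarrow> real \<Rightarrow> nat \<Rightarrow> real" where
  "cycle_walks n r k = (\<Sum>a | a \<le> k \<and> int n dvd 2 * int a - int k.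
     real (k choose a) * exp (r * of_int (2 * int a - int k)))"

text \<open>
  Weighting a walk that ends at $x$ by $e^{rx}$ multiplies the $n$-th roots of unity by $e^r$.
\<close>

definition tilted_root :: "nat \<Rightarrow> real \<Rightarrow> nat \<Rightarrow> complex" where
  "tilted_root n r j = complex_of_real (exp r) * cis (2 * pi * real j / real n)"

lemma tilted_root_powi:
  "tilted_root n r j powi m =
     complex_of_real (exp (r * of_int m)) * cis (2 * pi * real j * of_int m / real n)"
proof -
  have "complex_of_real (exp r) powi m = complex_of_real (exp (r * of_int m))"
    by (metis exp_power_int mult.commute of_real_power_int)
  then show ?thesis
    unfolding tilted_root_def power_int_mult_distrib
    by (simp add: cis_power_int mult_ac)
qed

text \<open>The binomial expansion separates the tilt, which depends on the endpoint alone, from the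
  phase, whose sum over \<open>j\<close> is \<open>n\<close> or 0.\<close>

lemma sum_tilted_root_power:
  assumes "n > 0"
  shows "(\<Sum>j<n. (tilted_root n r j + inverse (tilted_root n r j)) ^ k)
           = complex_of_real (real n * cycle_walks n r k)"
proof -
  have nz: "tilted_root n r j \<noteq> 0" for j by (simp add: tilted_root_def)
  have "(\<Sum>j<n. (tilted_root n r j + inverse (tilted_root n r j)) ^ k)
    = (\<Sum>a\<le>k. of_nat (k choose a) * (complex_of_real (exp (r * of_int (2 * int a - int k))) *
        (\<Sum>j<n. cis (2 * pi * real j * of_int (2 * int a - int k) / real n))))"
    unfolding add_inverse_power[OF nz] tilted_root_powi
    by (subst sum.swap) (simp only: sum_distrib_left)
  also have "\<dots> = (\<Sum>a\<le>k. if int n dvd 2 * int a - int k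
       then complex_of_real (real n * (real (k choose a) * exp (r * of_int (2 * int a
           - int k)))) else 0)"
    unfolding sum_cis_multiples[OF assms] by (intro sum.cong refl) auto
  also have "\<dots> = (\<Sum>a | a \<le> k \<and> int n dvd 2 * int a - int k.
       complex_of_real (real n * (real (k choose a) * exp (r * of_int (2 * int a - int k)))))"
    by (subst sum.inter_filter[symmetric]) (auto intro: sum.cong)
  also have "\<dots> = complex_of_real (real n * cycle_walks n r k)"
    unfolding cycle_walks_def by (simp add: sum_distrib_left)
  finally show ?thesis .
qed

text \<open>The weights \<open>t^k / k!\<close> pass to continuous time, still without the
  normalising factor \<open>exp (- 2 * t)\<close>. The left side is real, so taking real parts on
  the right loses nothing.\<close>

lemma cycle_walks_sums:
  assumes "n > 0"
  shows "(\<lambda>k. t ^ k / fact k * (real n * cycle_walks n r k)) sums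
     (\<Sum>j<n. Re (exp (of_real t * (tilted_root n r j + inverse (tilted_root n r j)))))"
proof -
  let ?w = "\<lambda>j. tilted_root n r j + inverse (tilted_root n r j)"
  have "(\<lambda>k. (\<Sum>j<n. (of_real t * ?w j) ^ k /\<^sub>R fact k)) sums (\<Sum>j<n. exp (of_real t * ?w j))"
    by (intro sums_sum exp_converges)
  also have "(\<lambda>k. (\<Sum>j<n. (of_real t * ?w j) ^ k /\<^sub>R fact k))
      = (\<lambda>k. complex_of_real (t ^ k / fact k * (real n * cycle_walks n r k)))"
  proof
    fix k
    have "(\<Sum>j<n. (of_real t * ?w j) ^ k /\<^sub>R fact k) = of_real (t ^ k / fact k) * (\<Sum>j<n. ?w j ^ k)"
      unfolding sum_distrib_left
      by (intro sum.cong refl) (simp add: power_mult_distrib scaleR_conv_of_real divide_inverse)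
    then show "(\<Sum>j<n. (of_real t * ?w j) ^ k /\<^sub>R fact k)
        = complex_of_real (t ^ k / fact k * (real n * cycle_walks n r k))"
      unfolding sum_tilted_root_power[OF assms] by simp
  qed
  finally have "(\<lambda>k. Re (complex_of_real (t ^ k / fact k * (real n * cycle_walks n r k)))) sums
      Re (\<Sum>j<n. exp (of_real t * ?w j))"
    by (rule sums_Re)
  then show ?thesis by (simp only: Re_complex_of_real Re_sum)
qed

lemma Re_tilted_root: "Re (tilted_root n r j + inverse (tilted_root n r j)) = 2 * cosh r * cos (2 * pi
    * real j / real n)"
proof -
  have "inverse (tilted_root n r j) = complex_of_real (exp (- r)) * cis (- (2 * pi * real j / real n))"
    by (simp add: tilted_root_def exp_minus)
  then show ?thesis by (simp add: tilted_root_def cosh_def distrib_right)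
qed

lemma cycle_walks_sums_theta:
  assumes "n > 0"
  shows "(\<lambda>k. t ^ k / fact k * (real n * cycle_walks n 0 k)) sums (exp (2 * t) * cycle_theta n t)"
proof -
  have "tilted_root n 0 j + inverse (tilted_root n 0 j) = of_real (2 * cos (2 * pi
      * real j / real n))" for j
    by (simp add: tilted_root_def complex_eq_iff)
  then have "Re (exp (of_real t * (tilted_root n 0 j + inverse (tilted_root n 0 j))))
      = exp (2 * t) * exp (- (2 - 2 * cos (2 * pi * real j / real n)) * t)" for j
    by (simp only: of_real_mult[symmetric] exp_of_real Re_complex_of_real exp_add[symmetric])
      (simp add: algebra_simps)
  then show ?thesis
    using cycle_walks_sums[OF assms, of t 0] by (simp add: cycle_theta_def sum_distrib_left)
qed

text \<open>The real part of an exponential is at most the exponential of the real part, here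
  \<open>2 * t * cosh r * cos x\<close>. Splitting \<open>cosh r\<close> into
  \<open>1 + (cosh r - 1)\<close> and bounding the cosine by 1 in the second part only leaves the
  untilted theta function as a factor.\<close>

lemma suminf_cycle_walks_le:
  assumes "n > 0" "t \<ge> 0"
  shows "(\<Sum>k. t ^ k / fact k * (real n * cycle_walks n r k))
     \<le> exp (2 * t * (cosh r - 1)) * (exp (2 * t) * cycle_theta n t)"
proof -
  have "(\<Sum>k. t ^ k / fact k * (real n * cycle_walks n r k))
    = (\<Sum>j<n. Re (exp (of_real t * (tilted_root n r j + inverse (tilted_root n r j)))))"
    using cycle_walks_sums[OF assms(1)] by (rule sums_unique[symmetric])
  also have "\<dots> \<le> (\<Sum>j<n. exp (2 * t * (cosh r - 1)) *
       (exp (2 * t) * exp (- (2 - 2 * cos (2 * pi * real j / real n)) * t)))"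
  proof (intro sum_mono)
    fix j
    let ?c = "cos (2 * pi * real j / real n)"
    have "Re (exp (of_real t * (tilted_root n r j + inverse (tilted_root n r j))))
        \<le> exp (Re (of_real t * (tilted_root n r j + inverse (tilted_root n r j))))"
      by (metis complex_Re_le_cmod norm_exp_eq_Re)
    also have "\<dots> = exp (t * (2 * cosh r * ?c))"
      using Re_tilted_root[of n r j] by (simp add: Re_complex_of_real)
    also have "\<dots> \<le> exp (2 * t * (cosh r - 1) + 2 * t * ?c)"
    proof -
      have "t * (cosh r - 1) * ?c \<le> t * (cosh r - 1) * 1"
        using assms(2) cosh_real_ge_1[of r] by (intro mult_left_mono) auto
      then show ?thesis by (simp add: algebra_simps)
    qed
    also have "\<dots> = exp (2 * t * (cosh r - 1)) * (exp (2 * t) * exp (- (2 - 2 * ?c) * t))"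
      by (simp only: exp_add[symmetric]) (simp add: algebra_simps)
    finally show "Re (exp (of_real t * (tilted_root n r j + inverse (tilted_root n r j)))) \<le> \<dots>" .
  qed
  also have "\<dots> = exp (2 * t * (cosh r - 1)) * (exp (2 * t) * cycle_theta n t)"
    by (simp add: cycle_theta_def sum_distrib_left)
  finally show ?thesis .
qed

section \<open>Closed walks on the line and the Bessel function\<close>

definition closed_walks :: "nat \<Rightarrow> real" where
  "closed_walks k = (\<Sum>a | a \<le> k \<and> 2 * int a - int k = 0. real (k choose a))"

lemma integral_cos_int:
  fixes m :: int
  shows "(LBINT x:{0..pi}. cos (of_int m * x)) = (if m = 0 then pi else 0)"
proof (cases "m = 0")
  case True
  then show ?thesis by (simp add: set_integral_const)
next
  case False
  have "(LBINT x:{0..pi}. cos (of_int m * x)) = (LBINT x=ereal 0..ereal pi. cos (of_int m * x))"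
    by (simp add: interval_integral_Icc)
  also have "\<dots> = sin (of_int m * pi) / of_int m - sin (of_int m * 0) / of_int m"
    by (rule interval_integral_FTC_finite)
      (use False in \<open>auto intro!: continuous_intros derivative_eq_intros simp:
          has_real_derivative_iff_has_vector_derivative[symmetric]\<close>)
  also have "\<dots> = 0" by (simp add: sin_times_pi_eq_0)
  finally show ?thesis using False by simp
qed

lemma two_cos_power: "(2 * cos x) ^ k = (\<Sum>a\<le>k. real (k choose a) * cos (of_int (2 * int a - int k)
    * x))"
proof -
  have "complex_of_real ((2 * cos x) ^ k) = (cis x + inverse (cis x)) ^ k"
    by (simp add: complex_eq_iff[of "2 * _"] flip: of_real_power) (simp add: complex_eq_iff)
  also have "\<dots> = (\<Sum>a\<le>k. of_nat (k choose a) * cis (of_int (2 * int a - int k) * x))"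
    by (subst add_inverse_power) (simp_all add: cis_power_int)
  finally have "Re (complex_of_real ((2 * cos x) ^ k)) = Re \<dots>" by (rule arg_cong)
  then show ?thesis by simp
qed

lemma integral_two_cos_power: "(LBINT x:{0..pi}. (2 * cos x) ^ k) = pi * closed_walks k"
proof -
  have int: "set_integrable lborel {0..pi} (\<lambda>x. real (k choose a) * cos (of_int (2 * int a - int k)
      * x))" for a
    by (intro borel_integrable_atLeastAtMost') (auto intro!: continuous_intros)
  have "(LBINT x:{0..pi}. (2 * cos x) ^ k) =
      (\<Sum>a\<le>k. LBINT x:{0..pi}. real (k choose a) * cos (of_int (2 * int a - int k) * x))"
    unfolding set_lebesgue_integral_def two_cos_power scaleR_sum_right
    by (rule Bochner_Integration.integral_sum) (use int in \<open>simp only: set_integrable_def\<close>)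
  also have "\<dots> = (\<Sum>a\<le>k. real (k choose a) * (if 2 * int a - int k = 0 then pi else 0))"
    by (simp only: set_integral_mult_right integral_cos_int)
  also have "\<dots> = (\<Sum>a | a \<le> k \<and> 2 * int a - int k = 0. real (k choose a) * pi)"
    by (rule sum.mono_neutral_cong_right) auto
  also have "\<dots> = pi * closed_walks k"
    unfolding closed_walks_def by (simp add: sum_distrib_left mult.commute)
  finally show ?thesis .
qed

text \<open>The exponential series of \<open>exp (2 * t * cos x)\<close> is integrated term by term,
  which the bound \<open>(2 * |t|)^k / k!\<close> on the summands permits; the moments of
  \<open>2 * cos x\<close> count the closed walks.\<close>

lemma closed_walks_sums_Bessel: "(\<lambda>k. t ^ k / fact k * closed_walks k) sums Bessel_I 0 (2 * t)"
proof -
  let ?f = "\<lambda>k x. indicator {0..pi} x *\<^sub>R (t ^ k / fact k * (2 * cos x) ^ k)"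
  have int: "integrable lborel (?f k)" for k
  proof -
    have "set_integrable lborel {0..pi} (\<lambda>x. t ^ k / fact k * (2 * cos x) ^ k)"
      by (intro borel_integrable_atLeastAtMost' continuous_intros)
    then show ?thesis by (simp only: set_integrable_def)
  qed
  have bnd: "norm (?f k x) \<le> indicator {0..pi} x * ((2 * \<bar>t\<bar>) ^ k / fact k)" for k x
  proof -
    have "\<bar>2 * cos x\<bar> ^ k \<le> 2 ^ k"
      by (intro power_mono) (auto simp: abs_mult)
    then have "\<bar>t\<bar> ^ k / fact k * \<bar>2 * cos x\<bar> ^ k \<le> \<bar>t\<bar> ^ k / fact k * 2 ^ k"
      by (intro mult_left_mono) auto
    moreover have "norm (t ^ k / fact k * (2 * cos x) ^ k) = \<bar>t\<bar> ^ k / fact k * \<bar>2 * cos x\<bar> ^ k"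
      by (simp only: real_norm_def abs_mult abs_divide power_abs abs_of_nonneg[OF fact_ge_zero])
    moreover have "(2 * \<bar>t\<bar>) ^ k / fact k = \<bar>t\<bar> ^ k / fact k * 2 ^ k"
      by (simp add: power_mult_distrib)
    ultimately show ?thesis
      by (cases "x \<in> {0..pi}") (simp_all only: indicator_simps norm_scaleR, simp_all)
  qed
  have sum: "summable (\<lambda>k. (2 * \<bar>t\<bar>) ^ k / fact k)"
    using summable_exp[of "2 * \<bar>t\<bar>"] by (simp add: divide_inverse mult.commute)
  have "(\<lambda>k. integral\<^sup>L lborel (?f k)) sums (\<integral>x. (\<Sum>k. ?f k x) \<partial>lborel)"
  proof (rule sums_integral[OF int])
    show "AE x in lborel. summable (\<lambda>k. norm (?f k x))"
    proof (rule AE_I2)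
      fix x
      have "summable (\<lambda>k. indicator {0..pi} x * ((2 * \<bar>t\<bar>) ^ k / fact k))" using sum
          by (rule summable_mult)
      then show "summable (\<lambda>k. norm (?f k x))"
        by (rule summable_comparison_test') (use bnd in simp)
    qed
    show "summable (\<lambda>k. \<integral>x. norm (?f k x) \<partial>lborel)"
    proof (rule summable_comparison_test')
      show "summable (\<lambda>k. pi * ((2 * \<bar>t\<bar>) ^ k / fact k))" using sum by (rule summable_mult)
      fix k :: nat
      have "(\<integral>x. norm (?f k x) \<partial>lborel) \<le> (\<integral>x. indicator {0..pi} x * ((2 * \<bar>t\<bar>) ^ k / fact k) \<partial>lborel)"
        using bnd int by (intro integral_mono integrable_norm integrable_mult_left)
            (auto intro!: integrable_real_indicator)
      then show "norm (\<integral>x. norm (?f k x) \<partial>lborel) \<le> pi * ((2 * \<bar>t\<bar>) ^ k / fact k)"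
        by simp
    qed
  qed
  moreover have "integral\<^sup>L lborel (?f k) = pi * (t ^ k / fact k * closed_walks k)" for k
  proof -
    have "integral\<^sup>L lborel (?f k) = (LBINT x:{0..pi}. t ^ k / fact k * (2 * cos x) ^ k)"
      by (simp only: set_lebesgue_integral_def)
    then show ?thesis
      by (simp only: set_integral_mult_right integral_two_cos_power mult.left_commute)
  qed
  moreover have "(\<Sum>k. ?f k x) = indicator {0..pi} x *\<^sub>R (exp (2 * t * cos x) * cos (of_int 0 * x))"
      for x
  proof -
    have "(\<lambda>k. t ^ k / fact k * (2 * cos x) ^ k) sums exp (2 * t * cos x)"
      using exp_converges[of "2 * t * cos x"] by (simp add: power_mult_distrib divide_inverse mult_ac)
    then have "(\<lambda>k. ?f k x) sums (indicator {0..pi} x *\<^sub>R exp (2 * t * cos x))"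
      by (rule sums_scaleR_right)
    then show ?thesis using sums_unique by fastforce
  qed
  ultimately have "(\<lambda>k. pi * (t ^ k / fact k * closed_walks k)) sums (LBINT x:{0..pi}. exp (2 * t
      * cos x) * cos (of_int 0 * x))"
    by (simp add: set_lebesgue_integral_def)
  then have "(\<lambda>k. 1 / pi * (pi * (t ^ k / fact k * closed_walks k))) sums
     (1 / pi * (LBINT x:{0..pi}. exp (2 * t * cos x) * cos (of_int 0 * x)))"
    by (rule sums_mult)
  then show ?thesis by (simp add: Bessel_I_def)
qed

text \<open>
  A walk that ends at a nonzero multiple $x$ of $n$ satisfies $1 \le e^{-rn}(e^{rx} + e^{-rx})$.
\<close>

lemma cycle_walks_minus_closed:
  assumes "n > 0" "r \<ge> 0"
  shows "closed_walks k \<le> cycle_walks n 0 k"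
    and "cycle_walks n 0 k - closed_walks k \<le> exp (- r * real n) * (cycle_walks n r k
        + cycle_walks n (- r) k)"
proof -
  let ?A = "{a. a \<le> k \<and> int n dvd 2 * int a - int k}"
  let ?B = "{a. a \<le> k \<and> 2 * int a - int k = 0}"
  have sub: "?B \<subseteq> ?A" by auto
  have eq: "cycle_walks n 0 k - closed_walks k = (\<Sum>a\<in>?A - ?B. real (k choose a))"
    unfolding cycle_walks_def closed_walks_def using sub
    by (subst sum_diff) auto
  show "closed_walks k \<le> cycle_walks n 0 k"
  proof -
    have "0 \<le> (\<Sum>a\<in>?A - ?B. real (k choose a))" by (intro sum_nonneg) simp
    then show ?thesis using eq by simp
  qed
  have "(\<Sum>a\<in>?A - ?B. real (k choose a)) \<le> (\<Sum>a\<in>?A - ?B. exp (- r * real n) *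
      (real (k choose a) * exp (r * of_int (2 * int a - int k)) + real (k choose a) * exp (- r
          * of_int (2 * int a - int k))))"
  proof (intro sum_mono)
    fix a assume "a \<in> ?A - ?B"
    then have "int n dvd 2 * int a - int k" "2 * int a - int k \<noteq> 0" by auto
    then have "int n \<le> \<bar>2 * int a - int k\<bar>"
      using dvd_imp_le_int[of "2 * int a - int k" "int n"] by simp
    then have le: "real n \<le> \<bar>of_int (2 * int a - int k)\<bar>" by linarith
    have "exp (r * real n) \<le> exp (r * \<bar>of_int (2 * int a - int k)\<bar>)"
      using le assms by (simp add: mult_left_mono)
    also have "\<dots> \<le> exp (r * of_int (2 * int a - int k)) + exp (- r * of_int (2 * int a - int k))"
      by (cases "(of_int (2 * int a - int k) :: real) \<ge> 0")
          (auto simp: abs_if simp del: of_int_diff of_int_mult)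
    finally have "exp (- r * real n) * exp (r * real n) \<le> exp (- r * real n) *
       (exp (r * of_int (2 * int a - int k)) + exp (- r * of_int (2 * int a - int k)))"
      by (intro mult_left_mono) auto
    then have "1 \<le> exp (- r * real n) *
       (exp (r * of_int (2 * int a - int k)) + exp (- r * of_int (2 * int a - int k)))"
      by (simp add: exp_minus)
    then have "real (k choose a) * 1 \<le> real (k choose a) * (exp (- r * real n) *
       (exp (r * of_int (2 * int a - int k)) + exp (- r * of_int (2 * int a - int k))))"
      by (intro mult_left_mono) auto
    then show "real (k choose a) \<le> exp (- r * real n) *
      (real (k choose a) * exp (r * of_int (2 * int a - int k)) + real (k choose a) * exp (- r
          * of_int (2 * int a - int k)))"
      by (simp add: algebra_simps)
  qed
  also have "\<dots> \<le> (\<Sum>a\<in>?A. exp (- r * real n) *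
      (real (k choose a) * exp (r * of_int (2 * int a - int k)) + real (k choose a) * exp (- r
          * of_int (2 * int a - int k))))"
    by (intro sum_mono2) auto
  also have "\<dots> = exp (- r * real n) * (cycle_walks n r k + cycle_walks n (- r) k)"
    unfolding cycle_walks_def by (simp add: sum_distrib_left sum.distrib distrib_left)
  finally show "cycle_walks n 0 k - closed_walks k \<le> exp (- r * real n) * (cycle_walks n r k
      + cycle_walks n (- r) k)"
    unfolding eq .
qed

lemma cycle_theta_heat_return_sums:
  assumes "n > 0"
  shows "(\<lambda>k. t ^ k / fact k * (real n * (cycle_walks n 0 k - closed_walks k))) sums
     (exp (2 * t) * (cycle_theta n t - real n * heat_return t))"
proof -
  have "(\<lambda>k. t ^ k / fact k * (real n * cycle_walks n 0 k) - real n * (t ^ k / fact k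
      * closed_walks k)) sums
     (exp (2 * t) * cycle_theta n t - real n * Bessel_I 0 (2 * t))"
    by (intro sums_diff sums_mult cycle_walks_sums_theta assms closed_walks_sums_Bessel)
  moreover have "exp (2 * t) * cycle_theta n t - real n * Bessel_I 0 (2 * t)
      = exp (2 * t) * (cycle_theta n t - real n * heat_return t)"
    by (simp add: heat_return_def exp_minus right_diff_distrib)
  moreover have "t ^ k / fact k * (real n * cycle_walks n 0 k) - real n * (t ^ k / fact k
      * closed_walks k)
      = t ^ k / fact k * (real n * (cycle_walks n 0 k - closed_walks k))" for k
    by (simp only: right_diff_distrib mult.left_commute)
  ultimately show ?thesis by (simp only:)
qed

lemma heat_return_le_cycle_theta:
  assumes "n > 0" "t \<ge> 0"
  shows "real n * heat_return t \<le> cycle_theta n t"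
proof -
  have "0 \<le> exp (2 * t) * (cycle_theta n t - real n * heat_return t)"
    using cycle_walks_minus_closed(1)[OF assms(1) order_refl] assms(2)
    by (intro sums_le[OF _ sums_zero cycle_theta_heat_return_sums[OF assms(1)]])
      (auto intro!: mult_nonneg_nonneg divide_nonneg_nonneg)
  then show ?thesis by (simp add: zero_le_mult_iff)
qed

text \<open>The factor 2 comes from using both tilts \<open>r\<close> and \<open>- r\<close>, since
  a nonzero endpoint may have either sign; \<open>cosh\<close> is even, so both obey the same
  bound.\<close>

lemma cycle_theta_minus_heat_return_le:
  assumes "n > 0" "t \<ge> 0" "r \<ge> 0"
  shows "cycle_theta n t - real n * heat_return t
     \<le> 2 * exp (2 * t * (cosh r - 1) - r * real n) * cycle_theta n t"
proof -
  let ?W = "\<lambda>r k. t ^ k / fact k * (real n * cycle_walks n r k)"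
  have sm: "?W r sums (\<Sum>k. ?W r k)" for r
    by (rule summable_sums[OF sums_summable[OF cycle_walks_sums[OF assms(1)]]])
  have "exp (2 * t) * (cycle_theta n t - real n * heat_return t) \<le> exp (- r * real n) * ((\<Sum>k. ?W r k)
      + (\<Sum>k. ?W (- r) k))"
  proof (rule sums_le[OF _ cycle_theta_heat_return_sums[OF assms(1)] sums_mult[OF sums_add[OF sm sm]]])
    fix k
    have "t ^ k / fact k * (real n * (cycle_walks n 0 k - closed_walks k)) \<le>
      t ^ k / fact k * (real n * (exp (- r * real n) * (cycle_walks n r k + cycle_walks n (- r) k)))"
      using assms cycle_walks_minus_closed(2)[OF assms(1,3)] by (intro mult_left_mono) auto
    then show "t ^ k / fact k * (real n * (cycle_walks n 0 k - closed_walks k)) \<le> exp (- r * real n)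
        * (?W r k + ?W (- r) k)"
      by (simp add: algebra_simps)
  qed
  also have "\<dots> \<le> exp (- r * real n) * (exp (2 * t * (cosh r - 1)) * (exp (2 * t) * cycle_theta n t)
      + exp (2 * t * (cosh r - 1)) * (exp (2 * t) * cycle_theta n t))"
    by (rule mult_left_mono[OF add_mono[OF suminf_cycle_walks_le[OF assms(1,2)]
          suminf_cycle_walks_le[OF assms(1,2), of "- r", unfolded cosh_minus]]]) simp
  also have "\<dots> = exp (2 * t) * (2 * exp (2 * t * (cosh r - 1) - r * real n) * cycle_theta n t)"
  proof -
    have "exp (2 * t * (cosh r - 1) - r * real n) = exp (- r * real n) * exp (2 * t * (cosh r - 1))"
      by (simp add: exp_add[symmetric])
    then show ?thesis by (simp only:) simp
  qed
  finally show ?thesis by (rule mult_left_le_imp_le) simp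
qed

section \<open>Estimates for the theta function of the cycle\<close>

text \<open>Jordan's inequality. If the sine were below the chord at an interior point, the
  difference would have a negative slope somewhere to the left of it and a positive slope somewhere
  to the right, but its slope \<open>cos x - 2 / pi\<close> is decreasing.\<close>

lemma sin_ge_chord:
  fixes y :: real
  assumes "0 \<le> y" "y \<le> pi / 2"
  shows "2 * y / pi \<le> sin y"
proof (rule ccontr)
  assume "\<not> ?thesis"
  then have neg: "sin y - 2 * y / pi < 0" by simp
  have "2 * (pi / 2) / pi = 1" by simp
  then have "y \<noteq> pi / 2" using neg sin_pi_half by fastforce
  moreover have "y \<noteq> 0" using neg by auto
  ultimately have y: "0 < y" "y < pi / 2" using assms by auto
  let ?g = "\<lambda>y. sin y - 2 * y / pi"
  have d: "(?g has_real_derivative cos x - 2 / pi) (at x)" for x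
    by (auto intro!: derivative_eq_intros)
  obtain a where a: "0 < a" "a < y" "?g y - ?g 0 = (y - 0) * (cos a - 2 / pi)"
    using MVT2[of 0 y ?g "\<lambda>x. cos x - 2 / pi"] y d by blast
  obtain b where b: "y < b" "b < pi / 2" "?g (pi / 2) - ?g y = (pi / 2 - y) * (cos b - 2 / pi)"
    using MVT2[of y "pi / 2" ?g "\<lambda>x. cos x - 2 / pi"] y d by blast
  have "y * (cos a - 2 / pi) < 0" using a neg by simp
  then have "cos a < 2 / pi" using y by (simp add: mult_less_0_iff)
  moreover have "(pi / 2 - y) * (cos b - 2 / pi) > 0" using b neg by simp
  then have "cos b > 2 / pi" using y by (simp add: zero_less_mult_iff)
  moreover have "cos b < cos a"
    using a b by (intro cos_monotone_0_pi) auto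
  ultimately show False by simp
qed

lemma cos_le_parabola:
  fixes x :: real
  assumes "\<bar>x\<bar> \<le> pi"
  shows "4 * x\<^sup>2 / pi\<^sup>2 \<le> 2 - 2 * cos x"
proof -
  have "2 * (\<bar>x\<bar> / 2) / pi \<le> sin (\<bar>x\<bar> / 2)"
    using assms by (intro sin_ge_chord) auto
  then have "(2 * (\<bar>x\<bar> / 2) / pi)\<^sup>2 \<le> (sin (\<bar>x\<bar> / 2))\<^sup>2"
    by (intro power_mono) auto
  moreover have "cos \<bar>x\<bar> = 1 - 2 * (sin (\<bar>x\<bar> / 2))\<^sup>2"
    using cos_double_sin[of "\<bar>x\<bar> / 2"] by simp
  then have "2 - 2 * cos x = 4 * (sin (\<bar>x\<bar> / 2))\<^sup>2" by simp
  ultimately show ?thesis by (simp add: power_divide)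
qed

lemma cosh_minus_1_le:
  fixes r :: real
  assumes "0 \<le> r" "r \<le> 1"
  shows "cosh r - 1 \<le> r\<^sup>2"
proof -
  have 1: "exp r \<le> 1 + r + r\<^sup>2" using assms by (intro exp_bound)
  have "1 \<le> exp r * (1 - r + r\<^sup>2)"
  proof -
    \<comment> \<open>The product equals \<open>1 + r^3\<close>.\<close>
    have "1 \<le> (1 + r) * (1 - r + r\<^sup>2)"
      using assms by (simp add: algebra_simps power2_eq_square)
    also have "\<dots> \<le> exp r * (1 - r + r\<^sup>2)"
      using assms exp_ge_add_one_self[of r] by (intro mult_right_mono) auto
    finally show ?thesis .
  qed
  then have "exp (- r) \<le> 1 - r + r\<^sup>2"
    by (simp add: exp_minus field_simps)
  with 1 have "(exp r + exp (- r)) / 2 \<le> 1 + r\<^sup>2" by simp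
  moreover have "cosh r = (exp r + exp (- r)) / 2" by (simp add: cosh_def)
  ultimately show ?thesis by linarith
qed

lemma power_div_fact_le_exp:
  fixes y :: real
  assumes "y \<ge> 0"
  shows "y ^ m / fact m \<le> exp y"
proof -
  have "(\<Sum>k\<in>{m}. y ^ k /\<^sub>R fact k) \<le> (\<Sum>k. y ^ k /\<^sub>R fact k)"
    by (rule sum_le_suminf[OF summable_exp_generic]) (use assms in auto)
  also have "\<dots> = exp y" by (simp add: exp_def)
  finally have "(\<Sum>k\<in>{m}. y ^ k /\<^sub>R fact k) \<le> exp y" .
  then show ?thesis by (simp add: divide_inverse mult.commute)
qed

lemma exp_neg_le_fact:
  fixes y :: real
  assumes "y > 0"
  shows "exp (- y) \<le> fact m / y ^ m"
  using power_div_fact_le_exp[of y m] assms by (simp add: exp_minus field_simps)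

text \<open>On the positive and on the negative integers separately, \<open>|k| - 1\<close> is an
  injective index, so each half is a partial sum of a geometric series.\<close>

lemma sum_geometric_int_le:
  fixes q :: real
  assumes q: "0 \<le> q" "q < 1" and F: "finite F" "0 \<notin> F"
  shows "(\<Sum>k\<in>F. q ^ nat \<bar>k\<bar>) \<le> 2 * (q / (1 - q))"
proof -
  have half: "(\<Sum>k\<in>G. q ^ nat \<bar>k\<bar>) \<le> q / (1 - q)"
    if G: "finite G" "inj_on (\<lambda>k. nat \<bar>k\<bar> - 1) G" "0 \<notin> G" for G :: "int set"
  proof -
    have "(\<Sum>k\<in>G. q ^ nat \<bar>k\<bar>) = (\<Sum>m\<in>(\<lambda>k. nat \<bar>k\<bar> - 1) ` G. q * q ^ m)"
      unfolding sum.reindex[OF G(2)] o_def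
    proof (intro sum.cong refl)
      fix k assume "k \<in> G"
      then have "nat \<bar>k\<bar> = Suc (nat \<bar>k\<bar> - 1)" using G(3) by (cases "k = 0") auto
      then show "q ^ nat \<bar>k\<bar> = q * q ^ (nat \<bar>k\<bar> - 1)" by (metis power_Suc)
    qed
    also have "\<dots> \<le> (\<Sum>m. q * q ^ m)"
      by (rule sum_le_suminf) (use q G in \<open>auto intro!: summable_mult summable_geometric\<close>)
    also have "\<dots> = q / (1 - q)"
      using q by (simp add: suminf_mult suminf_geometric summable_geometric)
    finally show ?thesis .
  qed
  have "(\<Sum>k\<in>F. q ^ nat \<bar>k\<bar>) = (\<Sum>k\<in>{k\<in>F. k > 0} \<union> {k\<in>F. k < 0}. q ^ nat \<bar>k\<bar>)"
    using F by (intro sum.cong) (auto simp: less_le)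
  also have "\<dots> = (\<Sum>k\<in>{k\<in>F. k > 0}. q ^ nat \<bar>k\<bar>) + (\<Sum>k\<in>{k\<in>F. k < 0}. q ^ nat \<bar>k\<bar>)"
    using F by (intro sum.union_disjoint) auto
  also have "\<dots> \<le> q / (1 - q) + q / (1 - q)"
    using F by (intro add_mono half) (auto simp: inj_on_def)
  finally show ?thesis by simp
qed

text \<open>Since \<open>k^2\<close> is at least \<open>|k|\<close>, the sum is below a geometric
  one. The form of the bound serves both ends: it is at most \<open>2 / x\<close>, and exponentially
  small for large \<open>x\<close>.\<close>

lemma sum_exp_neg_square_le:
  fixes x :: real
  assumes x: "x > 0" and F: "finite F" "0 \<notin> F"
  shows "(\<Sum>k\<in>F. exp (- x * (of_int k)\<^sup>2)) \<le> 2 / (exp x - 1)"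
proof -
  have "(\<Sum>k\<in>F. exp (- x * (of_int k)\<^sup>2)) \<le> (\<Sum>k\<in>F. exp (- x) ^ nat \<bar>k\<bar>)"
  proof (intro sum_mono)
    fix k :: int
    have "\<bar>k\<bar> * 1 \<le> \<bar>k\<bar> * \<bar>k\<bar>"
    proof (cases "k = 0")
      case False
      then show ?thesis by (intro mult_left_mono) auto
    qed simp
    then have "real_of_int \<bar>k\<bar> \<le> of_int (\<bar>k\<bar> * \<bar>k\<bar>)" by linarith
    then have "of_int \<bar>k\<bar> \<le> (real_of_int k)\<^sup>2" by (simp add: power2_eq_square)
    then have "- x * (of_int k)\<^sup>2 \<le> of_nat (nat \<bar>k\<bar>) * (- x)" using x by simp
    then show "exp (- x * (of_int k)\<^sup>2) \<le> exp (- x) ^ nat \<bar>k\<bar>"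
      unfolding exp_of_nat_mult[symmetric] by simp
  qed
  also have "\<dots> \<le> 2 * (exp (- x) / (1 - exp (- x)))"
    using x F by (intro sum_geometric_int_le) auto
  also have "\<dots> = 2 / (exp x - 1)"
    using x by (simp add: exp_minus field_simps)
  finally show ?thesis .
qed

text \<open>With representatives nearest to 0, a frequency can be held fixed while \<open>n\<close>
  grows, and its angle stays in the interval from \<open>- pi\<close> to \<open>pi\<close> on which
  \<open>cos_le_parabola\<close> applies. One end is excluded so that \<open>n / 2\<close> is not
  counted twice for even \<open>n\<close>.\<close>

definition centered_residues :: "nat \<Rightarrow> int set" where
  "centered_residues n = {k. - int n < 2 * k \<and> 2 * k \<le> int n}"

lemma finite_centered_residues [simp]: "finite (centered_residues n)"
  by (rule finite_subset[of _ "{- int n..int n}"]) (auto simp: centered_residues_def)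

lemma cycle_theta_centered:
  assumes "n > 0"
  shows "cycle_theta n t =
    (\<Sum>k\<in>centered_residues n. exp (- (2 - 2 * cos (2 * pi * of_int k / real n)) * t))"
  unfolding cycle_theta_def
proof (rule sum.reindex_bij_witness[where i = "\<lambda>k. if k \<ge> 0 then nat k else nat (k + int n)"
      and j = "\<lambda>k. if 2 * k \<le> n then int k else int k - int n"])
  fix k assume "k \<in> {..<n}"
  have "cos (2 * pi * real_of_int (int k - int n) / real n) = cos (2 * pi * real k / real n - 2 * pi)"
    using assms by (simp add: field_simps)
  also have "\<dots> = cos (2 * pi * real k / real n)" by (simp add: cos_diff)
  finally show "exp (- (2 - 2 * cos (2 * pi * real_of_int (if 2 * k \<le> n then int k else int k
      - int n) / real n)) * t) =
         exp (- (2 - 2 * cos (2 * pi * real k / real n)) * t)" by simp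
qed (auto simp: centered_residues_def)

lemma exp_eigenvalue_le_gaussian:
  assumes "n > 0" "t \<ge> 0" "k \<in> centered_residues n"
  shows "exp (- (2 - 2 * cos (2 * pi * of_int k / real n)) * t) \<le> exp (- (16 * (t / (real n)\<^sup>2))
      * (of_int k)\<^sup>2)"
proof -
  have "\<bar>2 * k\<bar> \<le> int n" using assms(3) by (auto simp: centered_residues_def)
  then have "real_of_int \<bar>2 * k\<bar> \<le> real n" by linarith
  then have "\<bar>2 * pi * of_int k / real n\<bar> \<le> pi"
    using assms(1) by (simp add: abs_mult field_simps)
  \<comment> \<open>The constant 16 arises from
    \<open>4 * (2 * pi * k / n)^2 / pi^2 = 16 * k^2 / n^2\<close>.\<close>
  from cos_le_parabola[OF this] have "16 * (of_int k)\<^sup>2 / (real n)\<^sup>2 \<le> 2 - 2 * cos (2 * pi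
      * of_int k / real n)"
    by (simp add: power_divide power_mult_distrib)
  then have "16 * (of_int k)\<^sup>2 / (real n)\<^sup>2 * t \<le> (2 - 2 * cos (2 * pi * of_int k / real n)) * t"
    using assms(2) by (rule mult_right_mono)
  then show ?thesis by (simp add: algebra_simps)
qed

text \<open>The two upper bounds divide the work: one depends on the rescaled time alone, the other,
  the number of eigenvalues, stays finite as \<open>t\<close> tends to 0.\<close>

lemma cycle_theta_bounds:
  assumes "n > 0" "t > 0"
  shows "1 \<le> cycle_theta n t" "cycle_theta n t \<le> 1 + 2 / (exp (16 * (t / (real n)\<^sup>2)) - 1)"
    "cycle_theta n t \<le> real n"
proof -
  let ?R = "centered_residues n"
  let ?f = "\<lambda>k::int. exp (- (2 - 2 * cos (2 * pi * of_int k / real n)) * t)"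
  have 0: "0 \<in> ?R" using assms by (simp add: centered_residues_def)
  have eq: "cycle_theta n t = 1 + sum ?f (?R - {0})"
    unfolding cycle_theta_centered[OF assms(1)] by (subst sum.remove[OF _ 0]) auto
  show "1 \<le> cycle_theta n t" unfolding eq by (simp add: sum_nonneg)
  have "sum ?f (?R - {0}) \<le> (\<Sum>k\<in>?R - {0}. exp (- (16 * (t / (real n)\<^sup>2)) * (of_int k)\<^sup>2))"
    using assms by (intro sum_mono exp_eigenvalue_le_gaussian) auto
  also have "\<dots> \<le> 2 / (exp (16 * (t / (real n)\<^sup>2)) - 1)"
    using assms by (intro sum_exp_neg_square_le) auto
  finally show "cycle_theta n t \<le> 1 + 2 / (exp (16 * (t / (real n)\<^sup>2)) - 1)" unfolding eq by simp
  have "cycle_theta n t \<le> (\<Sum>k<n. 1)"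
    unfolding cycle_theta_def using assms by (intro sum_mono)
        (auto intro!: mult_nonneg_nonneg simp: mult_nonpos_nonneg)
  then show "cycle_theta n t \<le> real n" by simp
qed

lemma theta_tail_le:
  fixes s :: real
  assumes "s > 0"
  shows "2 / (exp (16 * s) - 1) \<le> 1 / (8 * s)"
proof -
  have "exp (16 * s) - 1 \<ge> 16 * s" using exp_ge_add_one_self[of "16 * s"] by linarith
  then have "2 / (exp (16 * s) - 1) \<le> 2 / (16 * s)" using assms by (intro divide_left_mono) auto
  then show ?thesis by simp
qed

text \<open>
  The two cases use the tilt $r = t^{-1/2}$ for $t \ge 1$ and $r = 1 - \ln t$ for $t < 1$.
\<close>

lemma cycle_theta_minus_heat_return_le_power:
  "\<exists>C\<ge>0. \<forall>n t. n \<ge> K \<longrightarrow> n > 0 \<longrightarrow> t > 0 \<longrightarrow>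
      cycle_theta n t - real n * heat_return t \<le> C * (t / (real n)\<^sup>2) ^ K"
proof -
  define C1 :: real where "C1 = 2 * exp 2 * (fact (2 * K) + fact (2 * K + 2)) "
  define C2 :: real where "C2 = 2 * exp (exp 1 + 1) * fact (2 * K + 1)"
  have C: "C1 \<ge> 0" "C2 \<ge> 0" by (auto simp: C1_def C2_def)
  have "cycle_theta n t - real n * heat_return t \<le> (C1 + C2) * (t / (real n)\<^sup>2) ^ K"
    if n: "n \<ge> K" "n > 0" and t: "t > 0" for n t
  proof (cases "t \<ge> 1")
    case True
    define s where "s = t / (real n)\<^sup>2"
    have s: "s > 0" using t n by (simp add: s_def)
    define y where "y = real n / sqrt t"
    have y: "y > 0" using t n by (simp add: y_def)
    \<comment> \<open>\<open>y\<close> is \<open>s^(-1/2)\<close>, so decay in \<open>y\<close>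
      becomes a power of the rescaled time at half the exponent.\<close>
    have ys: "1 / y ^ (2 * m) = s ^ m" for m
      using t n by (simp add: y_def s_def power_mult power_divide)
    have "2 * t * (cosh (1 / sqrt t) - 1) \<le> 2 * t * (1 / sqrt t)\<^sup>2"
      using t True by (intro mult_left_mono cosh_minus_1_le) auto
    also have "\<dots> = 2" using t by (simp add: power_divide)
    finally have e: "2 * t * (cosh (1 / sqrt t) - 1) - 1 / sqrt t * real n \<le> 2 - y" by (simp add: y_def)
    have "cycle_theta n t - real n * heat_return t
        \<le> 2 * exp (2 * t * (cosh (1 / sqrt t) - 1) - 1 / sqrt t * real n) * cycle_theta n t"
      using t n by (intro cycle_theta_minus_heat_return_le) auto
    also have "\<dots> \<le> 2 * exp (2 - y) * (1 + 1 / (8 * s))"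
      using e cycle_theta_bounds(1,2)[OF n(2) t] theta_tail_le[OF s]
      by (intro mult_mono) (auto simp: s_def)
    also have "\<dots> = 2 * exp 2 * (exp (- y) + exp (- y) / (8 * s))"
      by (simp add: exp_diff exp_minus field_simps)
    also have "\<dots> \<le> 2 * exp 2 * (fact (2 * K) * s ^ K + fact (2 * K + 2) * s ^ K)"
    proof (intro mult_left_mono add_mono)
      show "exp (- y) \<le> fact (2 * K) * s ^ K"
        using exp_neg_le_fact[OF y, of "2 * K"] ys[of K] by (simp add: divide_inverse)
      \<comment> \<open>Two further powers of \<open>1 / y\<close> give one further power of
        \<open>s\<close>, which absorbs the factor \<open>1 / s\<close> from the bound on
        theta.\<close>
      have "exp (- y) \<le> fact (2 * (K + 1)) * s ^ (K + 1)"
        using exp_neg_le_fact[OF y, of "2 * (K + 1)"] ys[of "K + 1"] by (simp add: divide_inverse)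
      then have "exp (- y) / (8 * s) \<le> fact (2 * (K + 1)) * s ^ (K + 1) / (8 * s)"
        using s by (intro divide_right_mono) auto
      also have "\<dots> = fact (2 * K + 2) * s ^ K / 8" using s by simp
      also have "\<dots> \<le> fact (2 * K + 2) * s ^ K" using s by (simp add: divide_le_eq)
      finally show "exp (- y) / (8 * s) \<le> fact (2 * K + 2) * s ^ K" .
    qed auto
    also have "\<dots> = C1 * s ^ K" by (simp add: C1_def algebra_simps)
    also have "\<dots> \<le> (C1 + C2) * s ^ K" using C s by (intro mult_right_mono) auto
    finally show ?thesis unfolding s_def .
  next
    case False
    define r where "r = 1 - ln t"
    have r: "r \<ge> 0" "exp r = exp 1 / t" "exp (- r) = t / exp 1" 
      using False t ln_le_minus_one[OF t] by (auto simp: r_def exp_diff exp_minus)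
    \<comment> \<open>This tilt makes \<open>t * exp r\<close> constant, so the exponent stays
      bounded while \<open>exp (- r * n)\<close> becomes \<open>(t / e)^n\<close>.\<close>
    have "2 * t * (cosh r - 1) \<le> 2 * t * cosh r" using t by simp
    also have "\<dots> = exp 1 + t * (t / exp 1)"
      unfolding cosh_def r using t by (simp add: field_simps)
    also have "t * (t / exp 1) \<le> 1 * 1"
      using t False exp_ge_add_one_self[of "1::real"] by (intro mult_mono) (auto simp: divide_le_eq)
    finally have e: "2 * t * (cosh r - 1) - r * real n \<le> (exp 1 + 1) - r * real n" by simp
    \<comment> \<open>Here \<open>n \<ge> K\<close> is essential: for small \<open>t\<close> the
      difference really has order \<open>t^n\<close>.\<close>
    have "t ^ n \<le> t ^ K" using n t False by (intro power_decreasing) auto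
    have "cycle_theta n t - real n * heat_return t
        \<le> 2 * exp (2 * t * (cosh r - 1) - r * real n) * cycle_theta n t"
      using t n r by (intro cycle_theta_minus_heat_return_le) auto
    also have "\<dots> \<le> 2 * exp (exp 1 + 1 - r * real n) * real n"
      using e cycle_theta_bounds(1,3)[OF n(2) t] by (intro mult_mono) auto
    also have "\<dots> = 2 * exp (exp 1 + 1) * (real n * exp (- r * real n))"
      by (simp add: exp_diff exp_minus field_simps)
    also have "exp (- r * real n) = exp (- real n) * t ^ n"
    proof -
      have "exp (- r * real n) = exp (- r) ^ n" by (simp add: exp_of_nat_mult[symmetric] mult.commute)
      also have "\<dots> = t ^ n / exp (real n)" unfolding r
          by (simp add: power_divide exp_of_nat_mult[symmetric])
      finally show ?thesis by (simp only: exp_minus divide_inverse mult.commute)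
    qed
    \<comment> \<open>Of the \<open>2 * K + 1\<close> powers of \<open>1 / n\<close>, one cancels
      the factor \<open>n\<close> and the rest form \<open>(1 / n^2)^K\<close>.\<close>
    also have "real n * (exp (- real n) * t ^ n) \<le> real n * (fact (2 * K + 1) / real n ^ (2 * K + 1)
        * t ^ K)"
      using n t \<open>t ^ n \<le> t ^ K\<close> exp_neg_le_fact[of "real n" "2 * K + 1"]
          by (intro mult_left_mono mult_mono) auto
    also have "\<dots> = fact (2 * K + 1) * (t / (real n)\<^sup>2) ^ K"
      using n by (simp add: power_divide power_mult[symmetric])
    finally have "cycle_theta n t - real n * heat_return t \<le> C2 * (t / (real n)\<^sup>2) ^ K"
      by (simp add: C2_def mult.assoc)
    also have "\<dots> \<le> (C1 + C2) * (t / (real n)\<^sup>2) ^ K" using C t by (intro mult_right_mono) auto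
    finally show ?thesis .
  qed
  then show ?thesis using C by (intro exI[of _ "C1 + C2"]) auto
qed

section \<open>The return probability of the line\<close>

lemma gaussian_half_integrable:
  fixes a :: real
  assumes "a > 0"
  shows "integrable lborel (\<lambda>y. indicator {0..} y * exp (- (a * y)\<^sup>2))"
    "(\<integral>y. indicator {0..} y * exp (- (a * y)\<^sup>2) \<partial>lborel) = sqrt pi / (2 * a)"
proof -
  let ?g = "\<lambda>x::real. indicator {0..} x * exp (- x\<^sup>2) :: real"
  have g: "integrable lborel ?g" "integral\<^sup>L lborel ?g = sqrt pi / 2"
    using gaussian_moment_0 by (auto simp: has_bochner_integral_iff)
  have ind: "indicator {0..} (a * y) = (indicator {0..} y :: real)" for y
    using assms by (auto simp: indicator_def zero_le_mult_iff)
  show "integrable lborel (\<lambda>y. indicator {0..} y * exp (- (a * y)\<^sup>2))"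
    using lborel_integrable_real_affine[OF g(1), of a 0] assms by (simp add: ind)
  show "(\<integral>y. indicator {0..} y * exp (- (a * y)\<^sup>2) \<partial>lborel) = sqrt pi / (2 * a)"
    using lborel_integral_real_affine[of a ?g 0] g(2) assms by (simp add: ind)
qed

text \<open>The integrand of the return probability after the substitution
  \<open>x = y / sqrt t\<close>, which brings it to a Gaussian scale independent of
  \<open>t\<close>.\<close>

definition rescaled_heat_integrand :: "real \<Rightarrow> real \<Rightarrow> real" where
  "rescaled_heat_integrand t y = indicator {0..pi} (y / sqrt t) * exp (- (2 - 2 * cos (y / sqrt t))
      * t)"

lemma sqrt_times_heat_return:
  assumes "t > 0"
  shows "sqrt t * heat_return t = 1 / pi * (\<integral>y. rescaled_heat_integrand t y \<partial>lborel)"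
proof -
  have "heat_return t = 1 / pi * (LBINT x:{0..pi}. exp (- 2 * t) * (exp (2 * t * cos x)
      * cos (of_int 0 * x)))"
    by (simp add: heat_return_def Bessel_I_def)
  also have "\<dots> = 1 / pi * (\<integral>x. indicator {0..pi} x * exp (- (2 - 2 * cos x) * t) \<partial>lborel)"
    unfolding set_lebesgue_integral_def by (simp add: exp_add[symmetric] algebra_simps)
  also have "(\<integral>x. indicator {0..pi} x * exp (- (2 - 2 * cos x) * t) \<partial>lborel)
      = \<bar>1 / sqrt t\<bar> *\<^sub>R (\<integral>y. indicator {0..pi} (0 + 1 / sqrt t * y) * exp (- (2 - 2 * cos (0
          + 1 / sqrt t * y)) * t) \<partial>lborel)"
    by (rule lborel_integral_real_affine) (use assms in auto)
  also have "\<dots> = 1 / sqrt t * (\<integral>y. rescaled_heat_integrand t y \<partial>lborel)"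
    using assms by (simp add: rescaled_heat_integrand_def)
  finally show ?thesis using assms by simp
qed

lemma rescaled_heat_integrand_bound:
  assumes "t > 0"
  shows "0 \<le> rescaled_heat_integrand t y"
    "rescaled_heat_integrand t y \<le> indicator {0..} y * exp (- (2 / pi * y)\<^sup>2)"
proof -
  show "rescaled_heat_integrand t y \<le> indicator {0..} y * exp (- (2 / pi * y)\<^sup>2)"
  proof (cases "y / sqrt t \<in> {0..pi}")
    case True
    then have "y \<ge> 0" using assms by (auto simp: zero_le_divide_iff)
    have "4 * (y / sqrt t)\<^sup>2 / pi\<^sup>2 * t \<le> (2 - 2 * cos (y / sqrt t)) * t"
      using True assms by (intro mult_right_mono cos_le_parabola) auto
    then have "(2 / pi * y)\<^sup>2 \<le> (2 - 2 * cos (y / sqrt t)) * t"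
      using assms by (simp add: power_divide power_mult_distrib field_simps)
    then have "- (2 - 2 * cos (y / sqrt t)) * t \<le> - (2 / pi * y)\<^sup>2" by linarith
    then show ?thesis using \<open>y \<ge> 0\<close> True by (simp add: rescaled_heat_integrand_def)
  qed (simp add: rescaled_heat_integrand_def)
qed (simp add: rescaled_heat_integrand_def)

lemma borel_measurable_rescaled_heat_integrand [measurable]:
  "rescaled_heat_integrand t \<in> borel_measurable borel"
  unfolding rescaled_heat_integrand_def by measurable

lemma heat_return_bound:
  assumes "t > 0"
  shows "0 \<le> heat_return t" "heat_return t \<le> 1 / sqrt t"
proof -
  have "0 \<le> sqrt t * heat_return t"
    unfolding sqrt_times_heat_return[OF assms] using rescaled_heat_integrand_bound[OF assms] by simp
  then show "0 \<le> heat_return t" using assms by (simp add: zero_le_mult_iff)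
  have int: "integrable lborel (\<lambda>y. indicator {0..} y * exp (- (2 / pi * y)\<^sup>2))"
    by (rule gaussian_half_integrable) simp
  have "integral\<^sup>L lborel (rescaled_heat_integrand t) \<le> (\<integral>y. indicator {0..} y * exp (- (2 / pi
      * y)\<^sup>2) \<partial>lborel)"
    using rescaled_heat_integrand_bound[OF assms]
    by (intro integral_mono Bochner_Integration.integrable_bound[OF int]) auto
  also have "\<dots> = sqrt pi * pi / 4" by (subst gaussian_half_integrable) auto
  finally have "sqrt t * heat_return t \<le> 1 / pi * (sqrt pi * pi / 4)"
    unfolding sqrt_times_heat_return[OF assms] by (intro mult_left_mono) auto
  also have "\<dots> = sqrt pi / 4" by simp
  also have "\<dots> \<le> sqrt 16 / 4" using pi_less_4 by (intro divide_right_mono real_sqrt_le_mono) auto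
  finally have "sqrt t * heat_return t \<le> 1" by simp
  then show "heat_return t \<le> 1 / sqrt t" using assms by (simp add: field_simps)
qed

text \<open>The local limit theorem for the line, by Laplace's method at angle 0. Only half a
  Gaussian appears because the angle runs over \<open>{0..pi}\<close>.\<close>

lemma heat_return_asymp: "((\<lambda>t. sqrt t * heat_return t) \<longlongrightarrow> 1 / (2 * sqrt pi)) at_top"
proof -
  have "((\<lambda>t. integral\<^sup>L lborel (rescaled_heat_integrand t)) \<longlongrightarrow> (\<integral>y. indicator {0..} y * exp (- (1
      * y)\<^sup>2) \<partial>lborel)) at_top"
  proof (rule integral_dominated_convergence_at_top)
    show "integrable lborel (\<lambda>y. indicator {0..} y * exp (- (2 / pi * y)\<^sup>2))"
      by (rule gaussian_half_integrable) simp
    show "\<forall>\<^sub>F t in at_top. AE y in lborel. norm (rescaled_heat_integrand t y) \<le> indicator {0..} y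
        * exp (- (2 / pi * y)\<^sup>2)"
      using eventually_gt_at_top[of 0] by eventually_elim (use rescaled_heat_integrand_bound in auto)
    show "AE y in lborel. ((\<lambda>t. rescaled_heat_integrand t y) \<longlongrightarrow> indicator {0..} y * exp (- (1
        * y)\<^sup>2)) at_top"
    proof (rule AE_I2)
      fix y :: real
      consider "y < 0" | "y = 0" | "y > 0" by linarith
      then show "((\<lambda>t. rescaled_heat_integrand t y) \<longlongrightarrow> indicator {0..} y * exp (- (1 * y)\<^sup>2)) at_top"
      proof cases
        case 1
        have "\<forall>\<^sub>F t in at_top. rescaled_heat_integrand t y = 0"
          using eventually_gt_at_top[of 0]
          by eventually_elim (use 1 in \<open>auto simp: rescaled_heat_integrand_def zero_le_divide_iff\<close>)
        then show ?thesis using 1 by (simp add: tendsto_eventually)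
      next
        case 2
        then show ?thesis by (simp add: rescaled_heat_integrand_def)
      next
        case 3
        have "((\<lambda>t. exp (- (2 - 2 * cos (y / sqrt t)) * t)) \<longlongrightarrow> exp (- y\<^sup>2)) at_top"
          unfolding power2_eq_square using 3 by real_asymp
        moreover have "\<forall>\<^sub>F t in at_top. y / sqrt t \<le> pi" using 3 by real_asymp
        then have "\<forall>\<^sub>F t in at_top. exp (- (2 - 2 * cos (y / sqrt t)) * t)
            = rescaled_heat_integrand t y"
          using eventually_gt_at_top[of 0]
          by eventually_elim (use 3 in \<open>simp add: rescaled_heat_integrand_def\<close>)
        ultimately show ?thesis using 3 by (simp add: tendsto_cong)
      qed
    qed
  qed auto
  then have "((\<lambda>t. 1 / pi * integral\<^sup>L lborel (rescaled_heat_integrand t)) \<longlongrightarrow> 1 / pi * (sqrt pi / (2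
      * 1))) at_top"
    by (subst (asm) gaussian_half_integrable) (simp_all only: zero_less_one tendsto_mult_left)
  moreover have "\<forall>\<^sub>F t in at_top. 1 / pi * integral\<^sup>L lborel (rescaled_heat_integrand t) = sqrt t
      * heat_return t"
    using eventually_gt_at_top[of 0] by eventually_elim (simp add: sqrt_times_heat_return)
  moreover have "1 / pi * (sqrt pi / (2 * 1)) = 1 / (2 * sqrt pi)"
    by (simp add: field_simps)
  ultimately show ?thesis by (simp only: tendsto_cong)
qed

text \<open>This belongs to the circle of length 1; length \<alpha> is reached by dividing
  \<open>s\<close> by the square of \<alpha>.\<close>

definition circle_theta :: "real \<Rightarrow> real" where
  "circle_theta s = (\<Sum>\<^sub>\<infinity>k\<in>(UNIV :: int set). exp (- (2 * pi * of_int k)\<^sup>2 * s))"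

section \<open>The theta function of the circle\<close>

text \<open>Turns unordered sums into integrals for the counting measure, so that dominated
  convergence and Fubini apply to them.\<close>

lemma infsum_eq_integral_count_space:
  fixes f :: "'a \<Rightarrow> 'b::{banach,second_countable_topology}"
  assumes "(\<lambda>x. norm (f x)) summable_on A"
  shows "integrable (count_space A) f" "infsum f A = (\<integral>x. f x \<partial>count_space A)"
proof -
  have f: "Infinite_Set_Sum.abs_summable_on f A" using assms abs_summable_equivalent by blast
  then show "integrable (count_space A) f" by (simp add: Infinite_Set_Sum.abs_summable_on_def)
  show "infsum f A = (\<integral>x. f x \<partial>count_space A)"
    using infsetsum_infsum[OF f] by (simp add: infsetsum_def)
qed

lemma gaussian_sum_int:
  fixes x :: real
  assumes x: "x > 0"
  shows "(\<lambda>k::int. exp (- x * (of_int k)\<^sup>2)) summable_on UNIV"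
    "(\<Sum>\<^sub>\<infinity>k::int. exp (- x * (of_int k)\<^sup>2)) \<le> 1 + 2 / (exp x - 1)"
proof -
  have fin: "(\<Sum>k\<in>F. exp (- x * (of_int k)\<^sup>2)) \<le> 1 + 2 / (exp x - 1)" if "finite F" for F :: "int set"
  proof -
    have "(\<Sum>k\<in>F. exp (- x * (of_int k)\<^sup>2)) \<le> (\<Sum>k\<in>insert 0 (F - {0}). exp (- x * (of_int k)\<^sup>2))"
      using that by (intro sum_mono2) auto
    also have "\<dots> \<le> 1 + 2 / (exp x - 1)"
      using that sum_exp_neg_square_le[OF x, of "F - {0}"] by (subst sum.insert) auto
    finally show ?thesis .
  qed
  show 1: "(\<lambda>k::int. exp (- x * (of_int k)\<^sup>2)) summable_on UNIV"
    by (rule nonneg_bdd_above_summable_on) (use fin in \<open>auto intro!: bdd_aboveI2\<close>)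
  show "(\<Sum>\<^sub>\<infinity>k::int. exp (- x * (of_int k)\<^sup>2)) \<le> 1 + 2 / (exp x - 1)"
    by (rule infsum_le_finite_sums[OF 1]) (use fin in auto)
qed

lemma circle_theta_summable:
  assumes "s > 0"
  shows "(\<lambda>k::int. exp (- (2 * pi * of_int k)\<^sup>2 * s)) summable_on UNIV"
  using gaussian_sum_int(1)[of "(2 * pi)\<^sup>2 * s"] assms by (simp add: power_mult_distrib mult_ac)

lemma circle_theta_bounds:
  assumes s: "s > 0"
  shows "1 \<le> circle_theta s" "circle_theta s \<le> 1 + 2 / (exp (16 * s) - 1)"
proof -
  have "(\<Sum>k\<in>{0::int}. exp (- (2 * pi * of_int k)\<^sup>2 * s)) \<le> circle_theta s"
    unfolding circle_theta_def by (intro finite_sum_le_infsum circle_theta_summable s) auto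
  then show "1 \<le> circle_theta s" by simp
  have "circle_theta s \<le> (\<Sum>\<^sub>\<infinity>k::int. exp (- (16 * s) * (of_int k)\<^sup>2))"
    unfolding circle_theta_def
  proof (intro infsum_mono circle_theta_summable gaussian_sum_int s)
    fix k :: int
    \<comment> \<open>Weakening \<open>(2 * pi)^2\<close> to 16 gives the circle the same tail bound
      as the cycle.\<close>
    have "2\<^sup>2 * (2 * of_int k)\<^sup>2 * s \<le> pi\<^sup>2 * (2 * of_int k)\<^sup>2 * s"
      using s pi_ge_two by (intro mult_right_mono power_mono) auto
    then show "exp (- (2 * pi * of_int k)\<^sup>2 * s) \<le> exp (- (16 * s) * (of_int k)\<^sup>2)"
      by (simp add: power_mult_distrib mult_ac)
  qed (use s in auto)
  also have "\<dots> \<le> 1 + 2 / (exp (16 * s) - 1)" by (intro gaussian_sum_int) (use s in auto)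
  finally show "circle_theta s \<le> 1 + 2 / (exp (16 * s) - 1)" .
qed

lemma tendsto_square_times_cos: "((\<lambda>x::real. x\<^sup>2 * (2 - 2 * cos (c / x))) \<longlongrightarrow> c\<^sup>2) at_top"
proof -
  have pos: "((\<lambda>x::real. x\<^sup>2 * (2 - 2 * cos (c / x))) \<longlongrightarrow> c\<^sup>2) at_top" if "c > 0" for c
    unfolding power2_eq_square using that by real_asymp
  consider "c = 0" | "c > 0" | "- c > 0" by linarith
  then show ?thesis
  proof cases
    case 3
    show ?thesis using pos[OF 3] by simp
  qed (auto simp: pos)
qed

text \<open>Dominated convergence over the frequencies: each \<open>k\<close> is eventually a
  centered residue of \<open>n i\<close>, its decay rate times \<open>t i\<close> tends to
  \<open>(2 * pi * k)^2 * s\<close>, and a fixed Gaussian dominates.\<close>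

lemma cycle_theta_tendsto:
  fixes n :: "nat \<Rightarrow> nat" and t :: "nat \<Rightarrow> real"
  assumes n: "filterlim (\<lambda>i. real (n i)) at_top sequentially"
    and t: "(\<lambda>i. t i / (real (n i))\<^sup>2) \<longlonglongrightarrow> s" and s: "s > 0"
  shows "(\<lambda>i. cycle_theta (n i) (t i)) \<longlonglongrightarrow> circle_theta s"
proof -
  define f where "f i k = indicator (centered_residues (n i)) k *
     exp (- (2 - 2 * cos (2 * pi * of_int k / real (n i))) * t i)" for i k
  have "\<forall>\<^sub>F i in sequentially. real (n i) > 0"
      by (rule eventually_compose_filterlim[OF eventually_gt_at_top n])
  moreover have "\<forall>\<^sub>F i in sequentially. t i / (real (n i))\<^sup>2 > s / 2"
    using t s by (intro order_tendstoD) auto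
  ultimately have "\<forall>\<^sub>F i in sequentially. n i > 0 \<and> t i / (real (n i))\<^sup>2 > s / 2"
    by eventually_elim auto
  then obtain I where I: "\<And>i. i \<ge> I \<Longrightarrow> n i > 0 \<and> t i / (real (n i))\<^sup>2 > s / 2"
    unfolding eventually_sequentially by blast
  have int: "cycle_theta (n i) (t i) = (\<integral>k. f i k \<partial>count_space UNIV)" if "i \<ge> I" for i
  proof -
    have "(\<integral>k. f i k \<partial>count_space UNIV) = (\<Sum>k | f i k \<noteq> 0. f i k)"
      by (rule lebesgue_integral_count_space_finite_support[of UNIV, simplified])
        (rule finite_subset[OF _ finite_centered_residues[of "n i"]], auto simp: f_def indicator_def)
    also have "\<dots> = (\<Sum>k\<in>centered_residues (n i). f i k)"
      by (rule sum.mono_neutral_left) (auto simp: f_def indicator_def)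
    also have "\<dots> = cycle_theta (n i) (t i)"
      using I[OF that] by (simp add: cycle_theta_centered f_def)
    finally show ?thesis ..
  qed
  \<comment> \<open>The rate \<open>8 * s\<close> is 16 times the lower bound \<open>s / 2\<close>
    for the rescaled time, valid from \<open>I\<close> on.\<close>
  have bound: "norm (f i k) \<le> exp (- (8 * s) * (of_int k)\<^sup>2)" if "i \<ge> I" for i k
  proof (cases "k \<in> centered_residues (n i)")
    case True
    have ti: "t i / (real (n i))\<^sup>2 > s / 2" and ni: "n i > 0" using I[OF that] by auto
    have "t i > 0"
    proof (rule ccontr)
      assume "\<not> t i > 0"
      then have "t i / (real (n i))\<^sup>2 \<le> 0" by (simp add: divide_nonpos_nonneg)
      then show False using ti s by linarith
    qed
    then have "norm (f i k) \<le> exp (- (16 * (t i / (real (n i))\<^sup>2)) * (of_int k)\<^sup>2)"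
      using exp_eigenvalue_le_gaussian[OF ni _ True, of "t i"] True by (simp add: f_def)
    also have "\<dots> \<le> exp (- (8 * s) * (of_int k)\<^sup>2)"
    proof -
      have "8 * s * (real_of_int k)\<^sup>2 \<le> (16 * (t i / (real (n i))\<^sup>2)) * (of_int k)\<^sup>2"
        using ti by (intro mult_right_mono) auto
      then show ?thesis by simp
    qed
    finally show ?thesis .
  qed (simp add: f_def)
  have lim: "(\<lambda>i. f i k) \<longlonglongrightarrow> exp (- (2 * pi * of_int k)\<^sup>2 * s)" for k
  proof -
    have "(\<lambda>i. (real (n i))\<^sup>2 * (2 - 2 * cos (2 * pi * of_int k / real (n i)))) \<longlonglongrightarrow> (2 * pi * of_int k)\<^sup>2"
      using filterlim_compose[OF tendsto_square_times_cos n] .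
    then have "(\<lambda>i. exp (- ((real (n i))\<^sup>2 * (2 - 2 * cos (2 * pi * of_int k / real (n i))))
        * (t i / (real (n i))\<^sup>2)))
       \<longlonglongrightarrow> exp (- (2 * pi * of_int k)\<^sup>2 * s)"
      by (intro tendsto_intros t)
    moreover have "\<forall>\<^sub>F i in sequentially. real (n i) > 2 * \<bar>of_int k\<bar>"
        by (rule eventually_compose_filterlim[OF eventually_gt_at_top n])
    then have "\<forall>\<^sub>F i in sequentially.
      exp (- ((real (n i))\<^sup>2 * (2 - 2 * cos (2 * pi * of_int k / real (n i))))
          * (t i / (real (n i))\<^sup>2)) = f i k"
    proof eventually_elim
      case (elim i)
      then have "k \<in> centered_residues (n i)" by (auto simp: centered_residues_def)
      then show ?case using elim by (simp add: f_def left_diff_distrib)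
    qed
    ultimately show ?thesis by (rule Lim_transform_eventually)
  qed
  have "(\<lambda>i. \<integral>k. f (i + I) k \<partial>count_space UNIV) \<longlonglongrightarrow> (\<integral>k. exp (- (2 * pi * of_int k)\<^sup>2
      * s) \<partial>count_space UNIV)"
  proof (rule integral_dominated_convergence)
    show "integrable (count_space UNIV) (\<lambda>k::int. exp (- (8 * s) * (of_int k)\<^sup>2))"
      by (rule infsum_eq_integral_count_space) (use gaussian_sum_int(1)[of "8 * s"] s in simp)
    show "AE k in count_space UNIV. (\<lambda>i. f (i + I) k) \<longlonglongrightarrow> exp (- (2 * pi * of_int k)\<^sup>2 * s)"
      using LIMSEQ_ignore_initial_segment[OF lim] by simp
    show "AE k in count_space UNIV. norm (f (i + I) k) \<le> exp (- (8 * s) * (of_int k)\<^sup>2)" for i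
      using bound by simp
  qed auto
  also have "(\<integral>k. exp (- (2 * pi * of_int k)\<^sup>2 * s) \<partial>count_space UNIV) = circle_theta s"
    unfolding circle_theta_def
    by (rule infsum_eq_integral_count_space(2)[symmetric]) (use circle_theta_summable s in simp)
  also have "(\<lambda>i. \<integral>k. f (i + I) k \<partial>count_space UNIV) = (\<lambda>i. cycle_theta (n (i + I)) (t (i + I)))"
    using int by simp
  finally show ?thesis by (rule LIMSEQ_offset)
qed

lemma heat_return_scaled_tendsto:
  fixes n :: "nat \<Rightarrow> nat" and t :: "nat \<Rightarrow> real"
  assumes n: "filterlim (\<lambda>i. real (n i)) at_top sequentially"
    and t: "(\<lambda>i. t i / (real (n i))\<^sup>2) \<longlonglongrightarrow> s" and s: "s > 0"
  shows "(\<lambda>i. real (n i) * heat_return (t i)) \<longlonglongrightarrow> 1 / (2 * sqrt (pi * s))"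
proof -
  have n0: "\<forall>\<^sub>F i in sequentially. real (n i) > 0"
      by (rule eventually_compose_filterlim[OF eventually_gt_at_top n])
  have "filterlim (\<lambda>i. t i / (real (n i))\<^sup>2 * (real (n i))\<^sup>2) at_top sequentially"
    by (rule filterlim_tendsto_pos_mult_at_top[OF t s])
      (rule filterlim_pow_at_top[OF _ n], simp)
  moreover have "\<forall>\<^sub>F i in sequentially. t i / (real (n i))\<^sup>2 * (real (n i))\<^sup>2 = t i"
    using n0 by eventually_elim simp
  ultimately have tt: "filterlim t at_top sequentially"
    by (rule filterlim_mono_eventually[OF _ order_refl order_refl])
  \<comment> \<open>\<open>n\<close> is written as \<open>sqrt t / sqrt (t / n^2)\<close>, so that
    \<open>heat_return_asymp\<close> applies.\<close>
  have "(\<lambda>i. 1 / sqrt (t i / (real (n i))\<^sup>2) * (sqrt (t i) * heat_return (t i)))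
     \<longlonglongrightarrow> 1 / sqrt s * (1 / (2 * sqrt pi))"
    using s by (intro tendsto_mult tendsto_divide tendsto_real_sqrt t tendsto_const
        filterlim_compose[OF heat_return_asymp tt]) auto
  moreover have "\<forall>\<^sub>F i in sequentially. t i > 0"
      by (rule eventually_compose_filterlim[OF eventually_gt_at_top tt])
  with n0 have "\<forall>\<^sub>F i in sequentially. 1 / sqrt (t i / (real (n i))\<^sup>2) * (sqrt (t i)
      * heat_return (t i))
      = real (n i) * heat_return (t i)"
    by eventually_elim (simp add: real_sqrt_divide)
  ultimately have "(\<lambda>i. real (n i) * heat_return (t i)) \<longlonglongrightarrow> 1 / sqrt s * (1 / (2 * sqrt pi))"
    by (rule Lim_transform_eventually)
  then show ?thesis by (simp add: real_sqrt_mult mult_ac)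
qed

text \<open>Along \<open>t = s * n^2\<close> the ratio \<open>t / n^2\<close> is exactly
  \<open>s\<close>, so the estimates for the cycle pass to the limit with an unchanged constant, and
  \<open>n \<ge> K\<close> holds from some \<open>n\<close> on.\<close>

lemma circle_theta_heat_bounds:
  shows "s > 0 \<Longrightarrow> 1 / (2 * sqrt (pi * s)) \<le> circle_theta s"
    and "\<exists>C\<ge>0. \<forall>s>0. circle_theta s - 1 / (2 * sqrt (pi * s)) \<le> C * s ^ K"
proof -
  have n: "filterlim (\<lambda>i. real (Suc i)) at_top sequentially"
    by (rule filterlim_compose[OF filterlim_real_sequentially filterlim_Suc])
  have e: "s * (real (Suc i))\<^sup>2 / (real (Suc i))\<^sup>2 = s" for s :: real and i by simp
  have l1: "(\<lambda>i. cycle_theta (Suc i) (s * (real (Suc i))\<^sup>2)) \<longlonglongrightarrow> circle_theta s" if "s > 0" for s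
    by (rule cycle_theta_tendsto[OF n _ that]) (simp only: e tendsto_const)
  have l2: "(\<lambda>i. real (Suc i) * heat_return (s * (real (Suc i))\<^sup>2)) \<longlonglongrightarrow> 1 / (2 * sqrt (pi * s))"
      if "s > 0" for s
    by (rule heat_return_scaled_tendsto[OF n _ that]) (simp only: e tendsto_const)
  show "1 / (2 * sqrt (pi * s)) \<le> circle_theta s" if "s > 0"
    by (rule LIMSEQ_le[OF l2[OF that] l1[OF that]])
      (use that in \<open>auto intro!: heat_return_le_cycle_theta simp del: of_nat_Suc\<close>)
  obtain C where C: "C \<ge> 0" "\<And>n t. n \<ge> K \<Longrightarrow> n > 0 \<Longrightarrow> t > 0 \<Longrightarrow>
      cycle_theta n t - real n * heat_return t \<le> C * (t / (real n)\<^sup>2) ^ K"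
    using cycle_theta_minus_heat_return_le_power[of K] by blast
  have "circle_theta s - 1 / (2 * sqrt (pi * s)) \<le> C * s ^ K" if "s > 0" for s
  proof (rule LIMSEQ_le_const2[OF tendsto_diff[OF l1[OF that] l2[OF that]]])
    show "\<exists>I. \<forall>i\<ge>I. cycle_theta (Suc i) (s * (real (Suc i))\<^sup>2) - real (Suc i) * heat_return (s
        * (real (Suc i))\<^sup>2) \<le> C * s ^ K"
    proof (intro exI[of _ K] allI impI)
      fix i assume "i \<ge> K"
      then show "cycle_theta (Suc i) (s * (real (Suc i))\<^sup>2) - real (Suc i) * heat_return (s
          * (real (Suc i))\<^sup>2) \<le> C * s ^ K"
        using C(2)[of "Suc i" "s * (real (Suc i))\<^sup>2"] that unfolding e by auto
    qed
  qed
  then show "\<exists>C\<ge>0. \<forall>s>0. circle_theta s - 1 / (2 * sqrt (pi * s)) \<le> C * s ^ K"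
    using C(1) by blast
qed

section \<open>Dominated convergence on the torus\<close>

text \<open>Telescoping, one factor exchanged at a time. As \<open>M\<close> is at least 1, the
  natural exponent \<open>card S - 1\<close> is rounded up to \<open>card S\<close>, which keeps the
  induction uniform.\<close>

lemma abs_prod_diff_le:
  fixes x y :: "'a \<Rightarrow> real"
  assumes "finite S" "1 \<le> M" "\<And>j. j \<in> S \<Longrightarrow> \<bar>x j\<bar> \<le> M" "\<And>j. j \<in> S \<Longrightarrow> \<bar>y j\<bar> \<le> M"
    and "\<And>j. j \<in> S \<Longrightarrow> \<bar>x j - y j\<bar> \<le> e"
  shows "\<bar>prod x S - prod y S\<bar> \<le> real (card S) * M ^ card S * e"
  using assms(1,3-5)
proof (induction S rule: finite_induct)
  case (insert i S)
  have e: "0 \<le> e" using insert.prems(3)[of i] by simp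
  have py: "\<bar>prod y S\<bar> \<le> M ^ card S"
    unfolding abs_prod using insert.prems(2) by (intro prod_le_power) (use assms(2) in auto)
  have "prod x (insert i S) - prod y (insert i S) = x i * (prod x S - prod y S) + (x i - y i)
      * prod y S"
    using insert.hyps by (simp add: algebra_simps)
  also have "\<bar>\<dots>\<bar> \<le> \<bar>x i\<bar> * \<bar>prod x S - prod y S\<bar> + \<bar>x i - y i\<bar> * \<bar>prod y S\<bar>"
    by (metis abs_mult abs_triangle_ineq)
  also have "\<dots> \<le> M * (real (card S) * M ^ card S * e) + e * M ^ card S"
    using insert py e assms(2) by (intro add_mono mult_mono) auto
  also have "\<dots> \<le> M * (real (card S) * M ^ card S * e) + e * (M * M ^ card S)"
    using e assms(2) by (intro add_left_mono mult_left_mono) auto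
  also have "\<dots> = real (card (insert i S)) * M ^ card (insert i S) * e"
    using insert.hyps by (simp add: algebra_simps)
  finally show ?case .
qed simp

text \<open>A common majorant for all the integrals. The exponent comes from the slowest decay that
  occurs at infinity: a term \<open>s^(-1/2)\<close>, the heat term in dimension 1, divided by
  \<open>s\<close>.\<close>

definition dominating :: "real \<Rightarrow> real \<Rightarrow> real" where
  "dominating C s = (if s \<le> 1 then C else C * s powr (- 3 / 2))"

text \<open>Moves values known for the gauge integral to \<open>lborel\<close>; for a Borel function
  the completion of the measure changes nothing.\<close>

lemma set_integral_lborel_of_absolutely_integrable:
  fixes f :: "real \<Rightarrow> 'a::euclidean_space"
  assumes "f absolutely_integrable_on S" "S \<in> sets borel" "f \<in> borel_measurable borel" "(f
      has_integral I) S"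
  shows "set_integrable lborel S f" "(LBINT x:S. f x) = I"
proof -
  have meas: "(\<lambda>x. indicator S x *\<^sub>R f x) \<in> borel_measurable lborel" using assms(2,3) by measurable
  show "set_integrable lborel S f"
    using assms(1) integrable_completion[OF meas] by (simp add: set_integrable_def)
  have "(LBINT x:S. f x) = (LINT x:S|lebesgue. f x)"
    unfolding set_lebesgue_integral_def by (rule integral_completion[OF meas, symmetric])
  also have "\<dots> = integral S f" by (rule set_lebesgue_integral_eq_integral(2)[OF assms(1)])
  also have "\<dots> = I" using assms(4) by (rule integral_unique)
  finally show "(LBINT x:S. f x) = I" .
qed

lemma set_integral_powr_Ici:
  fixes a :: real
  assumes "a < - 1"
  shows "set_integrable lborel {1..} (\<lambda>s. s powr a)" "(LBINT s:{1..}. s powr a) = - 1 / (a + 1)"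
proof -
  have h: "((\<lambda>x. x powr a) has_integral - 1 / (a + 1)) {1..}"
    using has_integral_powr_to_inf[OF assms, of 1] by simp
  then have "(\<lambda>x. x powr a) absolutely_integrable_on {1..}"
    by (intro nonnegative_absolutely_integrable_1) auto
  from set_integral_lborel_of_absolutely_integrable[OF this _ _ h]
  show "set_integrable lborel {1..} (\<lambda>s. s powr a)" "(LBINT s:{1..}. s powr a) = - 1 / (a + 1)"
    by auto
qed

lemma dominating_integrable: "set_integrable lborel {0<..} (dominating C)"
proof -
  have "set_integrable lborel ({0<..1} \<union> {1<..}) (dominating C)"
  proof (rule set_integrable_Un)
    have "set_integrable lborel {0<..1::real} (\<lambda>_. C)"
      by (simp add: set_integrable_def)
    then show "set_integrable lborel {0<..1} (dominating C)"
      by (rule set_integrable_cong[THEN iffD1, rotated -1]) (auto simp: dominating_def)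
    have "set_integrable lborel {1..} (\<lambda>s. C * s powr (- 3 / 2))"
      by (intro set_integrable_mult_right set_integral_powr_Ici) simp
    then have "set_integrable lborel {1<..} (\<lambda>s. C * s powr (- 3 / 2))"
      by (rule set_integrable_subset) auto
    then show "set_integrable lborel {1<..} (dominating C)"
      by (rule set_integrable_cong[THEN iffD1, rotated -1]) (auto simp: dominating_def)
  qed auto
  also have "{0<..1} \<union> {1<..} = {0::real<..}" by auto
  finally show ?thesis .
qed

lemma abs_exp_minus_one_le: "s \<ge> 0 \<Longrightarrow> \<bar>exp (- s) - 1\<bar> \<le> (s::real)"
  using exp_ge_add_one_self[of "- s"] by simp

text \<open>Here \<open>x\<close> and \<open>a\<close> stand for the theta and heat factors of the
  coordinates. For \<open>s \<le> 1\<close> the factors are at most \<open>(1 + E) / s\<close>, so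
  telescoping loses \<open>s^(-d)\<close>, and the exponent \<open>d + 1\<close> leaves one
  \<open>s\<close> to cancel the denominator. For \<open>s > 1\<close> the theta product is compared
  with 1 instead, and the heat product and \<open>exp (- s)\<close> are each small on their
  own.\<close>

lemma theta_product_dominated:
  fixes A B E :: real
  assumes ABE: "A \<ge> 0" "B \<ge> 0" "E \<ge> 0"
  shows "\<exists>C. \<forall>s x (a :: 'd::finite \<Rightarrow> real). s > 0 \<longrightarrow>
     (\<forall>j. 0 \<le> a j \<and> a j \<le> A / sqrt s \<and> a j \<le> x j \<and> x j - a j \<le> B * s ^ (CARD('d) + 1) \<and>
          1 \<le> x j \<and> x j \<le> 1 + E / s) \<longrightarrow>
     \<bar>(prod x UNIV - prod a UNIV - 1 + exp (- s)) / s\<bar> \<le> dominating C s"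
proof -
  define d where "d = CARD('d)"
  have d: "d > 0" by (simp add: d_def)
  define C1 where "C1 = real d * (1 + E) ^ d * B + 1"
  define C2 where "C2 = real d * (1 + E) ^ d * E + A ^ d + 1"
  have C: "C1 \<ge> 0" "C2 \<ge> 0" using ABE by (auto simp: C1_def C2_def)
  have "\<bar>(prod x UNIV - prod a UNIV - 1 + exp (- s)) / s\<bar> \<le> dominating (C1 + C2) s"
    if s: "s > 0" and h: "\<And>j. 0 \<le> a j \<and> a j \<le> A / sqrt s \<and> a j \<le> x j \<and> x j - a j \<le> B * s ^ (d + 1) \<and>
          1 \<le> x j \<and> x j \<le> 1 + E / s" for s and x a :: "'d \<Rightarrow> real"
  proof (cases "s \<le> 1")
    case True
    have xM: "x j \<le> (1 + E) / s" for j
    proof -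
      have "1 + E / s \<le> 1 / s + E / s" using s True by simp
      also have "\<dots> = (1 + E) / s" by (simp add: add_divide_distrib)
      finally show ?thesis using h[of j] by linarith
    qed
    have "\<bar>prod x UNIV - prod a UNIV\<bar> \<le> real d * ((1 + E) / s) ^ d * (B * s ^ (d + 1))"
      unfolding d_def
    proof (rule abs_prod_diff_le)
      show "1 \<le> (1 + E) / s" using s True ABE by simp
      show "\<bar>x j\<bar> \<le> (1 + E) / s" "\<bar>a j\<bar> \<le> (1 + E) / s" for j
        using h[of j] xM[of j] by auto
      show "\<bar>x j - a j\<bar> \<le> B * s ^ (CARD('d) + 1)" for j using h[of j] by (simp add: d_def)
    qed auto
    also have "\<dots> = real d * (1 + E) ^ d * B * s"
      using s by (simp add: power_divide field_simps)
    finally have "\<bar>prod x UNIV - prod a UNIV\<bar> \<le> real d * (1 + E) ^ d * B * s" .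
    moreover have "C1 * s = real d * (1 + E) ^ d * B * s + s" by (simp add: C1_def distrib_right)
    ultimately have "\<bar>prod x UNIV - prod a UNIV - 1 + exp (- s)\<bar> \<le> C1 * s"
      using abs_exp_minus_one_le[of s] s by linarith
    also have "\<dots> \<le> (C1 + C2) * s" using C s by simp
    finally show ?thesis using s True by (simp add: dominating_def abs_divide divide_le_eq)
  next
    case False
    then have s1: "s > 1" by simp
    have "E / s \<le> E" using ABE s1 mult_left_mono[of 1 s E] by (simp add: divide_le_eq)
    have "\<bar>prod x UNIV - prod (\<lambda>_::'d. 1) UNIV\<bar> \<le> real d * (1 + E) ^ d * (E / s)"
      unfolding d_def
    proof (rule abs_prod_diff_le)
      show "\<bar>x j\<bar> \<le> 1 + E" for j
        using h[of j] \<open>E / s \<le> E\<close> by auto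
      show "\<bar>x j - 1\<bar> \<le> E / s" for j using h[of j] by auto
    qed (use ABE in auto)
    moreover have "sqrt s \<le> s" using s1 by (intro real_le_lsqrt) (auto simp: power2_eq_square)
    then have sq: "1 / s \<le> 1 / sqrt s"
      using s1 by (intro divide_left_mono) auto
    then have "E / s \<le> E / sqrt s" using ABE mult_left_mono[OF sq, of E] by simp
    ultimately have 1: "\<bar>prod x UNIV - 1\<bar> \<le> real d * (1 + E) ^ d * (E / sqrt s)"
      using ABE by (smt (verit) mult_left_mono mult_nonneg_nonneg of_nat_0_le_iff prod.neutral_const
          zero_le_power)
    have "prod a UNIV \<le> (\<Prod>_\<in>(UNIV :: 'd set). A / sqrt s)"
      using h by (intro prod_mono) auto
    then have "prod a UNIV \<le> (A / sqrt s) ^ d" by (simp add: d_def)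
    also have "\<dots> = A ^ d * (1 / sqrt s) ^ d" by (simp add: power_divide)
    also have "\<dots> \<le> A ^ d * (1 / sqrt s) ^ 1"
      using ABE s1 d by (intro mult_left_mono power_decreasing) auto
    finally have 2: "prod a UNIV \<le> A ^ d / sqrt s" by simp
    have 20: "0 \<le> prod a UNIV" using h by (intro prod_nonneg) auto
    have "exp (- s) \<le> 1 / s" using exp_neg_le_fact[OF s, of 1] by simp
    with sq have 3: "exp (- s) \<le> 1 / sqrt s" by simp
    have 4: "C2 / sqrt s = real d * (1 + E) ^ d * (E / sqrt s) + A ^ d / sqrt s + 1 / sqrt s"
      by (simp add: C2_def add_divide_distrib)
    have 5: "\<bar>prod x UNIV - prod a UNIV - 1 + exp (- s)\<bar> \<le> C2 / sqrt s"
      using 1 2 20 3 4 exp_gt_zero[of "- s"] by linarith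
    also have "\<dots> \<le> (C1 + C2) / sqrt s" using C s by (simp add: divide_right_mono)
    finally have "\<bar>prod x UNIV - prod a UNIV - 1 + exp (- s)\<bar> / \<bar>s\<bar> \<le> (C1 + C2) / sqrt s / s"
      using s by (simp only: abs_of_pos) (rule divide_right_mono, auto)
    then have "\<bar>(prod x UNIV - prod a UNIV - 1 + exp (- s)) / s\<bar> \<le> (C1 + C2) / sqrt s / s"
      by (simp only: abs_divide)
    also have "\<dots> = (C1 + C2) * s powr (- 3 / 2)"
    proof -
      have "s powr (3 / 2) = s powr (1 + 1 / 2)" by simp
      also have "\<dots> = s * sqrt s" using s by (simp only: powr_add powr_one powr_half_sqrt)
      finally have "s powr (- 3 / 2) = inverse (s * sqrt s)" using powr_minus[of s "3 / 2"] by simp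
      then show ?thesis by (simp only: divide_inverse inverse_mult_distrib mult_ac)
    qed
    finally show ?thesis using False by (simp add: dominating_def)
  qed
  then show ?thesis unfolding d_def by blast
qed

text \<open>The quotient is the integral of \<open>exp (- y * t)\<close> over \<open>y\<close> in
  \<open>{a..b}\<close>. With \<open>a \<le> b\<close> everything is nonnegative, so the integrals
  may be exchanged before integrability is known.\<close>

lemma Frullani_exp_aux:
  fixes a b :: real
  assumes "a > 0" "a \<le> b"
  shows "has_bochner_integral lborel (\<lambda>t. indicator {0<..} t *\<^sub>R ((exp (- a * t) - exp (- b
      * t)) / t)) (ln b - ln a)"
proof (rule has_bochner_integral_nn_integral)
  show "AE t in lborel. 0 \<le> indicator {0<..} t *\<^sub>R ((exp (- a * t) - exp (- b * t)) / t)"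
    using assms by (intro AE_I2) (auto simp: indicator_def mult_right_mono intro!: divide_nonneg_pos)
  show "0 \<le> ln b - ln a" using assms by simp
  let ?g = "\<lambda>t y. ennreal (exp (- y * t)) * indicator {a..b} y * indicator {0<..} (t::real)"
  have inner: "(\<integral>\<^sup>+ y. ?g t y \<partial>lborel) = ennreal (indicator {0<..} t *\<^sub>R ((exp (- a * t) - exp (- b
      * t)) / t))" for t
  proof (cases "t > 0")
    case True
    have "(\<integral>\<^sup>+ y. ennreal (exp (- y * t)) * indicator {a..b} y \<partial>lborel) = ennreal (- exp (- b * t) / t
        - (- exp (- a * t) / t))"
      using assms True by (intro nn_integral_FTC_Icc)
          (auto intro!: derivative_eq_intros simp: field_simps)
    then show ?thesis using True by (simp add: diff_divide_distrib)
  qed simp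
  have outer: "(\<integral>\<^sup>+ t. ?g t y \<partial>lborel) = ennreal (1 / y) * indicator {a..b} y" for y
  proof (cases "y \<in> {a..b}")
    case True
    then have y: "y > 0" using assms by auto
    have "(\<integral>\<^sup>+ t. ?g t y \<partial>lborel) = (\<integral>\<^sup>+ t. ennreal (exp (- y * t)) * indicator {0..} t \<partial>lborel)"
      using True by (intro nn_integral_cong_AE AE_I[where N = "{0}"]) (auto simp: indicator_def)
    also have "\<dots> = ennreal (0 - (- exp (- y * 0) / y))"
    proof (rule nn_integral_FTC_atLeast)
      show "((\<lambda>t. - exp (- y * t) / y) \<longlongrightarrow> 0) at_top" using y by real_asymp
    qed (use y in \<open>auto intro!: derivative_eq_intros\<close>)
    finally show ?thesis using True by simp
  qed simp
  have "(\<integral>\<^sup>+ t. ennreal (indicator {0<..} t *\<^sub>R ((exp (- a * t) - exp (- b * t)) / t)) \<partial>lborel)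
      = (\<integral>\<^sup>+ t. \<integral>\<^sup>+ y. ?g t y \<partial>lborel \<partial>lborel)"
    unfolding inner ..
  also have "\<dots> = (\<integral>\<^sup>+ y. \<integral>\<^sup>+ t. ?g t y \<partial>lborel \<partial>lborel)"
    by (rule lborel_pair.Fubini') measurable
  also have "\<dots> = (\<integral>\<^sup>+ y. ennreal (1 / y) * indicator {a..b} y \<partial>lborel)"
    unfolding outer ..
  also have "\<dots> = ennreal (ln b - ln a)"
    using assms by (intro nn_integral_FTC_Icc) (auto intro!: derivative_eq_intros)
  finally show "(\<integral>\<^sup>+ t. ennreal (indicator {0<..} t *\<^sub>R ((exp (- a * t) - exp (- b
      * t)) / t)) \<partial>lborel) = ennreal (ln b - ln a)" .
qed measurable

lemma Frullani_exp:
  fixes a b :: real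
  assumes "a > 0" "b > 0"
  shows "set_integrable lborel {0<..} (\<lambda>t. (exp (- a * t) - exp (- b * t)) / t)"
    "(LBINT t:{0<..}. (exp (- a * t) - exp (- b * t)) / t) = ln b - ln a"
proof -
  have "has_bochner_integral lborel (\<lambda>t. indicator {0<..} t *\<^sub>R ((exp (- a * t) - exp (- b
      * t)) / t)) (ln b - ln a)"
  proof (cases "a \<le> b")
    case True
    then show ?thesis using assms by (intro Frullani_exp_aux)
  next
    case False
    then have "has_bochner_integral lborel (\<lambda>t. - (indicator {0<..} t *\<^sub>R ((exp (- b * t) - exp (- a
        * t)) / t))) (- (ln a - ln b))"
      using assms by (intro has_bochner_integral_minus Frullani_exp_aux) auto
    also have "(\<lambda>t. - (indicator {0<..} t *\<^sub>R ((exp (- b * t) - exp (- a * t)) / t))) =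
        (\<lambda>t. indicator {0<..} t *\<^sub>R ((exp (- a * t) - exp (- b * t)) / t))"
      by (auto simp: indicator_def diff_divide_distrib)
    finally show ?thesis by simp
  qed
  then show "set_integrable lborel {0<..} (\<lambda>t. (exp (- a * t) - exp (- b * t)) / t)"
    "(LBINT t:{0<..}. (exp (- a * t) - exp (- b * t)) / t) = ln b - ln a"
    by (simp_all only: has_bochner_integral_iff set_integrable_def set_lebesgue_integral_def)
qed

section \<open>A uniform majorant for the rescaled integrand\<close>

lemma borel_measurable_cycle_theta [measurable]: "cycle_theta n \<in> borel_measurable borel"
  unfolding cycle_theta_def by measurable

lemma borel_measurable_heat_return [measurable]: "heat_return \<in> borel_measurable borel"
proof -
  have "heat_return = (\<lambda>t. exp (- 2 * t) * (\<Sum>k. t ^ k / fact k * closed_walks k))"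
    using closed_walks_sums_Bessel by (auto simp: heat_return_def sums_iff)
  moreover have "(\<lambda>t. exp (- 2 * t) * (\<Sum>k. t ^ k / fact k * closed_walks k)) \<in> borel_measurable borel"
    by measurable
  ultimately show ?thesis by (simp only:)
qed

text \<open>For \<open>v = 1\<close> this is the integrand of \<open>torus_H0\<close>. For other
  \<open>v\<close> the lattice time is rescaled but \<open>exp (- s)\<close> is not, and this
  mismatch is the source of the logarithm.\<close>

definition regularized_theta :: "nat ^ 'd::finite \<Rightarrow> real \<Rightarrow> real \<Rightarrow> real" where
  "regularized_theta N v s = ((\<Prod>j\<in>UNIV. cycle_theta (N $ j) (v * s))
     - (\<Prod>j\<in>UNIV. real (N $ j) * heat_return (v * s)) - 1 + exp (- s)) / s"

lemma borel_measurable_regularized_theta [measurable]: "regularized_theta N v \<in> borel_measurable borel"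
  unfolding regularized_theta_def by measurable

text \<open>One constant serves all tori whose squared sides, divided by \<open>v\<close>, lie in a
  fixed window; this is the uniformity that dominated convergence along \<open>u\<close> requires.
  Sides above the dimension meet \<open>n \<ge> K\<close> with \<open>K = d + 1\<close>.\<close>

lemma regularized_theta_dominated:
  assumes m: "m > 0" and M: "M \<ge> 0"
  shows "\<exists>C. \<forall>(N :: nat ^ 'd::finite) v s. v > 0 \<longrightarrow> s > 0 \<longrightarrow>
     (\<forall>j. CARD('d) < N $ j \<and> m \<le> (real (N $ j))\<^sup>2 / v \<and> (real (N $ j))\<^sup>2 / v \<le> M) \<longrightarrow>
     \<bar>regularized_theta N v s\<bar> \<le> dominating C s"
proof -
  define K where "K = CARD('d) + 1"
  obtain C where C: "C \<ge> 0" "\<And>n t. n \<ge> K \<Longrightarrow> n > 0 \<Longrightarrow> t > 0 \<Longrightarrow>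
      cycle_theta n t - real n * heat_return t \<le> C * (t / (real n)\<^sup>2) ^ K"
    using cycle_theta_minus_heat_return_le_power[of K] by blast
  define A where "A = sqrt M"
  define B where "B = C / m ^ K"
  have "A \<ge> 0" "B \<ge> 0" using m M C by (auto simp: A_def B_def)
  then obtain C' where C': "\<And>s x (a :: 'd \<Rightarrow> real). s > 0 \<Longrightarrow>
     (\<forall>j. 0 \<le> a j \<and> a j \<le> A / sqrt s \<and> a j \<le> x j \<and> x j - a j \<le> B * s ^ K \<and>
          1 \<le> x j \<and> x j \<le> 1 + M / s) \<Longrightarrow>
     \<bar>(prod x UNIV - prod a UNIV - 1 + exp (- s)) / s\<bar> \<le> dominating C' s"
    using theta_product_dominated[of A B M, where 'd = 'd] M unfolding K_def by blast
  have "\<bar>regularized_theta N v s\<bar> \<le> dominating C' s"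
    if v: "v > 0" and s: "s > 0"
      and N: "\<And>j. CARD('d) < N $ j \<and> m \<le> (real (N $ j))\<^sup>2 / v \<and> (real (N $ j))\<^sup>2 / v \<le> M"
    for N :: "nat ^ 'd" and v s
    unfolding regularized_theta_def
  proof (rule C'[OF s], intro allI conjI)
    fix j
    define n where "n = N $ j"
    have n: "n \<ge> K" "n > 0" and q: "m \<le> (real n)\<^sup>2 / v" "(real n)\<^sup>2 / v \<le> M"
      using N[of j] by (auto simp: n_def K_def)
    have vs: "v * s > 0" using v s by simp
    have e: "v * s / (real n)\<^sup>2 = s / ((real n)\<^sup>2 / v)" using v n by simp
    have "real n * heat_return (v * s) \<le> real n * (1 / sqrt (v * s))"
      using heat_return_bound[OF vs] by (intro mult_left_mono) auto
    also have "\<dots> = sqrt ((real n)\<^sup>2 / v) / sqrt s"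
      using v s by (simp add: real_sqrt_mult real_sqrt_divide)
    also have "\<dots> \<le> A / sqrt s" unfolding A_def using q s
        by (intro divide_right_mono real_sqrt_le_mono) auto
    finally show "real (N $ j) * heat_return (v * s) \<le> A / sqrt s" unfolding n_def .
    show "0 \<le> real (N $ j) * heat_return (v * s)" using heat_return_bound[OF vs] by simp
    show "real (N $ j) * heat_return (v * s) \<le> cycle_theta (N $ j) (v * s)"
      using heat_return_le_cycle_theta[OF n(2), of "v * s"] vs by (simp add: n_def)
    have "cycle_theta n (v * s) - real n * heat_return (v * s) \<le> C * (s / ((real n)\<^sup>2 / v)) ^ K"
      using C(2)[OF n vs] unfolding e .
    also have "\<dots> \<le> C * (s / m) ^ K"
      using C(1) q m s v n
      by (intro mult_left_mono power_mono divide_left_mono) (auto intro!: mult_pos_pos divide_pos_pos)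
    finally show "cycle_theta (N $ j) (v * s) - real (N $ j) * heat_return (v * s) \<le> B * s ^ K"
      by (simp add: n_def B_def power_divide)
    show "1 \<le> cycle_theta (N $ j) (v * s)" using cycle_theta_bounds(1)[OF n(2) vs] by (simp add: n_def)
    have "cycle_theta n (v * s) \<le> 1 + 1 / (8 * (s / ((real n)\<^sup>2 / v)))"
    proof -
      have "v * s / (real n)\<^sup>2 > 0" using vs n by (intro divide_pos_pos) auto
      from theta_tail_le[OF this] cycle_theta_bounds(2)[OF n(2) vs] show ?thesis
        unfolding e by linarith
    qed
    also have "1 / (8 * (s / ((real n)\<^sup>2 / v))) \<le> M / s"
      using q s M by (simp add: field_simps)
    finally show "cycle_theta (N $ j) (v * s) \<le> 1 + M / s" by (simp add: n_def)
  qed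
  then show ?thesis by blast
qed

lemma set_integrable_dominating:
  fixes f :: "real \<Rightarrow> real"
  assumes "f \<in> borel_measurable borel" "\<And>s. s > 0 \<Longrightarrow> \<bar>f s\<bar> \<le> dominating C s"
  shows "set_integrable lborel {0<..} f"
  unfolding set_integrable_def
  by (rule Bochner_Integration.integrable_bound[OF dominating_integrable[unfolded set_integrable_def,
      of C]])
    (use assms in \<open>auto intro!: AE_I2 simp: indicator_def intro: order_trans[OF _ abs_ge_self]\<close>)

lemma regularized_theta_integrable:
  fixes N :: "nat ^ 'd::finite"
  assumes "v > 0" "\<And>j. CARD('d) < N $ j"
  shows "set_integrable lborel {0<..} (regularized_theta N v)"
proof -
  define M where "M = (\<Sum>j\<in>UNIV. (real (N $ j))\<^sup>2 / v)"
  have "(real (N $ j))\<^sup>2 / v \<le> M" for j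
    unfolding M_def using assms(1) by (intro member_le_sum) auto
  moreover have "1 / v \<le> (real (N $ j))\<^sup>2 / v" for j
  proof -
    have "1 \<le> real (N $ j)" using assms(2)[of j] by simp
    then have "1\<^sup>2 \<le> (real (N $ j))\<^sup>2" by (intro power_mono) auto
    then show ?thesis using assms(1) by (simp add: divide_right_mono)
  qed
  moreover have "M \<ge> 0" unfolding M_def using assms(1) by (intro sum_nonneg) auto
  ultimately obtain C where "\<And>s. s > 0 \<Longrightarrow> \<bar>regularized_theta N v s\<bar> \<le> dominating C s"
    using regularized_theta_dominated[of "1 / v" M, where 'd = 'd] assms
        by (metis divide_pos_pos zero_less_one)
  then show ?thesis by (intro set_integrable_dominating) auto
qed

lemma torus_H0_integrand:
  fixes N :: "nat ^ 'd::finite"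
  assumes "\<And>j. N $ j > 0"
  shows "(torus_theta N t - torus_volume N * exp (- 2 * real CARD('d) * t) * Bessel_I 0 (2
      * t) ^ CARD('d)
           - 1 + exp (- t)) / t = regularized_theta N 1 t"
proof -
  have "exp (- 2 * real CARD('d) * t) = exp (- 2 * t) ^ CARD('d)"
    by (simp add: exp_of_nat_mult[symmetric] mult_ac)
  then have "torus_volume N * exp (- 2 * real CARD('d) * t) * Bessel_I 0 (2 * t) ^ CARD('d)
     = (\<Prod>j\<in>UNIV. real (N $ j) * heat_return t)"
    by (simp add: torus_volume_def heat_return_def prod.distrib power_mult_distrib)
  then show ?thesis
    by (simp add: regularized_theta_def torus_theta_eq_prod[OF assms])
qed

lemma torus_H0_eq:
  fixes N :: "nat ^ 'd::finite"
  assumes "\<And>j. CARD('d) < N $ j"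
  shows "torus_H0 N = - (LBINT t:{0<..}. regularized_theta N 1 t)"
proof -
  have "N $ j > 0" for j using assms[of j] by linarith
  then show ?thesis unfolding torus_H0_def by (subst torus_H0_integrand) auto
qed

lemma torus_H0_rescaled:
  fixes N :: "nat ^ 'd::finite"
  assumes v: "v > 0" and N: "\<And>j. CARD('d) < N $ j"
  shows "torus_H0 N = ln v - (LBINT s:{0<..}. regularized_theta N v s)"
proof -
  have ind: "indicator {0<..} (v * s) = (indicator {0<..} s :: real)" for s
    using v by (auto simp: indicator_def zero_less_mult_iff)
  have "(LBINT t:{0<..}. regularized_theta N 1 t) =
     \<bar>v\<bar> *\<^sub>R (\<integral>s. indicator {0<..} (0 + v * s) *\<^sub>R regularized_theta N 1 (0 + v * s) \<partial>lborel)"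
    unfolding set_lebesgue_integral_def by (rule lborel_integral_real_affine) (use v in auto)
  also have "\<dots> = (LBINT s:{0<..}. v * regularized_theta N 1 (v * s))"
    using v by (simp add: set_lebesgue_integral_def ind mult.left_commute)
  \<comment> \<open>The measure \<open>dt / t\<close> is invariant under scaling, so only the
    exponential term changes.\<close>
  also have "\<dots> = (LBINT s:{0<..}. regularized_theta N v s + (exp (- v * s) - exp (- 1 * s)) / s)"
    by (intro set_lebesgue_integral_cong) (use v in \<open>auto simp: regularized_theta_def field_simps\<close>)
  also have "\<dots> = (LBINT s:{0<..}. regularized_theta N v s) + (ln 1 - ln v)"
    using regularized_theta_integrable[OF v N] Frullani_exp[OF v zero_less_one]
    by (subst set_integral_add) auto
  finally show ?thesis using N by (simp add: torus_H0_eq)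
qed

section \<open>The limit of the rescaled integral\<close>

definition real_torus_theta :: "real ^ 'd::finite \<Rightarrow> real \<Rightarrow> real" where
  "real_torus_theta \<alpha> s = (\<Prod>j\<in>UNIV. circle_theta (s / (\<alpha> $ j)\<^sup>2))"

text \<open>The volume of the real torus divided by \<open>(4 * pi * s)^(d/2)\<close>: the heat
  trace as it would be if no geodesic closed up.\<close>

definition flat_heat :: "real ^ 'd::finite \<Rightarrow> real \<Rightarrow> real" where
  "flat_heat \<alpha> s = (\<Prod>j\<in>UNIV. \<alpha> $ j / (2 * sqrt (pi * s)))"

definition regularized_real_theta :: "real ^ 'd::finite \<Rightarrow> real \<Rightarrow> real" where
  "regularized_real_theta \<alpha> s = (real_torus_theta \<alpha> s - flat_heat \<alpha> s - 1 + exp (- s)) / s"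

context
  fixes \<alpha> :: "real ^ 'd::finite" and N :: "nat \<Rightarrow> nat ^ 'd"
  assumes \<alpha>: "\<And>j. \<alpha> $ j > 0"
    and lim: "\<And>j. (\<lambda>u. real (N u $ j) / real u) \<longlonglongrightarrow> \<alpha> $ j"
begin

lemma side_length_at_top: "filterlim (\<lambda>u. real (N u $ j)) at_top sequentially"
proof -
  have "filterlim (\<lambda>u. real (N u $ j) / real u * real u) at_top sequentially"
    by (rule filterlim_tendsto_pos_mult_at_top[OF lim \<alpha> filterlim_real_sequentially])
  moreover have "\<forall>\<^sub>F u in sequentially. real (N u $ j) / real u * real u = real (N u $ j)"
    using eventually_gt_at_top[of 0] by eventually_elim simp
  ultimately show ?thesis
    by (rule filterlim_mono_eventually[OF _ order_refl order_refl])
qed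

lemma eventually_large: "\<forall>\<^sub>F u in sequentially. \<forall>j. CARD('d) < N u $ j"
proof (rule eventually_all_finite)
  fix j
  have "\<forall>\<^sub>F u in sequentially. real CARD('d) < real (N u $ j)"
    by (rule eventually_compose_filterlim[OF eventually_gt_at_top side_length_at_top])
  then show "\<forall>\<^sub>F u in sequentially. CARD('d) < N u $ j" by eventually_elim simp
qed

lemma scaled_time_tendsto:
  "(\<lambda>u. (real u)\<^sup>2 * s / (real (N u $ j))\<^sup>2) \<longlonglongrightarrow> s / (\<alpha> $ j)\<^sup>2"
proof -
  have "(\<lambda>u. s / (real (N u $ j) / real u)\<^sup>2) \<longlonglongrightarrow> s / (\<alpha> $ j)\<^sup>2"
    using \<alpha>[of j] by (intro tendsto_intros lim) auto
  then show ?thesis by (simp add: power_divide mult.commute)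
qed

lemma eventually_dominated:
  "\<exists>C. \<forall>\<^sub>F u in sequentially. \<forall>s>0. \<bar>regularized_theta (N u) ((real u)\<^sup>2) s\<bar> \<le> dominating C s"
proof -
  \<comment> \<open>Any window with positive lower end will do, provided that all squares of the
    entries of \<alpha>, the limits of the squared sides over \<open>u^2\<close>, lie strictly
    inside.\<close>
  define m where "m = Min (range (\<lambda>j. (\<alpha> $ j)\<^sup>2)) / 2"
  define M where "M = Max (range (\<lambda>j. (\<alpha> $ j)\<^sup>2)) + 1"
  have "Min (range (\<lambda>j. (\<alpha> $ j)\<^sup>2)) > 0"
    using \<alpha> by (subst Min_gr_iff) (auto simp: less_imp_neq[THEN not_sym])
  then have m: "m > 0" "\<And>j. m < (\<alpha> $ j)\<^sup>2"
  proof -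
    assume h: "Min (range (\<lambda>j. (\<alpha> $ j)\<^sup>2)) > 0"
    then show "m > 0" by (simp add: m_def)
    fix j
    have "Min (range (\<lambda>j. (\<alpha> $ j)\<^sup>2)) \<le> (\<alpha> $ j)\<^sup>2" by (intro Min_le) auto
    then show "m < (\<alpha> $ j)\<^sup>2" using h unfolding m_def by linarith
  qed
  have M: "(\<alpha> $ j)\<^sup>2 < M" for j
  proof -
    have "(\<alpha> $ j)\<^sup>2 \<le> Max (range (\<lambda>j. (\<alpha> $ j)\<^sup>2))" by (intro Max_ge) auto
    then show ?thesis unfolding M_def by linarith
  qed
  then have "M \<ge> 0" by (meson less_imp_le order_trans zero_le_power2)
  obtain C where C: "\<And>(N :: nat ^ 'd) v s. v > 0 \<Longrightarrow> s > 0 \<Longrightarrow>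
     (\<forall>j. CARD('d) < N $ j \<and> m \<le> (real (N $ j))\<^sup>2 / v \<and> (real (N $ j))\<^sup>2 / v \<le> M) \<Longrightarrow>
     \<bar>regularized_theta N v s\<bar> \<le> dominating C s"
    using regularized_theta_dominated[OF m(1) \<open>M \<ge> 0\<close>, where 'd = 'd] by blast
  have l: "(\<lambda>u. (real (N u $ j))\<^sup>2 / (real u)\<^sup>2) \<longlonglongrightarrow> (\<alpha> $ j)\<^sup>2" for j
    using tendsto_power[OF lim, of j 2] by (simp add: power_divide)
  have "\<forall>\<^sub>F u in sequentially. \<forall>j. m \<le> (real (N u $ j))\<^sup>2 / (real u)\<^sup>2
      \<and> (real (N u $ j))\<^sup>2 / (real u)\<^sup>2 \<le> M"
  proof (intro eventually_all_finite eventually_conj)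
    fix j
    show "\<forall>\<^sub>F u in sequentially. m \<le> (real (N u $ j))\<^sup>2 / (real u)\<^sup>2"
      using order_tendstoD(1)[OF l[of j] m(2)[of j]] by eventually_elim simp
    show "\<forall>\<^sub>F u in sequentially. (real (N u $ j))\<^sup>2 / (real u)\<^sup>2 \<le> M"
      using order_tendstoD(2)[OF l[of j] M[of j]] by eventually_elim simp
  qed
  with eventually_large have "\<forall>\<^sub>F u in sequentially. \<forall>s>0. \<bar>regularized_theta (N u) ((real u)\<^sup>2) s\<bar>
      \<le> dominating C s"
    using eventually_gt_at_top[of 0] by eventually_elim (auto intro!: C)
  then show ?thesis by blast
qed

lemma regularized_theta_tendsto:
  assumes "s > 0"
  shows "(\<lambda>u. regularized_theta (N u) ((real u)\<^sup>2) s) \<longlonglongrightarrow> regularized_real_theta \<alpha> s"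
proof -
  have pos: "s / (\<alpha> $ j)\<^sup>2 > 0" for j using assms \<alpha>[of j] by simp
  have "(\<lambda>u. real (N u $ j) * heat_return ((real u)\<^sup>2 * s)) \<longlonglongrightarrow> \<alpha> $ j / (2 * sqrt (pi * s))" for j
    using heat_return_scaled_tendsto[OF side_length_at_top scaled_time_tendsto pos, of j] \<alpha>[of j]
    by (simp add: real_sqrt_divide)
  then show ?thesis
    unfolding regularized_theta_def regularized_real_theta_def real_torus_theta_def flat_heat_def
    by (intro tendsto_intros cycle_theta_tendsto[OF side_length_at_top scaled_time_tendsto pos])
        (use assms in auto)
qed

lemma regularized_theta_integral_tendsto:
  "set_integrable lborel {0<..} (regularized_real_theta \<alpha>)"
  "(\<lambda>u. LBINT s:{0<..}. regularized_theta (N u) ((real u)\<^sup>2) s)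
      \<longlonglongrightarrow> (LBINT s:{0<..}. regularized_real_theta \<alpha> s)"
proof -
  obtain C where "\<forall>\<^sub>F u in sequentially. \<forall>s>0. \<bar>regularized_theta (N u) ((real u)\<^sup>2) s\<bar>
      \<le> dominating C s"
    using eventually_dominated by blast
  then obtain U where U: "\<And>u s. u \<ge> U \<Longrightarrow> s > 0 \<Longrightarrow> \<bar>regularized_theta (N u) ((real u)\<^sup>2) s\<bar>
      \<le> dominating C s"
    unfolding eventually_sequentially by blast
  let ?f = "\<lambda>u s. indicator {0<..} s *\<^sub>R regularized_theta (N (u + U)) ((real (u + U))\<^sup>2) s"
  let ?g = "\<lambda>s. indicator {0<..} s *\<^sub>R regularized_real_theta \<alpha> s"
  have pt: "(\<lambda>u. ?f u s) \<longlonglongrightarrow> ?g s" for s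
  proof (cases "s > 0")
    case True
    from LIMSEQ_ignore_initial_segment[OF regularized_theta_tendsto[OF True], of U] True
    show ?thesis by simp
  qed simp
  have fm: "?f u \<in> borel_measurable borel" for u by measurable
  \<comment> \<open>The limit integrand is measurable as a pointwise limit; nothing about the
    infinite sums in it is needed.\<close>
  have gm: "?g \<in> borel_measurable borel" by (rule borel_measurable_LIMSEQ_real[OF pt fm])
  have bound: "norm (?f u s) \<le> indicator {0<..} s *\<^sub>R dominating C s" for u s
    using U[of "u + U" s] by (auto simp: indicator_def)
  note dct = dominating_integrable[of C, unfolded set_integrable_def]
  show "set_integrable lborel {0<..} (regularized_real_theta \<alpha>)"
    unfolding set_integrable_def
    by (rule integrable_dominated_convergence[OF _ _ dct, of _ ?f]) (use pt fm gm bound in auto)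
  have "(\<lambda>u. integral\<^sup>L lborel (?f u)) \<longlonglongrightarrow> integral\<^sup>L lborel ?g"
    by (rule integral_dominated_convergence[OF _ _ dct]) (use pt fm gm bound in auto)
  then show "(\<lambda>u. LBINT s:{0<..}. regularized_theta (N u) ((real u)\<^sup>2) s)
      \<longlonglongrightarrow> (LBINT s:{0<..}. regularized_real_theta \<alpha> s)"
    unfolding set_lebesgue_integral_def by (rule LIMSEQ_offset)
qed

lemma torus_H0_asymp:
  "(\<lambda>u. torus_H0 (N u) - ln ((real u)\<^sup>2)) \<longlonglongrightarrow> - (LBINT s:{0<..}. regularized_real_theta \<alpha> s)"
proof -
  have "\<forall>\<^sub>F u in sequentially. - (LBINT s:{0<..}. regularized_theta (N u) ((real u)\<^sup>2) s)
      = torus_H0 (N u) - ln ((real u)\<^sup>2)"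
    using eventually_large eventually_gt_at_top[of 0]
  proof eventually_elim
    case (elim u)
    then show ?case using torus_H0_rescaled[of "(real u)\<^sup>2" "N u"] by simp
  qed
  then show ?thesis
    by (rule Lim_transform_eventually[OF tendsto_minus[OF regularized_theta_integral_tendsto(2)]])
qed

end

text \<open>An exact identity of integrands. There are \<open>V - 1\<close> nonzero eigenvalues, so
  their Frullani integrands carry \<open>V - 1\<close> copies of \<open>exp (- t)\<close>; the
  integrand of \<open>torus_H0\<close> carries the remaining one, and the theta functions
  cancel.\<close>

lemma ln_torus_det:
  fixes N :: "nat ^ 'd::finite"
  assumes N: "\<And>j. CARD('d) < N $ j"
  shows "ln (torus_det N) = torus_volume N * lattice_I0 CARD('d) + torus_H0 N"
proof -
  have N0: "N $ j > 0" for j using N[of j] by linarith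
  define B where "B = dual_box N - {\<lambda>_. 0}"
  define d where "d = CARD('d)"
  have pos: "torus_eigenvalue N k > 0" if "k \<in> B" for k
    using that torus_eigenvalue_eq_0_iff[OF N0, of k] torus_eigenvalue_nonneg[of N k]
    by (auto simp: B_def less_le)
  let ?P = "\<lambda>t. (exp (- 2 * real d * t) * Bessel_I 0 (2 * t) ^ d - exp (- t)) / t"
  let ?R = "\<lambda>t. \<Sum>k\<in>B. (exp (- torus_eigenvalue N k * t) - exp (- 1 * t)) / t"
  have "real (card (dual_box N)) = 1 + real (card B)"
    using zero_in_dual_box[OF N0] unfolding B_def by (subst card.remove[of _ "\<lambda>_. 0"]) auto
  then have V: "torus_volume N = 1 + real (card B)" by (simp add: card_dual_box)
  have "torus_theta N t = 1 + (\<Sum>k\<in>B. exp (- torus_eigenvalue N k * t))" for t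
    unfolding torus_theta_eq_sum[OF N0] B_def
    by (subst sum.remove[OF _ zero_in_dual_box[OF N0]]) (auto simp: torus_eigenvalue_def)
  then have eq: "torus_volume N * ?P t = ?R t - regularized_theta N 1 t" for t
    unfolding torus_H0_integrand[OF N0, symmetric] d_def[symmetric] V
    by (simp add: sum_divide_distrib[symmetric] sum_subtractf diff_divide_distrib[symmetric]
        algebra_simps)
  have Rint: "set_integrable lborel {0<..} ?R"
    unfolding set_integrable_def scaleR_sum_right
    by (intro Bochner_Integration.integrable_sum)
        (use Frullani_exp(1)[OF pos zero_less_one] in \<open>simp only: set_integrable_def\<close>)
  have "(LBINT t:{0<..}. ?R t) = (\<Sum>k\<in>B. LBINT t:{0<..}. (exp (- torus_eigenvalue N k * t) - exp (- 1
      * t)) / t)"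
    unfolding set_lebesgue_integral_def scaleR_sum_right
    by (intro Bochner_Integration.integral_sum)
        (use Frullani_exp(1)[OF pos zero_less_one] in \<open>simp only: set_integrable_def\<close>)
  also have "\<dots> = (\<Sum>k\<in>B. ln 1 - ln (torus_eigenvalue N k))"
    by (intro sum.cong refl Frullani_exp(2)[OF pos zero_less_one])
  also have "\<dots> = - ln (torus_det N)"
    unfolding torus_det_eq_prod[OF N0] B_def[symmetric]
    by (subst ln_prod) (simp_all add: sum_negf B_def pos[unfolded B_def, simplified] pos[unfolded
        B_def, simplified, THEN less_imp_neq, THEN not_sym])
  finally have R: "(LBINT t:{0<..}. ?R t) = - ln (torus_det N)" .
  have "torus_volume N * lattice_I0 d = - (LBINT t:{0<..}. torus_volume N * ?P t)"
    unfolding lattice_I0_def by (simp only: set_integral_mult_right mult_minus_right)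
  also have "\<dots> = - ((LBINT t:{0<..}. ?R t) - (LBINT t:{0<..}. regularized_theta N 1 t))"
    unfolding eq using regularized_theta_integrable[OF zero_less_one N] Rint
    by (subst set_integral_diff) auto
  finally show ?thesis unfolding R torus_H0_eq[OF N] d_def by simp
qed

section \<open>Mellin transforms\<close>

lemma integrable_exp_abs_ln:
  fixes f :: "real \<Rightarrow> real"
  assumes "f \<in> borel_measurable borel"
    and "\<And>s. s > 0 \<Longrightarrow> \<bar>f s\<bar> * exp (R * \<bar>ln s\<bar>) / s \<le> dominating C s"
  shows "integrable lborel (\<lambda>s. indicator {0<..} s * (\<bar>f s\<bar> * exp (R * \<bar>ln s\<bar>) / s))"
  by (rule Bochner_Integration.integrable_bound[OF dominating_integrable[unfolded set_integrable_def,
      of C]])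
    (use assms in \<open>auto intro!: AE_I2 simp: indicator_def abs_mult intro: order_trans[OF _
        abs_ge_self]\<close>)

lemma of_real_powr_eq_exp:
  assumes "s > 0"
  shows "complex_of_real s powr z = exp (z * of_real (ln s))"
  using assms by (simp add: powr_def Ln_of_real)

text \<open>The Mellin transform is the sum of the power series obtained by expanding $s^w = e^{w \ln s}$.\<close>

lemma mellin_entire:
  fixes f :: "real \<Rightarrow> real"
  assumes f: "f \<in> borel_measurable borel"
    and bound: "\<And>R. \<exists>C. \<forall>s>0. \<bar>f s\<bar> * exp (R * \<bar>ln s\<bar>) / s \<le> dominating C s"
  shows "\<And>w. set_integrable lborel {0<..} (\<lambda>s. of_real (f s) * of_real s powr (w - 1 :: complex))"
    and "(\<lambda>w. LBINT s:{0<..}. of_real (f s) * of_real s powr (w - 1 :: complex)) holomorphic_on UNIV"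
proof -
  let ?e = "\<lambda>R s. indicator {0<..} s * (\<bar>f s\<bar> * exp (R * \<bar>ln s\<bar>) / s)"
  have int: "integrable lborel (?e R)" for R
    using bound[of R] integrable_exp_abs_ln[OF f, of R] by blast
  let ?t = "\<lambda>w n s. indicator {0<..} s *\<^sub>R (of_real (f s / s) * ((w
      * of_real (ln s)) ^ n /\<^sub>R fact n)) :: complex"
  have nt: "norm (?t w n s) = indicator {0<..} s * (\<bar>f s\<bar> / s * ((norm w * \<bar>ln s\<bar>) ^ n / fact n))"
      for w n s
    by (cases "s > 0") (simp_all add: norm_mult norm_power norm_divide norm_inverse divide_inverse
        mult_ac)
  have sums_t: "(\<lambda>n. ?t w n s) sums (indicator {0<..} s *\<^sub>R (of_real (f s) * of_real s powr (w - 1)))"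
      for w s
  proof (cases "s > 0")
    case True
    have "(\<lambda>n. of_real (f s / s) * ((w * of_real (ln s)) ^ n /\<^sub>R fact n)) sums (of_real (f s / s)
        * exp (w * of_real (ln s)))"
      by (intro sums_mult exp_converges)
    also have "of_real (f s / s) * exp (w * of_real (ln s)) = of_real (f s) * of_real s powr (w - 1)"
      using True by (simp add: powr_diff of_real_powr_eq_exp[symmetric])
    finally show ?thesis using True by simp
  qed simp
  \<comment> \<open>With \<open>R = norm w\<close>, the weight \<open>exp (R * |ln s|)\<close> of
    the hypothesis is the sum of the absolute values of the expanded terms.\<close>
  have sums_n: "(\<lambda>n. norm (?t w n s)) sums ?e (norm w) s" for w s
  proof -
    have "(\<lambda>n. (norm w * \<bar>ln s\<bar>) ^ n / fact n) sums exp (norm w * \<bar>ln s\<bar>)"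
      using exp_converges[of "norm w * \<bar>ln s\<bar>"] by (simp add: divide_inverse mult.commute)
    then have "(\<lambda>n. indicator {0<..} s * (\<bar>f s\<bar> / s * ((norm w * \<bar>ln s\<bar>) ^ n / fact n))) sums
       (indicator {0<..} s * (\<bar>f s\<bar> / s * exp (norm w * \<bar>ln s\<bar>)))"
      by (intro sums_mult)
    then show ?thesis unfolding nt by simp
  qed
  have e_nonneg: "?e R s \<ge> 0" for R s by (auto simp: indicator_def)
  have tm: "?t w n \<in> borel_measurable lborel" for w n using f by measurable
  have part: "(\<Sum>n<k. norm (?t w n s)) \<le> ?e (norm w) s" for w s k
  proof -
    have sn: "(\<lambda>n. norm (?t w n s)) sums ?e (norm w) s" by (rule sums_n)
    show ?thesis
      using sum_le_suminf[OF sums_summable[OF sn], of "{..<k}"] sums_unique[OF sn] by simp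
  qed
  have t_le: "norm (?t w n s) \<le> norm (?e (norm w) s)" for w n s
  proof -
    have "norm (?t w n s) \<le> (\<Sum>n<Suc n. norm (?t w n s))" by (rule member_le_sum) auto
    also have "\<dots> \<le> ?e (norm w) s" by (rule part)
    also have "\<dots> \<le> norm (?e (norm w) s)" by (simp only: real_norm_def abs_ge_self)
    finally show ?thesis .
  qed
  have tint: "integrable lborel (?t w n)" for w n
    by (rule Bochner_Integration.integrable_bound[OF int[of "norm w"] tm]) (use t_le in blast)
  have summ: "summable (\<lambda>n. \<integral>s. norm (?t w n s) \<partial>lborel)" for w
  proof (rule summableI_nonneg_bounded)
    fix k
    have "(\<Sum>n<k. \<integral>s. norm (?t w n s) \<partial>lborel) = (\<integral>s. (\<Sum>n<k. norm (?t w n s)) \<partial>lborel)"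
      using tint by (intro Bochner_Integration.integral_sum[symmetric] integrable_norm)
    also have "\<dots> \<le> (\<integral>s. ?e (norm w) s \<partial>lborel)"
      using tint int part by (intro integral_mono Bochner_Integration.integrable_sum integrable_norm)
    finally show "(\<Sum>n<k. \<integral>s. norm (?t w n s) \<partial>lborel) \<le> (\<integral>s. ?e (norm w) s \<partial>lborel)" .
  qed simp
  have sumn: "summable (\<lambda>n. norm (?t w n s))" for w s by (rule sums_summable[OF sums_n])
  have sum_eq: "(\<Sum>n. ?t w n s) = indicator {0<..} s *\<^sub>R (of_real (f s) * of_real s powr (w - 1))"
      for w s
    by (rule sums_unique[OF sums_t, symmetric])
  have "integrable lborel (\<lambda>s. \<Sum>n. ?t w n s)" for w
    by (rule integrable_suminf[OF tint _ summ]) (use sumn in simp)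
  then show "set_integrable lborel {0<..} (\<lambda>s. of_real (f s) * of_real s powr (w - 1 :: complex))" for w
    unfolding sum_eq set_integrable_def .
  define M where "M w = (LBINT s:{0<..}. of_real (f s) * of_real s powr (w - 1 :: complex))" for w
  define a where "a n = (\<integral>s. ?t 1 n s \<partial>lborel)" for n
  have M_sums: "(\<lambda>n. a n * (w - 0) ^ n) sums M w" for w
  proof -
    have "(\<lambda>n. \<integral>s. ?t w n s \<partial>lborel) sums (\<integral>s. (\<Sum>n. ?t w n s) \<partial>lborel)"
      by (rule sums_integral[OF tint _ summ]) (use sumn in simp)
    also have "(\<integral>s. (\<Sum>n. ?t w n s) \<partial>lborel) = M w"
      unfolding sum_eq M_def set_lebesgue_integral_def ..
    also have "(\<lambda>n. \<integral>s. ?t w n s \<partial>lborel) = (\<lambda>n. a n * (w - 0) ^ n)"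
    proof
      fix n
      have "?t w n = (\<lambda>s. w ^ n * ?t 1 n s)"
        by (auto simp: fun_eq_iff power_mult_distrib scaleR_conv_of_real mult_ac)
      then show "(\<integral>s. ?t w n s \<partial>lborel) = a n * (w - 0) ^ n"
        by (simp only: a_def integral_mult_right_zero) simp
    qed
    finally show ?thesis .
  qed
  have hol: "M holomorphic_on ball 0 r" for r
    by (rule power_series_holomorphic[of 0 r a M]) (rule M_sums)
  have "M holomorphic_on UNIV"
    unfolding holomorphic_on_open[OF open_UNIV]
  proof
    fix w :: complex
    have "w \<in> ball 0 (norm w + 1)" by simp
    then show "\<exists>f'. (M has_field_derivative f') (at w)"
      using hol[of "norm w + 1"] holomorphic_on_open[OF open_ball] by blast
  qed
  then show "(\<lambda>w. LBINT s:{0<..}. of_real (f s) * of_real s powr (w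
      - 1 :: complex)) holomorphic_on UNIV"
    unfolding M_def .
qed

lemma integral_powr_unit_interval:
  fixes z :: complex
  assumes z: "Re z > 0"
  shows "set_integrable lborel {0<..1} (\<lambda>s. complex_of_real s powr (z - 1))"
    "(LBINT s:{0<..1}. complex_of_real s powr (z - 1)) = 1 / z"
proof -
  have z0: "z \<noteq> 0" using z by auto
  have h: "((\<lambda>s. complex_of_real s powr (z - 1)) has_integral (complex_of_real 1 powr z / z
      - complex_of_real 0 powr z / z)) {0..1}"
  proof (rule fundamental_theorem_of_calculus_interior)
    show "continuous_on {0..1} (\<lambda>s. complex_of_real s powr z / z)"
      using z by (intro continuous_intros continuous_on_powr_complex) (auto simp: z0)
    show "((\<lambda>s. complex_of_real s powr z / z) has_vector_derivative complex_of_real x powr (z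
        - 1)) (at x)"
      if "x \<in> {0<..<1}" for x
    proof -
      have "((\<lambda>s. s powr z / z) has_field_derivative (z * of_real x powr (z
          - 1)) / z) (at (complex_of_real x))"
        using that z0 by (intro derivative_eq_intros) auto
      then show ?thesis
        using z0 has_vector_derivative_real_field[of "\<lambda>s. s powr z / z"] by simp
    qed
  qed simp
  have h': "((\<lambda>s. complex_of_real s powr (z - 1)) has_integral 1 / z) {0<..1}"
  proof -
    have "((\<lambda>s. complex_of_real s powr (z - 1)) has_integral 1 / z) {0..1}" using h by simp
    moreover have "{x \<in> {0<..1} - {0..1}. complex_of_real x powr (z - 1) \<noteq> 0} = {}"
      "{x \<in> {0..1} - {0<..1}. complex_of_real x powr (z - 1) \<noteq> 0} \<subseteq> {0}" by auto
    ultimately show ?thesis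
      by (subst has_integral_spike_set_eq[of _ "{0..1}"]) (auto intro: negligible_subset[of "{0}"])
  qed
  have ai: "(\<lambda>s. complex_of_real s powr (z - 1)) absolutely_integrable_on {0<..1}"
  proof (rule measurable_bounded_by_integrable_imp_absolutely_integrable)
    show "(\<lambda>s. s powr (Re z - 1)) integrable_on {0<..1}"
      using z by (intro integrable_on_powr_from_0') auto
    show "norm (complex_of_real s powr (z - 1)) \<le> s powr (Re z - 1)" if "s \<in> {0<..1}" for s
      using that by (simp add: norm_powr_real_powr)
    show "(\<lambda>s. complex_of_real s powr (z - 1)) \<in> borel_measurable (lebesgue_on {0<..1})"
      by (intro measurable_restrict_space1 measurable_completion) measurable
  qed auto
  from set_integral_lborel_of_absolutely_integrable[OF ai _ _ h']
  show "set_integrable lborel {0<..1} (\<lambda>s. complex_of_real s powr (z - 1))"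
    "(LBINT s:{0<..1}. complex_of_real s powr (z - 1)) = 1 / z"
    by auto
qed

lemma integral_exp_powr:
  fixes z :: complex and l :: real
  assumes z: "Re z > 0" and l: "l > 0"
  shows "set_integrable lborel {0<..} (\<lambda>s. complex_of_real (exp (- l * s)) * of_real s powr (z - 1))"
    "(LBINT s:{0<..}. complex_of_real (exp (- l * s)) * of_real s powr (z - 1)) = Gamma z
        * of_real l powr (- z)"
proof -
  let ?f = "\<lambda>t. complex_of_real t powr (z - 1) / of_real (exp t)"
  have g: "set_integrable lborel {0<..} ?f" "(LBINT t:{0<..}. ?f t) = Gamma z"
    using set_integral_lborel_of_absolutely_integrable[OF absolutely_integrable_Gamma_integral'[OF z]
        _ _ Gamma_integral_complex'[OF z]]
    by auto
  have ind: "indicator {0<..} (l * s) = (indicator {0<..} s :: real)" for s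
    using l by (auto simp: indicator_def zero_less_mult_iff)
  have eq: "indicator {0<..} (0 + l * s) *\<^sub>R ?f (0 + l * s)
     = of_real l powr (z - 1) * (indicator {0<..} s *\<^sub>R (complex_of_real (exp (- l * s))
         * of_real s powr (z - 1)))" for s
  proof (cases "s > 0")
    case True
    have "complex_of_real (l * s) powr (z - 1) = of_real l powr (z - 1) * of_real s powr (z - 1)"
      using True l by (simp add: of_real_powr_eq_exp ln_mult exp_add[symmetric] distrib_left del:
          of_real_mult)
    then show ?thesis using True l by (simp add: ind exp_minus divide_inverse)
  qed (use l in \<open>simp add: ind\<close>)
  have lz: "complex_of_real l powr (z - 1) \<noteq> 0" using l by simp
  have "integrable lborel (\<lambda>s. of_real l powr (z - 1)
      * (indicator {0<..} s *\<^sub>R (complex_of_real (exp (- l * s)) * of_real s powr (z - 1))))"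
    using lborel_integrable_real_affine[OF g(1)[unfolded set_integrable_def], of l 0] l unfolding eq
        by simp
  then have "integrable lborel (\<lambda>s. inverse (of_real l powr (z - 1)) * (of_real l powr (z - 1) *
      (indicator {0<..} s *\<^sub>R (complex_of_real (exp (- l * s)) * of_real s powr (z - 1)))))"
    by (rule integrable_mult_right)
  then show "set_integrable lborel {0<..} (\<lambda>s. complex_of_real (exp (- l * s)) * of_real s powr (z
      - 1))"
    unfolding set_integrable_def mult.assoc[symmetric] left_inverse[OF lz] by simp
  have "Gamma z = \<bar>l\<bar> *\<^sub>R (\<integral>s. indicator {0<..} (0 + l * s) *\<^sub>R ?f (0 + l * s) \<partial>lborel)"
    unfolding g(2)[symmetric] set_lebesgue_integral_def
    by (rule lborel_integral_real_affine) (use l in auto)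
  also have "\<dots> = of_real l * of_real l powr (z - 1) * (LBINT s:{0<..}. complex_of_real (exp (- l * s))
      * of_real s powr (z - 1))"
    unfolding eq integral_mult_right_zero set_lebesgue_integral_def using l
        by (simp add: scaleR_conv_of_real)
  also have "of_real l * of_real l powr (z - 1) = complex_of_real l powr z"
    using l by (simp add: powr_diff)
  finally show "(LBINT s:{0<..}. complex_of_real (exp (- l * s)) * of_real s powr (z - 1)) = Gamma z
      * of_real l powr (- z)"
    using l by (simp add: powr_minus field_simps)
qed

text \<open>Fubini for Lebesgue measure times counting measure. The exponentials are positive, so
  the sum of the norms of the terms is the norm of the summed integrand, and absolute convergence
  reduces to the hypothesis \<open>int\<close>.\<close>

lemma mellin_exp_sum:
  fixes l :: "'i::countable \<Rightarrow> real" and w :: complex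
  assumes w: "Re w > 0" and l: "\<And>m. m \<in> A \<Longrightarrow> l m > 0"
    and summ: "\<And>s. s > 0 \<Longrightarrow> (\<lambda>m. exp (- l m * s)) summable_on A"
    and int: "set_integrable lborel {0<..} (\<lambda>s. of_real (\<Sum>\<^sub>\<infinity>m\<in>A. exp (- l m * s)) * of_real s powr (w
        - 1))"
  shows "(LBINT s:{0<..}. of_real (\<Sum>\<^sub>\<infinity>m\<in>A. exp (- l m * s)) * of_real s powr (w - 1)) =
     Gamma w * (\<Sum>\<^sub>\<infinity>m\<in>A. of_real (l m) powr (- w))"
proof -
  define F where "F s m = indicator {0<..} s *\<^sub>R (complex_of_real (exp (- l m * s))
      * of_real s powr (w - 1))" for s m
  interpret P: pair_sigma_finite lborel "count_space A"
    by (intro pair_sigma_finite.intro sigma_finite_measure_count_space sigma_finite_lborel)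
  have "(\<lambda>(m, s). F s m) \<in> borel_measurable (count_space A \<Otimes>\<^sub>M lborel)"
    by (rule measurable_pair_measure_countable1) (auto simp: F_def)
  then have meas: "(\<lambda>(s, m). F s m) \<in> borel_measurable (lborel \<Otimes>\<^sub>M count_space A)"
    using measurable_pair_swap[of "\<lambda>(m, s). F s m"] by (simp add: case_prod_beta')
  have s_int: "integrable (count_space A) (\<lambda>m. exp (- l m * s))"
    "(\<integral>m. exp (- l m * s) \<partial>count_space A) = (\<Sum>\<^sub>\<infinity>m\<in>A. exp (- l m * s))" if "s > 0" for s
    using infsum_eq_integral_count_space[of "\<lambda>m. exp (- l m * s)" A] summ[OF that] by simp_all
  have F_int: "integrable (count_space A) (F s)" for s
  proof (cases "s > 0")
    case True
    have "integrable (count_space A) (\<lambda>m. complex_of_real (exp (- l m * s)) * of_real s powr (w - 1))"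
      by (intro integrable_mult_left integrable_of_real s_int True)
    then show ?thesis using True by (simp add: F_def[abs_def])
  qed (simp add: F_def[abs_def])
  have inner: "(\<integral>m. F s m \<partial>count_space A) =
      indicator {0<..} s *\<^sub>R (of_real (\<Sum>\<^sub>\<infinity>m\<in>A. exp (- l m * s)) * of_real s powr (w - 1))" for s
  proof (cases "s > 0")
    case True
    then show ?thesis using s_int[OF True] by (simp add: F_def s_int(2)[OF True, symmetric])
  qed (simp add: F_def)
  have inner_norm: "(\<integral>m. norm (F s m) \<partial>count_space A) =
      norm (indicator {0<..} s *\<^sub>R (of_real (\<Sum>\<^sub>\<infinity>m\<in>A. exp (- l m * s)) * of_real s powr (w - 1)))" for s
  proof (cases "s > 0")
    case True
    have "(\<Sum>\<^sub>\<infinity>m\<in>A. exp (- l m * s)) \<ge> 0" by (intro infsum_nonneg) simp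
    then show ?thesis
      using True s_int[OF True] by (simp add: F_def norm_mult s_int(2)[OF True, symmetric])
  qed (simp add: F_def)
  have prod_int: "integrable (lborel \<Otimes>\<^sub>M count_space A) (\<lambda>(s, m). F s m)"
  proof (rule P.Fubini_integrable[OF meas])
    show "integrable lborel (\<lambda>s. \<integral>m. norm (case (s, m) of (s, m) \<Rightarrow> F s m) \<partial>count_space A)"
      using int unfolding prod.case inner_norm set_integrable_def by (rule integrable_norm)
  qed (simp add: F_int)
  have outer: "(\<integral>s. F s m \<partial>lborel) = Gamma w * of_real (l m) powr (- w)" if "m \<in> A" for m
    using integral_exp_powr(2)[OF w l[OF that]] by (simp add: F_def set_lebesgue_integral_def)
  have "integrable (count_space A) (\<lambda>m. \<integral>s. F s m \<partial>lborel)"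
    using P.integrable_snd[OF prod_int] .
  then have "integrable (count_space A) (\<lambda>m. Gamma w * of_real (l m) powr (- w))"
    by (rule Bochner_Integration.integrable_cong[THEN iffD1, rotated -1]) (auto simp: outer)
  then have "Infinite_Set_Sum.abs_summable_on (\<lambda>m. Gamma w * of_real (l m) powr (- w)) A"
    by (simp add: Infinite_Set_Sum.abs_summable_on_def)
  then have "(\<integral>m. Gamma w * of_real (l m) powr (- w) \<partial>count_space A) = (\<Sum>\<^sub>\<infinity>m\<in>A. Gamma w
      * of_real (l m) powr (- w))"
    using infsetsum_infsum[of "\<lambda>m. Gamma w * of_real (l m) powr (- w)" A] by (simp add: infsetsum_def)
  also have "\<dots> = Gamma w * (\<Sum>\<^sub>\<infinity>m\<in>A. of_real (l m) powr (- w))"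
    by (rule infsum_cmult_right')
  finally have e1: "(\<integral>m. Gamma w * of_real (l m) powr (- w) \<partial>count_space A) = Gamma w
      * (\<Sum>\<^sub>\<infinity>m\<in>A. of_real (l m) powr (- w))" .
  have "(\<integral>s. \<integral>m. F s m \<partial>count_space A \<partial>lborel) = (\<integral>m. \<integral>s. F s m \<partial>lborel \<partial>count_space A)"
    by (rule P.Fubini_integral[OF prod_int, symmetric])
  also have "\<dots> = (\<integral>m. Gamma w * of_real (l m) powr (- w) \<partial>count_space A)"
    by (rule Bochner_Integration.integral_cong) (auto simp: outer)
  finally show ?thesis unfolding inner e1 set_lebesgue_integral_def .
qed

section \<open>The zeta function of the real torus\<close>

lemma real_torus_theta_sum:
  fixes \<alpha> :: "real ^ 'd::finite"
  assumes \<alpha>: "\<And>j. \<alpha> $ j > 0" and s: "s > 0"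
  shows "(\<lambda>m. exp (- real_torus_eigenvalue \<alpha> m * s)) summable_on UNIV"
    "(\<Sum>\<^sub>\<infinity>m. exp (- real_torus_eigenvalue \<alpha> m * s)) = real_torus_theta \<alpha> s"
proof -
  have pos: "s / (\<alpha> $ j)\<^sup>2 > 0" for j using s \<alpha>[of j] by simp
  let ?f = "\<lambda>j (k::int). exp (- (2 * pi * of_int k)\<^sup>2 * (s / (\<alpha> $ j)\<^sup>2))"
  have "real_torus_theta \<alpha> s = (\<Sum>\<^sub>\<infinity>g\<in>PiE UNIV (\<lambda>_. UNIV). \<Prod>j\<in>UNIV. ?f j (g j))"
    unfolding real_torus_theta_def circle_theta_def
    by (rule infsum_prod_PiE_abs[symmetric]) (use circle_theta_summable[OF pos] in simp_all)
  also have "\<dots> = (\<Sum>\<^sub>\<infinity>m::int^'d. \<Prod>j\<in>UNIV. ?f j (m $ j))"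
    by (rule infsum_reindex_bij_betw[symmetric, of "\<lambda>m. ($) m"])
      (auto intro!: bij_betwI[of _ _ _ vec_lambda])
  also have "(\<lambda>m::int^'d. \<Prod>j\<in>UNIV. ?f j (m $ j)) = (\<lambda>m. exp (- real_torus_eigenvalue \<alpha> m * s))"
    by (simp add: exp_sum[symmetric] real_torus_eigenvalue_def sum_distrib_left sum_distrib_right
        sum_negf power_mult_distrib fun_eq_iff)
  finally show eq: "(\<Sum>\<^sub>\<infinity>m. exp (- real_torus_eigenvalue \<alpha> m * s)) = real_torus_theta \<alpha> s" ..
  have "real_torus_theta \<alpha> s > 0"
    unfolding real_torus_theta_def using circle_theta_bounds(1)[OF pos]
    by (intro prod_pos) (auto intro: less_le_trans[OF zero_less_one])
  then show "(\<lambda>m. exp (- real_torus_eigenvalue \<alpha> m * s)) summable_on UNIV"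
    \<comment> \<open>a family that is not summable has the sum 0\<close>
    using infsum_not_exists eq by fastforce
qed

lemma real_torus_eigenvalue_pos:
  assumes \<alpha>: "\<And>j. \<alpha> $ j > 0" and m: "m \<noteq> 0"
  shows "real_torus_eigenvalue \<alpha> m > 0"
proof -
  obtain j where "m $ j \<noteq> 0" using m by (auto simp: vec_eq_iff)
  then have "(of_int (m $ j))\<^sup>2 / (\<alpha> $ j)\<^sup>2 > 0" using \<alpha>[of j] by simp
  then have "(\<Sum>j\<in>UNIV. (of_int (m $ j))\<^sup>2 / (\<alpha> $ j)\<^sup>2) > 0"
    by (intro sum_pos2[of _ j]) auto
  then show ?thesis by (simp add: real_torus_eigenvalue_def)
qed

lemma real_torus_theta_minus_1:
  assumes \<alpha>: "\<And>j. \<alpha> $ j > 0" and s: "s > 0"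
  shows "(\<lambda>m. exp (- real_torus_eigenvalue \<alpha> m * s)) summable_on (UNIV - {0})"
    "(\<Sum>\<^sub>\<infinity>m\<in>UNIV - {0}. exp (- real_torus_eigenvalue \<alpha> m * s)) = real_torus_theta \<alpha> s - 1"
proof -
  note 1 = real_torus_theta_sum[OF \<alpha> s]
  show "(\<lambda>m. exp (- real_torus_eigenvalue \<alpha> m * s)) summable_on (UNIV - {0})"
    by (rule summable_on_subset_banach[OF 1(1)]) simp
  have "(\<Sum>\<^sub>\<infinity>m\<in>UNIV - {0}. exp (- real_torus_eigenvalue \<alpha> m * s)) =
     (\<Sum>\<^sub>\<infinity>m. exp (- real_torus_eigenvalue \<alpha> m * s)) - (\<Sum>\<^sub>\<infinity>m\<in>{0}. exp (- real_torus_eigenvalue \<alpha> m * s))"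
    by (rule infsum_Diff) (use 1(1) in auto)
  then show "(\<Sum>\<^sub>\<infinity>m\<in>UNIV - {0}. exp (- real_torus_eigenvalue \<alpha> m * s)) = real_torus_theta \<alpha> s - 1"
    unfolding 1(2) by (simp add: real_torus_eigenvalue_def)
qed

text \<open>A pointwise limit of theta functions of cycles, cut off at 0 because that limit is
  established for positive \<open>s\<close> only.\<close>

lemma borel_measurable_circle_theta:
  "(\<lambda>s. if s > 0 then circle_theta s else 0) \<in> borel_measurable borel"
proof (rule borel_measurable_LIMSEQ_real)
  fix s :: real
  have n: "filterlim (\<lambda>i. real (Suc i)) at_top sequentially"
    by (rule filterlim_compose[OF filterlim_real_sequentially filterlim_Suc])
  show "(\<lambda>i. if s > 0 then cycle_theta (Suc i) (s * (real (Suc i))\<^sup>2) else 0) \<longlonglongrightarrow>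
     (if s > 0 then circle_theta s else 0)"
    using cycle_theta_tendsto[OF n, of "\<lambda>i. s * (real (Suc i))\<^sup>2" s] by simp
qed measurable

text \<open>Subtracting the blow-up on \<open>{0<..1}\<close> and the zero mode on
  \<open>{1<..}\<close> leaves rapid decay at both ends, hence an entire Mellin transform. What is
  subtracted can be integrated in closed form.\<close>

definition mellin_kernel :: "real ^ 'd::finite \<Rightarrow> real \<Rightarrow> real" where
  "mellin_kernel \<alpha> s = (if s \<le> 0 then 0 else if s \<le> 1 then real_torus_theta \<alpha> s - flat_heat \<alpha> s
     else real_torus_theta \<alpha> s - 1)"

lemma borel_measurable_mellin_kernel:
  assumes \<alpha>: "\<And>j. \<alpha> $ j > 0"
  shows "mellin_kernel \<alpha> \<in> borel_measurable borel"
proof -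
  define g where "g s = (if s > 0 then circle_theta s else 0)" for s
  have g [measurable]: "g \<in> borel_measurable borel"
    unfolding g_def by (rule borel_measurable_circle_theta)
  have "mellin_kernel \<alpha> = (\<lambda>s. if s \<le> 0 then 0 else if s \<le> 1 then (\<Prod>j\<in>UNIV. g (s / (\<alpha> $ j)\<^sup>2))
      - flat_heat \<alpha> s
     else (\<Prod>j\<in>UNIV. g (s / (\<alpha> $ j)\<^sup>2)) - 1)"
    using \<alpha> by (auto simp: fun_eq_iff mellin_kernel_def real_torus_theta_def g_def less_imp_neq[THEN
        not_sym])
  also have "\<dots> \<in> borel_measurable borel" unfolding flat_heat_def by measurable
  finally show ?thesis .
qed

lemma power_le_exp_minus_1:
  fixes x :: real
  assumes "x \<ge> 0" "K > 0"
  shows "x ^ K / fact K \<le> exp x - 1"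
proof -
  have "(\<Sum>k\<in>{0, K}. x ^ k /\<^sub>R fact k) \<le> (\<Sum>k. x ^ k /\<^sub>R fact k)"
    by (rule sum_le_suminf[OF summable_exp_generic]) (use assms in auto)
  then show ?thesis using assms by (simp add: exp_def divide_inverse mult.commute)
qed

text \<open>Near 0 the coordinate estimate is taken with exponent \<open>K + d\<close>, because
  telescoping the product loses \<open>s^(-d)\<close>. At infinity the exponential decay of each
  factor towards 1 is weakened to \<open>s^(-K)\<close>, so that both ends have the same
  form.\<close>

lemma mellin_kernel_bound:
  fixes \<alpha> :: "real ^ 'd::finite"
  assumes \<alpha>: "\<And>j. \<alpha> $ j > 0" and K: "K > 0"
  shows "\<exists>C\<ge>0. \<forall>s>0. \<bar>mellin_kernel \<alpha> s\<bar> \<le> (if s \<le> 1 then C * s ^ K else C / s ^ K)"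
proof -
  define d where "d = CARD('d)"
  have pos: "s / (\<alpha> $ j)\<^sup>2 > 0" if "s > 0" for j s using that \<alpha>[of j] by simp
  obtain C0 where C0: "C0 \<ge> 0" "\<And>s. s > 0 \<Longrightarrow> circle_theta s - 1 / (2 * sqrt (pi * s)) \<le> C0 * s ^ (K + d)"
    using circle_theta_heat_bounds(2)[of "K + d"] by blast
  define E where "E = (\<Sum>j\<in>UNIV. (\<alpha> $ j)\<^sup>2)"
  define B1 where "B1 = (\<Sum>j\<in>UNIV. C0 / ((\<alpha> $ j)\<^sup>2) ^ (K + d))"
  define B2 where "B2 = (\<Sum>j\<in>UNIV. 2 * fact K * ((\<alpha> $ j)\<^sup>2) ^ K)"
  have E: "(\<alpha> $ j)\<^sup>2 \<le> E" for j unfolding E_def by (rule member_le_sum) auto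
  have B1: "C0 / ((\<alpha> $ j)\<^sup>2) ^ (K + d) \<le> B1" for j
    unfolding B1_def by (rule member_le_sum) (use C0 in auto)
  have B2: "2 * fact K * ((\<alpha> $ j)\<^sup>2) ^ K \<le> B2" for j unfolding B2_def by (rule member_le_sum) auto
  have nn: "E \<ge> 0" "B1 \<ge> 0" "B2 \<ge> 0" using C0 by (auto simp: E_def B1_def B2_def intro!: sum_nonneg)
  have th: "1 \<le> circle_theta (s / (\<alpha> $ j)\<^sup>2) \<and> circle_theta (s / (\<alpha> $ j)\<^sup>2) \<le> 1 + E / s" if "s > 0"
      for s j
  proof -
    have "circle_theta (s / (\<alpha> $ j)\<^sup>2) \<le> 1 + 1 / (8 * (s / (\<alpha> $ j)\<^sup>2))"
      using circle_theta_bounds(2)[OF pos[OF that]] theta_tail_le[OF pos[OF that]]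
          by (meson add_left_mono order_trans)
    also have "1 / (8 * (s / (\<alpha> $ j)\<^sup>2)) = (\<alpha> $ j)\<^sup>2 / 8 / s" by simp
    also have "\<dots> \<le> E / s" using that E[of j] nn(1) by (intro divide_right_mono) auto
    finally show ?thesis using circle_theta_bounds(1)[OF pos[OF that]] by simp
  qed
  define C where "C = real d * (1 + E) ^ d * B1 + real d * (1 + E) ^ d * B2"
  have C: "C \<ge> 0" using nn by (simp add: C_def)
  have "\<bar>mellin_kernel \<alpha> s\<bar> \<le> (if s \<le> 1 then C * s ^ K else C / s ^ K)" if s: "s > 0" for s
  proof (cases "s \<le> 1")
    case True
    have xM: "circle_theta (s / (\<alpha> $ j)\<^sup>2) \<le> (1 + E) / s" for j
    proof -
      have "1 + E / s \<le> 1 / s + E / s" using s True by simp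
      also have "\<dots> = (1 + E) / s" by (simp add: add_divide_distrib)
      finally show ?thesis using th[OF s, of j] by linarith
    qed
    have g: "1 / (2 * sqrt (pi * (s / (\<alpha> $ j)\<^sup>2))) = \<alpha> $ j / (2 * sqrt (pi * s))" for j
      using \<alpha>[of j] by (simp add: real_sqrt_divide)
    have g_le: "\<alpha> $ j / (2 * sqrt (pi * s)) \<le> circle_theta (s / (\<alpha> $ j)\<^sup>2)" for j
      using circle_theta_heat_bounds(1)[OF pos[OF s], of j] unfolding g .
    have g_nn: "0 \<le> \<alpha> $ j / (2 * sqrt (pi * s))" for j using \<alpha>[of j] s by simp
    have diff: "circle_theta (s / (\<alpha> $ j)\<^sup>2) - \<alpha> $ j / (2 * sqrt (pi * s)) \<le> B1 * s ^ (K + d)" for j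
    proof -
      have "circle_theta (s / (\<alpha> $ j)\<^sup>2) - \<alpha> $ j / (2 * sqrt (pi * s)) \<le> C0 * (s / (\<alpha> $ j)\<^sup>2) ^ (K + d)"
        using C0(2)[OF pos[OF s], of j] unfolding g .
      also have "\<dots> = C0 / ((\<alpha> $ j)\<^sup>2) ^ (K + d) * s ^ (K + d)" by (simp add: power_divide)
      also have "\<dots> \<le> B1 * s ^ (K + d)" using B1 s by (intro mult_right_mono) auto
      finally show ?thesis .
    qed
    have "\<bar>real_torus_theta \<alpha> s - flat_heat \<alpha> s\<bar> \<le> real d * ((1 + E) / s) ^ d * (B1 * s ^ (K + d))"
      unfolding real_torus_theta_def flat_heat_def d_def
    proof (rule abs_prod_diff_le)
      show "1 \<le> (1 + E) / s" using s True nn by simp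
      fix j
      show "\<bar>circle_theta (s / (\<alpha> $ j)\<^sup>2)\<bar> \<le> (1 + E) / s" using xM[of j] th[OF s, of j] by auto
      show "\<bar>\<alpha> $ j / (2 * sqrt (pi * s))\<bar> \<le> (1 + E) / s" using xM[of j] g_le[of j] g_nn[of j]
          by linarith
      show "\<bar>circle_theta (s / (\<alpha> $ j)\<^sup>2) - \<alpha> $ j / (2 * sqrt (pi * s))\<bar> \<le> B1 * s ^ (K + CARD('d))"
        using diff[of j] g_le[of j] unfolding d_def by linarith
    qed simp
    also have "\<dots> = real d * (1 + E) ^ d * B1 * s ^ K"
      using s by (simp add: power_divide power_add)
    also have "\<dots> \<le> C * s ^ K" using s nn unfolding C_def by (intro mult_right_mono) auto
    finally show ?thesis using s True by (simp add: mellin_kernel_def)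
  next
    case False
    have "E / s \<le> E" using nn False mult_left_mono[of 1 s E] by (simp add: divide_le_eq)
    have diff: "circle_theta (s / (\<alpha> $ j)\<^sup>2) - 1 \<le> B2 / s ^ K" for j
    proof -
      define x where "x = s / (\<alpha> $ j)\<^sup>2"
      have x: "x > 0" unfolding x_def by (rule pos[OF s])
      have "x ^ K / fact K \<le> (16 * x) ^ K / fact K"
        using x by (intro divide_right_mono power_mono) auto
      also have "\<dots> \<le> exp (16 * x) - 1" using x K by (intro power_le_exp_minus_1) auto
      finally have "2 / (exp (16 * x) - 1) \<le> 2 / (x ^ K / fact K)"
        using x by (intro divide_left_mono) (auto intro!: mult_pos_pos)
      also have "\<dots> = 2 * fact K * ((\<alpha> $ j)\<^sup>2) ^ K / s ^ K" by (simp add: x_def power_divide)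
      also have "\<dots> \<le> B2 / s ^ K" using B2 s by (intro divide_right_mono) auto
      finally show ?thesis using circle_theta_bounds(2)[OF x] unfolding x_def by linarith
    qed
    have "\<bar>real_torus_theta \<alpha> s - (\<Prod>j\<in>(UNIV :: 'd set). 1)\<bar> \<le> real d * (1 + E) ^ d * (B2 / s ^ K)"
      unfolding real_torus_theta_def d_def
    proof (rule abs_prod_diff_le)
      fix j
      show "\<bar>circle_theta (s / (\<alpha> $ j)\<^sup>2)\<bar> \<le> 1 + E" using th[OF s, of j] \<open>E / s \<le> E\<close> by linarith
      show "\<bar>circle_theta (s / (\<alpha> $ j)\<^sup>2) - 1\<bar> \<le> B2 / s ^ K" using th[OF s, of j] diff[of j] by linarith
    qed (use nn in auto)
    also have "\<dots> = real d * (1 + E) ^ d * B2 / s ^ K" by simp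
    also have "\<dots> \<le> C / s ^ K" using s nn unfolding C_def by (intro divide_right_mono) auto
    finally show ?thesis using s False by (simp add: mellin_kernel_def)
  qed
  then show ?thesis using C by blast
qed

lemma mellin_kernel_dominated:
  fixes \<alpha> :: "real ^ 'd::finite"
  assumes \<alpha>: "\<And>j. \<alpha> $ j > 0"
  shows "\<exists>C. \<forall>s>0. \<bar>mellin_kernel \<alpha> s\<bar> * exp (R * \<bar>ln s\<bar>) / s \<le> dominating C s"
proof -
  \<comment> \<open>The weight is at most \<open>s^(-n)\<close> for \<open>s \<le> 1\<close> and at
    most \<open>s^n\<close> for \<open>s > 1\<close>; two further powers leave room for the division
    by \<open>s\<close> and for decay at infinity.\<close>
  define n where "n = nat \<lceil>R\<rceil>"
  obtain C where C: "C \<ge> 0" "\<And>s. s > 0 \<Longrightarrow> \<bar>mellin_kernel \<alpha> s\<bar> \<le> (if s \<le> 1 then C * s ^ (n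
      + 2) else C / s ^ (n + 2))"
    using mellin_kernel_bound[OF \<alpha>, of "n + 2"] by auto
  have "\<bar>mellin_kernel \<alpha> s\<bar> * exp (R * \<bar>ln s\<bar>) / s \<le> dominating C s" if s: "s > 0" for s
  proof -
    have "R \<le> real n" unfolding n_def by linarith
    then have "exp (R * \<bar>ln s\<bar>) \<le> exp (real n * \<bar>ln s\<bar>)" by (simp add: mult_right_mono)
    also have "\<dots> = exp \<bar>ln s\<bar> ^ n" by (rule exp_of_nat_mult)
    finally have e: "exp (R * \<bar>ln s\<bar>) \<le> exp \<bar>ln s\<bar> ^ n" .
    show ?thesis
    proof (cases "s \<le> 1")
      case True
      have "exp \<bar>ln s\<bar> = 1 / s" using s True by (simp add: exp_minus divide_inverse)
      with e have "\<bar>mellin_kernel \<alpha> s\<bar> * exp (R * \<bar>ln s\<bar>) \<le> C * s ^ (n + 2) * (1 / s) ^ n"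
        using C(1) C(2)[OF s] s True by (intro mult_mono) auto
      also have "\<dots> = C * s * s" using s by (simp add: power_add power_divide power2_eq_square)
      finally have "\<bar>mellin_kernel \<alpha> s\<bar> * exp (R * \<bar>ln s\<bar>) / s \<le> C * s * s / s"
        using s by (intro divide_right_mono) auto
      also have "\<dots> \<le> C * 1" using s True C(1) mult_left_mono[OF True C(1)] by simp
      finally show ?thesis using True by (simp add: dominating_def)
    next
      case False
      have "exp \<bar>ln s\<bar> = s" using s False by simp
      with e have "\<bar>mellin_kernel \<alpha> s\<bar> * exp (R * \<bar>ln s\<bar>) \<le> C / s ^ (n + 2) * s ^ n"
        using C(1) C(2)[OF s] s False by (intro mult_mono) auto
      also have "\<dots> = C / s ^ 2" using s by (simp add: power_add power2_eq_square)
      finally have "\<bar>mellin_kernel \<alpha> s\<bar> * exp (R * \<bar>ln s\<bar>) / s \<le> C / s ^ 2 / s"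
        using s by (intro divide_right_mono) auto
      also have "\<dots> = C * s powr (- 3)" using s
          by (simp add: powr_minus powr_numeral power3_eq_cube power2_eq_square divide_inverse)
      also have "\<dots> \<le> C * s powr (- 3 / 2)" using C(1) False by (intro mult_left_mono powr_mono) auto
      finally show ?thesis using False by (simp add: dominating_def)
    qed
  qed
  then show ?thesis by blast
qed

section \<open>Euler's constant as an integral; uniqueness of the continuation\<close>

lemma set_integral_Ioi_eq_Ici:
  fixes f :: "real \<Rightarrow> real"
  assumes "f \<in> borel_measurable borel"
  shows "(LBINT s:{a<..}. f s) = (LBINT s:{a..}. f s)"
  unfolding set_lebesgue_integral_def
  by (rule integral_cong_AE)
    (use assms AE_lborel_singleton[of a] in \<open>auto simp: indicator_def elim!: eventually_mono\<close>)

lemma Re_pos_not_nonpos_Ints: "Re z > 0 \<Longrightarrow> z \<notin> \<int>\<^sub>\<le>\<^sub>0"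
  by (auto elim!: nonpos_Ints_cases)

text \<open>With the extra weight \<open>s^y\<close>, \<open>y > 0\<close>, the two terms are
  integrable separately and give \<open>Gamma y - 1 / y\<close>, which is the difference quotient
  \<open>(Gamma (1 + y) - Gamma 1) / y\<close>. Dominated convergence along \<open>y = x n\<close>
  produces the derivative of Gamma at 1.\<close>

lemma euler_mascheroni_integral:
  shows "set_integrable lborel {0<..} (\<lambda>s. (exp (- s) - indicator {..1} s) / s :: real)"
    "(LBINT s:{0<..}. (exp (- s) - indicator {..1} s) / s :: real) = - euler_mascheroni"
proof -
  define f where "f s = exp (- s) - indicator {..1} s" for s :: real
  define x where "x n = 1 / real (Suc n)" for n
  have x: "x n > 0" "x n \<le> 1" for n by (auto simp: x_def)
  have x0: "x \<longlonglongrightarrow> 0" unfolding x_def by (rule LIMSEQ_Suc[OF lim_1_over_n])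
  have fm [measurable]: "f \<in> borel_measurable borel" unfolding f_def by measurable
  let ?F = "\<lambda>(y::real) s. indicator {0<..} s *\<^sub>R (of_real (f s) * of_real s powr (complex_of_real y
      - 1))"
  have Fm: "?F y \<in> borel_measurable borel" for y by measurable
  have bound: "norm (?F y s) \<le> indicator {0<..} s *\<^sub>R dominating 2 s" if y: "0 \<le> y" "y \<le> 1" for y s
  proof (cases "s > 0")
    case True
    have n: "norm (?F y s) = \<bar>f s\<bar> * s powr (y - 1)"
      using True norm_powr_real_powr[of "complex_of_real s" "complex_of_real y - 1"]
          by (simp add: norm_mult)
    have "\<bar>f s\<bar> * s powr (y - 1) \<le> dominating 2 s"
    proof (cases "s \<le> 1")
      case True
      have "\<bar>f s\<bar> \<le> s" using abs_exp_minus_one_le[of s] \<open>s > 0\<close> True by (simp add: f_def)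
      then have "\<bar>f s\<bar> * s powr (y - 1) \<le> s * s powr (y - 1)" by (intro mult_right_mono) auto
      also have "\<dots> = s powr y" using \<open>s > 0\<close> by (simp add: powr_diff)
      also have "\<dots> \<le> 1" using True y \<open>s > 0\<close> by (intro powr_le1) auto
      finally show ?thesis using True by (simp add: dominating_def)
    next
      case False
      have "\<bar>f s\<bar> = exp (- s)" using False by (simp add: f_def)
      also have "\<dots> \<le> 2 / s ^ 2" using exp_neg_le_fact[OF \<open>s > 0\<close>, of 2] by simp
      also have "\<dots> = 2 * s powr (- 2)" using \<open>s > 0\<close> by (simp add: powr_minus divide_inverse)
      also have "\<dots> \<le> 2 * s powr (- 3 / 2)" using False by (intro mult_left_mono powr_mono) auto
      finally have "\<bar>f s\<bar> * s powr (y - 1) \<le> 2 * s powr (- 3 / 2) * s powr 0"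
        using False y by (intro mult_mono powr_mono) auto
      then show ?thesis using False by (simp add: dominating_def)
    qed
    then show ?thesis using n True by simp
  qed simp
  note dct = dominating_integrable[of 2, unfolded set_integrable_def]
  have int: "integrable lborel (?F y)" if "0 \<le> y" "y \<le> 1" for y
    by (rule Bochner_Integration.integrable_bound[OF dct])
      (use bound[OF that] Fm in \<open>auto intro!: AE_I2 intro: order_trans[OF _ abs_ge_self]\<close>)
  have lim1: "(\<lambda>n. integral\<^sup>L lborel (?F (x n))) \<longlonglongrightarrow> integral\<^sup>L lborel (?F 0)"
  proof (rule integral_dominated_convergence[OF _ _ dct])
    show "AE s in lborel. (\<lambda>n. ?F (x n) s) \<longlonglongrightarrow> ?F 0 s"
    proof (rule AE_I2)
      fix s :: real
      show "(\<lambda>n. ?F (x n) s) \<longlonglongrightarrow> ?F 0 s"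
      proof (cases "s > 0")
        case True
        then show ?thesis
          unfolding of_real_powr_eq_exp[OF True]
          by (intro tendsto_intros tendsto_of_real x0)
      qed simp
    qed
  qed (use bound x Fm in \<open>auto simp: less_imp_le\<close>)
  have eq: "integral\<^sup>L lborel (?F (x n)) = (Gamma (of_real (x n) + 1) - Gamma 1) / of_real (x n)" for n
  proof -
    let ?z = "complex_of_real (x n)"
    have z: "Re ?z > 0" using x by simp
    have "?F (x n) s = indicator {0<..} s *\<^sub>R (complex_of_real (exp (- 1 * s)) * of_real s powr (?z
        - 1))
        - indicator {0<..1} s *\<^sub>R (of_real s powr (?z - 1))" for s
      by (auto simp: f_def indicator_def algebra_simps)
    then have "integral\<^sup>L lborel (?F (x n)) = (LBINT s:{0<..}. complex_of_real (exp (- 1 * s))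
        * of_real s powr (?z - 1))
       - (LBINT s:{0<..1}. of_real s powr (?z - 1))"
      using integral_exp_powr(1)[OF z zero_less_one] integral_powr_unit_interval(1)[OF z]
      by (simp add: set_integrable_def set_lebesgue_integral_def)
    also have "\<dots> = Gamma ?z - 1 / ?z"
      using integral_exp_powr(2)[OF z zero_less_one] integral_powr_unit_interval(2)[OF z] by simp
    also have "\<dots> = (Gamma (?z + 1) - Gamma 1) / ?z"
    proof -
      have "?z \<notin> \<int>\<^sub>\<le>\<^sub>0" using z by (rule Re_pos_not_nonpos_Ints)
      then have "Gamma (?z + 1) = ?z * Gamma ?z" by (rule Gamma_plus1)
      then show ?thesis using x[of n] by (simp add: diff_divide_distrib)
    qed
    finally show ?thesis .
  qed
  have "(Gamma has_field_derivative (Gamma 1 * Digamma 1)) (at (1 :: complex))"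
    by (rule has_field_derivative_Gamma) (auto elim!: nonpos_Ints_cases)
  then have "(\<lambda>h. (Gamma (1 + h) - Gamma 1) / h) \<midarrow>0\<rightarrow> (- euler_mascheroni :: complex)"
    by (simp add: DERIV_def)
  moreover have "filterlim (\<lambda>n. complex_of_real (x n)) (at 0) sequentially"
    using tendsto_of_real[OF x0, where 'a = complex] x(1)
        by (simp add: filterlim_at less_imp_neq[THEN not_sym])
  ultimately have "(\<lambda>n. (Gamma (1 + complex_of_real (x n)) - Gamma 1) / of_real (x n)) \<longlonglongrightarrow>
      - euler_mascheroni"
    by (rule filterlim_compose)
  with lim1 have e: "integral\<^sup>L lborel (?F 0) = - euler_mascheroni"
    unfolding eq by (intro LIMSEQ_unique) (auto simp: add.commute)
  have F0: "?F 0 s = complex_of_real (indicator {0<..} s *\<^sub>R ((exp (- s) - indicator {..1} s) / s))"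
      for s
    by (auto simp: f_def powr_minus divide_inverse indicator_def)
  have "integrable lborel (\<lambda>s. complex_of_real (indicator {0<..} s *\<^sub>R ((exp (- s)
      - indicator {..1} s) / s)))"
    using int[of 0] unfolding F0 by simp
  then have "integrable lborel (\<lambda>s. Re (complex_of_real (indicator {0<..} s *\<^sub>R ((exp (- s)
      - indicator {..1} s) / s))))"
    by (rule integrable_Re)
  then show "set_integrable lborel {0<..} (\<lambda>s. (exp (- s) - indicator {..1} s) / s :: real)"
    unfolding set_integrable_def Re_complex_of_real .
  have "complex_of_real (LBINT s:{0<..}. (exp (- s) - indicator {..1} s) / s)
      = of_real (- euler_mascheroni)"
    using e unfolding F0 set_lebesgue_integral_def integral_complex_of_real by simp
  then show "(LBINT s:{0<..}. (exp (- s) - indicator {..1} s) / s :: real) = - euler_mascheroni"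
    unfolding of_real_eq_iff .
qed

text \<open>By the identity theorem the difference, with its removable singularities filled in,
  vanishes everywhere, so the functions agree on a punctured neighbourhood of every point. Nice
  meromorphy then fixes the value at the point: the limit, or 0 at a pole, where convergence to the
  value is impossible.\<close>

lemma nicely_meromorphic_unique:
  assumes f: "f nicely_meromorphic_on UNIV" and g: "g nicely_meromorphic_on UNIV"
    and eq: "\<And>w. Re w > a \<Longrightarrow> f w = g w"
  shows "f = g"
proof
  fix z
  have mero: "(\<lambda>w. f w - g w) meromorphic_on UNIV"
    using f g by (intro meromorphic_intros) (auto simp: nicely_meromorphic_on_def)
  let ?D = "remove_sings (\<lambda>w. f w - g w)"
  let ?w = "complex_of_real (a + 1)"
  have iso: "isolated_singularity_at (\<lambda>w. f w - g w) w" for w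
    using meromorphic_on_isolated_singularity mero meromorphic_on_subset by blast
  have "\<forall>\<^sub>F w in nhds ?w. w \<in> {w. Re w > a}"
    by (intro eventually_nhds_in_open open_halfspace_Re_gt) auto
  then have "\<forall>\<^sub>F w in at ?w. f w - g w = 0"
    by (auto simp: eventually_at_filter elim!: eventually_mono intro!: eq)
  then have "\<forall>\<^sub>F w in at ?w. ?D w = 0"
    using eventually_remove_sings_eq_at[OF iso, of ?w] by eventually_elim simp
  then have "\<exists>\<^sub>F w in at ?w. ?D w = 0"
    by (intro eventually_frequently) auto
  from frequently_eq_meromorphic_imp_constant[OF this remove_sings_nicely_meromorphic[OF mero]]
  have D0: "?D w = 0" for w by auto
  have ev: "\<forall>\<^sub>F w in at z. f w = g w"
    using eventually_remove_sings_eq_at[OF iso, of z] by eventually_elim (simp add: D0)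
  show "f z = g z"
  proof (cases "is_pole f z")
    case True
    then have "is_pole g z" using ev is_pole_cong by blast
    moreover have "\<not> h \<midarrow>z\<rightarrow> h z" if "is_pole h z" for h :: "complex \<Rightarrow> complex"
      using that not_tendsto_and_filterlim_at_infinity[of "at z" h "h z"] by (auto simp: is_pole_def)
    ultimately have "f z = 0" "g z = 0"
      using True f g by (auto simp: nicely_meromorphic_on_def)
    then show ?thesis by simp
  next
    case False
    then have "\<not> is_pole g z" using ev is_pole_cong by blast
    then have "f \<midarrow>z\<rightarrow> f z" "g \<midarrow>z\<rightarrow> g z" using False f g by (auto simp: nicely_meromorphic_on_def)
    moreover have "f \<midarrow>z\<rightarrow> g z" using tendsto_cong[OF ev] \<open>g \<midarrow>z\<rightarrow> g z\<close> by simp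
    ultimately show ?thesis by (intro tendsto_unique[of "at z" f]) auto
  qed
qed

section \<open>The continuation of the zeta function and its derivative at 0\<close>

lemma flat_heat_powr:
  fixes \<alpha> :: "real ^ 'd::finite"
  assumes s: "s > 0"
  shows "flat_heat \<alpha> s = flat_heat \<alpha> 1 * s powr (- real CARD('d) / 2)"
proof -
  have "s powr (- real CARD('d) / 2) = (s powr (- (1 / 2))) ^ CARD('d)"
    using s by (simp add: powr_power)
  also have "s powr (- (1 / 2)) = 1 / sqrt s" 
    unfolding powr_minus powr_half_sqrt[OF less_imp_le[OF s]] by (rule inverse_eq_divide)
  also have "(1 / sqrt s) ^ CARD('d) = (\<Prod>j\<in>(UNIV :: 'd set). 1 / sqrt s)" by simp
  finally have p: "s powr (- real CARD('d) / 2) = (\<Prod>j\<in>(UNIV :: 'd set). 1 / sqrt s)" .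
  show ?thesis
    unfolding flat_heat_def p prod.distrib[symmetric]
    by (intro prod.cong refl) (simp add: real_sqrt_mult)
qed

definition zeta_mellin :: "real ^ 'd::finite \<Rightarrow> complex \<Rightarrow> complex" where
  "zeta_mellin \<alpha> w = (LBINT s:{0<..}. of_real (mellin_kernel \<alpha> s) * of_real s powr (w - 1))"

text \<open>The last term is \<open>rGamma w / w\<close>, coming from the zero mode. Written as
  \<open>rGamma (w + 1)\<close> it has no singularity at 0, so \<open>d / 2\<close> is the only
  point where analyticity can fail.\<close>

definition zeta_continuation :: "real ^ 'd::finite \<Rightarrow> complex \<Rightarrow> complex" where
  "zeta_continuation \<alpha> w = rGamma w * (zeta_mellin \<alpha> w + of_real (flat_heat \<alpha> 1) / (w
      - of_real (real CARD('d) / 2)))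
     - rGamma (w + 1)"

context
  fixes \<alpha> :: "real ^ 'd::finite"
  assumes \<alpha>: "\<And>j. \<alpha> $ j > 0"
begin

lemmas zeta_mellin_integrable = mellin_entire(1)[OF borel_measurable_mellin_kernel[OF \<alpha>]
    mellin_kernel_dominated[OF \<alpha>]]

lemma zeta_mellin_holomorphic: "zeta_mellin \<alpha> holomorphic_on A"
  using mellin_entire(2)[OF borel_measurable_mellin_kernel[OF \<alpha>] mellin_kernel_dominated[OF \<alpha>]]
  unfolding zeta_mellin_def[abs_def] by (rule holomorphic_on_subset) simp

text \<open>On \<open>{0<..1}\<close> theta minus 1 differs from the kernel by
  \<open>flat_heat\<close> minus 1. These two pieces contribute the fractions with denominators
  \<open>w - d / 2\<close> and \<open>w\<close>; convergence of the first requires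
  \<open>Re w > d / 2\<close>.\<close>

lemma theta_mellin:
  assumes w: "Re w > real CARD('d) / 2"
  shows "set_integrable lborel {0<..} (\<lambda>s. of_real (real_torus_theta \<alpha> s - 1) * of_real s powr (w - 1))"
    "(LBINT s:{0<..}. of_real (real_torus_theta \<alpha> s - 1) * of_real s powr (w - 1)) =
       zeta_mellin \<alpha> w + of_real (flat_heat \<alpha> 1) / (w - of_real (real CARD('d) / 2)) - 1 / w"
proof -
  let ?c = "complex_of_real (flat_heat \<alpha> 1)" and ?v = "w - of_real (real CARD('d) / 2)"
  have v: "Re ?v > 0" "Re w > 0" using w by (auto intro: le_less_trans[rotated])
  let ?A = "\<lambda>s. indicator {0<..} s *\<^sub>R (of_real (mellin_kernel \<alpha> s) * of_real s powr (w - 1))"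
  let ?B = "\<lambda>s. ?c * (indicator {0<..1} s *\<^sub>R (complex_of_real s powr (?v - 1)))"
  let ?C = "\<lambda>s. indicator {0<..1} s *\<^sub>R (complex_of_real s powr (w - 1))"
  have eq: "indicator {0<..} s *\<^sub>R (of_real (real_torus_theta \<alpha> s - 1) * of_real s powr (w - 1))
      = ?A s + ?B s - ?C s" for s
  proof -
    consider "s \<le> 0" | "0 < s" "s \<le> 1" | "s > 1" by linarith
    then show ?thesis
    proof cases
      case 2
      have "of_real (flat_heat \<alpha> s) * complex_of_real s powr (w - 1) = ?c * of_real s powr (?v - 1)"
      proof -
        have "complex_of_real (s powr (- real CARD('d) / 2))
            = of_real s powr (of_real (- real CARD('d) / 2))"
          using 2 by (intro powr_of_real[symmetric]) simp
        moreover have "?v - 1 = of_real (- real CARD('d) / 2) + (w - 1)" by simp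
        ultimately show ?thesis
          unfolding flat_heat_powr[OF 2(1), of \<alpha>] of_real_mult by (simp only: powr_add mult.assoc)
      qed
      then show ?thesis using 2 by (simp add: mellin_kernel_def algebra_simps)
    qed (auto simp: mellin_kernel_def)
  qed
  have A: "integrable lborel ?A" using zeta_mellin_integrable[of w] by (simp add: set_integrable_def)
  have B: "integrable lborel ?B"
    using integral_powr_unit_interval(1)[OF v(1)] unfolding set_integrable_def
        by (rule integrable_mult_right)
  have C: "integrable lborel ?C"
    using integral_powr_unit_interval(1)[OF v(2)] unfolding set_integrable_def .
  show "set_integrable lborel {0<..} (\<lambda>s. of_real (real_torus_theta \<alpha> s - 1) * of_real s powr (w - 1))"
    unfolding set_integrable_def eq by (intro Bochner_Integration.integrable_diff
        Bochner_Integration.integrable_add A B C)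
  have "(LBINT s:{0<..}. of_real (real_torus_theta \<alpha> s - 1) * of_real s powr (w - 1)) =
     integral\<^sup>L lborel ?A + integral\<^sup>L lborel ?B - integral\<^sup>L lborel ?C"
    unfolding set_lebesgue_integral_def eq using A B C by simp
  also have "integral\<^sup>L lborel ?A = zeta_mellin \<alpha> w"
      by (simp only: zeta_mellin_def set_lebesgue_integral_def)
  also have "integral\<^sup>L lborel ?B = ?c * (1 / ?v)"
    unfolding integral_mult_right_zero using integral_powr_unit_interval(2)[OF v(1)]
        by (simp only: set_lebesgue_integral_def)
  also have "integral\<^sup>L lborel ?C = 1 / w"
    using integral_powr_unit_interval(2)[OF v(2)] by (simp only: set_lebesgue_integral_def)
  finally show "(LBINT s:{0<..}. of_real (real_torus_theta \<alpha> s - 1) * of_real s powr (w - 1)) =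
       zeta_mellin \<alpha> w + ?c / ?v - 1 / w" by simp
qed

lemma zeta_series_eq_continuation:
  assumes w: "Re w > real CARD('d) / 2"
  shows "real_torus_zeta_series \<alpha> w = zeta_continuation \<alpha> w"
proof -
  have w0: "Re w > 0" using w by (auto intro: le_less_trans[rotated])
  then have "w \<noteq> 0" by auto
  have cong: "complex_of_real (real_torus_theta \<alpha> s - 1) * of_real s powr (w - 1) =
      of_real (\<Sum>\<^sub>\<infinity>m\<in>UNIV - {0}. exp (- real_torus_eigenvalue \<alpha> m * s)) * of_real s powr (w - 1)"
          if "s \<in> {0<..}" for s
    using real_torus_theta_minus_1(2)[OF \<alpha>, of s] that by simp
  have "(LBINT s:{0<..}. of_real (\<Sum>\<^sub>\<infinity>m\<in>UNIV - {0}. exp (- real_torus_eigenvalue \<alpha> m * s))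
      * of_real s powr (w - 1))
      = Gamma w * (\<Sum>\<^sub>\<infinity>m\<in>UNIV - {0}. of_real (real_torus_eigenvalue \<alpha> m) powr (- w))"
  proof (rule mellin_exp_sum[OF w0])
    show "set_integrable lborel {0<..} (\<lambda>s. of_real (\<Sum>\<^sub>\<infinity>m\<in>UNIV - {0}. exp (- real_torus_eigenvalue \<alpha> m
        * s)) * of_real s powr (w - 1))"
      by (rule iffD1[OF set_integrable_cong[OF refl refl cong] theta_mellin(1)[OF w]])
  qed (use real_torus_eigenvalue_pos[OF \<alpha>] real_torus_theta_minus_1(1)[OF \<alpha>] in auto)
  also have "(LBINT s:{0<..}. of_real (\<Sum>\<^sub>\<infinity>m\<in>UNIV - {0}. exp (- real_torus_eigenvalue \<alpha> m * s))
      * of_real s powr (w - 1))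
      = (LBINT s:{0<..}. of_real (real_torus_theta \<alpha> s - 1) * of_real s powr (w - 1))"
    by (intro set_lebesgue_integral_cong allI impI cong[symmetric]) simp
  finally have G: "Gamma w * real_torus_zeta_series \<alpha> w =
      zeta_mellin \<alpha> w + of_real (flat_heat \<alpha> 1) / (w - of_real (real CARD('d) / 2)) - 1 / w"
    unfolding theta_mellin(2)[OF w] real_torus_zeta_series_def ..
  have "w \<notin> \<int>\<^sub>\<le>\<^sub>0" using w0 by (rule Re_pos_not_nonpos_Ints)
  then have "Gamma w \<noteq> 0" by (simp add: Gamma_eq_zero_iff)
  then have "real_torus_zeta_series \<alpha> w = rGamma w * (Gamma w * real_torus_zeta_series \<alpha> w)"
    by (simp add: rGamma_inverse_Gamma)
  also have "\<dots> = zeta_continuation \<alpha> w"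
    unfolding G zeta_continuation_def using rGamma_plus1[of w, symmetric] \<open>w \<noteq> 0\<close>
        by (simp add: algebra_simps)
  finally show ?thesis .
qed

lemma zeta_continuation_analytic:
  assumes "z \<noteq> of_real (real CARD('d) / 2)"
  shows "zeta_continuation \<alpha> analytic_on {z}"
proof -
  have "zeta_continuation \<alpha> holomorphic_on - {of_real (real CARD('d) / 2)}"
    unfolding zeta_continuation_def[abs_def]
    by (intro holomorphic_intros zeta_mellin_holomorphic) auto
  then have "zeta_continuation \<alpha> analytic_on - {of_real (real CARD('d) / 2)}"
    by (subst analytic_on_open) auto
  then show ?thesis by (rule analytic_on_subset) (use assms in auto)
qed

text \<open>At \<open>d / 2\<close> the formula contains a division by zero, so its value there need
  not be the one that nice meromorphy prescribes; \<open>remove_sings\<close> corrects it and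
  changes nothing at points of analyticity.\<close>

lemma real_torus_zeta_eq: "real_torus_zeta \<alpha> = remove_sings (zeta_continuation \<alpha>)"
proof -
  have an: "zeta_mellin \<alpha> analytic_on UNIV"
    by (simp add: analytic_on_open zeta_mellin_holomorphic)
  have "zeta_continuation \<alpha> meromorphic_on UNIV"
    unfolding zeta_continuation_def[abs_def]
    by (intro meromorphic_intros analytic_on_imp_meromorphic_on[OF an] analytic_on_imp_meromorphic_on
        analytic_intros)
  then have nice: "remove_sings (zeta_continuation \<alpha>) nicely_meromorphic_on UNIV"
    by (rule remove_sings_nicely_meromorphic)
  have eq: "remove_sings (zeta_continuation \<alpha>) w = real_torus_zeta_series \<alpha> w"
      if "Re w > real CARD('d) / 2" for w
  proof -
    have "w \<noteq> of_real (real CARD('d) / 2)"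
    proof
      assume "w = of_real (real CARD('d) / 2)"
      then have "Re w = real CARD('d) / 2" by (simp only: Re_complex_of_real)
      with that show False by simp
    qed
    from remove_sings_at_analytic[OF zeta_continuation_analytic[OF this]] show ?thesis
      using zeta_series_eq_continuation[OF that] by simp
  qed
  show ?thesis
    unfolding real_torus_zeta_def
  proof (rule the_equality)
    fix Z assume Z: "Z nicely_meromorphic_on UNIV \<and> (\<forall>w. real CARD('d) / 2 < Re w \<longrightarrow> Z w
        = real_torus_zeta_series \<alpha> w)"
    show "Z = remove_sings (zeta_continuation \<alpha>)"
      by (rule nicely_meromorphic_unique[where a = "real CARD('d) / 2"]) (use Z nice eq in auto)
  qed (use nice eq in auto)
qed

text \<open>\<open>rGamma\<close> has a simple zero at 0 with derivative 1, so the product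
  contributes just the value of its other factor at 0, where the pole term gives
  \<open>- 2 * c / d\<close> with \<open>c = flat_heat \<alpha> 1\<close>. The derivative of
  \<open>rGamma\<close> at 1 is \<open>euler_mascheroni\<close>.\<close>

lemma deriv_real_torus_zeta_0:
  "deriv (real_torus_zeta \<alpha>) 0 = zeta_mellin \<alpha> 0 - of_real (2 * flat_heat \<alpha> 1 / real CARD('d))
      - euler_mascheroni"
proof -
  let ?G = "\<lambda>w. zeta_mellin \<alpha> w + of_real (flat_heat \<alpha> 1) / (w - of_real (real CARD('d) / 2))"
  have "?G holomorphic_on - {of_real (real CARD('d) / 2)}"
    by (intro holomorphic_intros zeta_mellin_holomorphic) auto
  then obtain G' where G': "(?G has_field_derivative G') (at 0)"
    using holomorphic_on_open[of "- {complex_of_real (real CARD('d) / 2)}" ?G] by fastforce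
  have r0: "(rGamma has_field_derivative 1) (at (0 :: complex))"
    using has_field_derivative_rGamma_nonpos_int[of 0] by simp
  have "(rGamma has_field_derivative - rGamma 1 * Digamma 1) (at (0 + 1 :: complex))"
    by (simp only: add_0_left) (rule has_field_derivative_rGamma_no_nonpos_int, auto elim!:
        nonpos_Ints_cases)
  then have r1: "((\<lambda>w. rGamma (w + 1)) has_field_derivative euler_mascheroni) (at (0 :: complex))"
    by (subst DERIV_shift[symmetric]) simp
  have "(zeta_continuation \<alpha> has_field_derivative (1 * ?G 0 + G' * rGamma 0 - euler_mascheroni)) (at 0)"
    unfolding zeta_continuation_def[abs_def] by (intro DERIV_diff DERIV_mult r0 G' r1)
  then have "deriv (zeta_continuation \<alpha>) 0 = ?G 0 - euler_mascheroni"
    by (auto dest!: DERIV_imp_deriv)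
  moreover have "(0 :: complex) \<noteq> of_real (real CARD('d) / 2)" by simp
  then have "deriv (real_torus_zeta \<alpha>) 0 = deriv (zeta_continuation \<alpha>) 0"
    unfolding real_torus_zeta_eq by (intro deriv_remove_sings_at_analytic zeta_continuation_analytic)
  ultimately show ?thesis by simp
qed

text \<open>The integrand splits into three pieces, one for each term of
  \<open>deriv_real_torus_zeta_0\<close>: the Mellin kernel at \<open>w = 0\<close>, the heat term
  on \<open>{1<..}\<close>, which the kernel does not subtract and whose integral is
  \<open>2 * c / d\<close> with \<open>c = flat_heat \<alpha> 1\<close>, and
  \<open>exp (- s)\<close> minus the zero mode on \<open>{0<..1}\<close>.\<close>

lemma regularized_real_theta_integral:
  "complex_of_real (LBINT s:{0<..}. regularized_real_theta \<alpha> s) = deriv (real_torus_zeta \<alpha>) 0"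
proof -
  let ?c = "flat_heat \<alpha> 1" and ?a = "- real CARD('d) / 2 - 1"
  let ?A = "\<lambda>s. indicator {0<..} s *\<^sub>R (mellin_kernel \<alpha> s / s)"
  let ?B = "\<lambda>s. ?c * (indicator {1<..} s *\<^sub>R (s powr ?a))"
  let ?C = "\<lambda>s::real. indicator {0<..} s *\<^sub>R ((exp (- s) - indicator {..1} s) / s)"
  have a: "?a < - 1" by simp
  have eq: "indicator {0<..} s *\<^sub>R regularized_real_theta \<alpha> s = ?A s - ?B s + ?C s" for s
  proof -
    consider "s \<le> 0" | "0 < s" "s \<le> 1" | "s > 1" by linarith
    then show ?thesis
    proof cases
      case 2
      then show ?thesis by (simp add: regularized_real_theta_def mellin_kernel_def add_divide_distrib
          diff_divide_distrib)
    next
      case 3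
      have "flat_heat \<alpha> s / s = ?c * s powr ?a"
        using 3 by (subst flat_heat_powr) (simp_all add: powr_diff)
      then show ?thesis using 3
        by (simp add: regularized_real_theta_def mellin_kernel_def add_divide_distrib
            diff_divide_distrib)
    qed auto
  qed
  have Ac: "indicator {0<..} s *\<^sub>R (of_real (mellin_kernel \<alpha> s) * of_real s powr (0 - 1))
      = complex_of_real (?A s)" for s
    by (auto simp: indicator_def powr_minus divide_inverse)
  have "integrable lborel (\<lambda>s. complex_of_real (?A s))"
    using zeta_mellin_integrable[of 0] unfolding set_integrable_def Ac .
  then have "integrable lborel (\<lambda>s. Re (complex_of_real (?A s)))" by (rule integrable_Re)
  then have A: "integrable lborel ?A" unfolding Re_complex_of_real .
  have zA: "zeta_mellin \<alpha> 0 = complex_of_real (integral\<^sup>L lborel ?A)"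
    unfolding zeta_mellin_def set_lebesgue_integral_def Ac by (rule integral_complex_of_real)
  have "set_integrable lborel {1<..} (\<lambda>s. s powr ?a)"
    by (rule set_integrable_subset[OF set_integral_powr_Ici(1)[OF a]]) auto
  then have B: "integrable lborel ?B" unfolding set_integrable_def by (rule integrable_mult_right)
  have "(LBINT s:{1<..}. s powr ?a) = - 1 / (?a + 1)"
    unfolding set_integral_powr_Ici(2)[OF a, symmetric] by (rule set_integral_Ioi_eq_Ici) measurable
  then have iB: "integral\<^sup>L lborel ?B = 2 * ?c / real CARD('d)"
    unfolding integral_mult_right_zero by (simp add: set_lebesgue_integral_def)
  have C: "integrable lborel ?C" using euler_mascheroni_integral(1) unfolding set_integrable_def .
  have iC: "integral\<^sup>L lborel ?C = - euler_mascheroni"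
    using euler_mascheroni_integral(2) unfolding set_lebesgue_integral_def .
  have "(LBINT s:{0<..}. regularized_real_theta \<alpha> s) = integral\<^sup>L lborel ?A - integral\<^sup>L lborel ?B
      + integral\<^sup>L lborel ?C"
    unfolding set_lebesgue_integral_def eq using A B C by simp
  then show ?thesis unfolding deriv_real_torus_zeta_0 zA iB iC by simp
qed

end

theorem theorem5p8:
  fixes \<alpha> :: "real ^ 'd::finite" and N :: "nat \<Rightarrow> nat ^ 'd"
  assumes "\<And>j. \<alpha> $ j > 0"
    and "\<And>u j. u > 0 \<Longrightarrow> N u $ j > 0"
    and "\<And>j. (\<lambda>u. real (N u $ j) / real u) \<longlonglongrightarrow> \<alpha> $ j"
  shows "(\<lambda>u. complex_of_real (torus_H0 (N u))
              - (complex_of_real (ln ((real u)\<^sup>2)) - deriv (real_torus_zeta \<alpha>) 0))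
           \<in> o(\<lambda>_. 1) \<and>
         (\<lambda>u. complex_of_real (ln (torus_det (N u)))
              - (complex_of_real (torus_volume (N u) * lattice_I0 CARD('d))
                 + complex_of_real (ln ((real u)\<^sup>2)) - deriv (real_torus_zeta \<alpha>) 0))
           \<in> o(\<lambda>_. 1)"
proof -
  define J where "J = (LBINT s:{0<..}. regularized_real_theta \<alpha> s)"
  have J: "deriv (real_torus_zeta \<alpha>) 0 = complex_of_real J"
    unfolding J_def by (rule regularized_real_theta_integral[OF assms(1), symmetric])
  have "(\<lambda>u. torus_H0 (N u) - ln ((real u)\<^sup>2) + J) \<longlonglongrightarrow> - J + J"
    unfolding J_def by (intro tendsto_add torus_H0_asymp[OF assms(1,3)] tendsto_const)
  then have "(\<lambda>u. complex_of_real (torus_H0 (N u) - ln ((real u)\<^sup>2) + J)) \<longlonglongrightarrow> complex_of_real (- J + J)"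
    by (rule tendsto_of_real)
  then have lim: "(\<lambda>u. complex_of_real (torus_H0 (N u)) - (complex_of_real (ln ((real u)\<^sup>2))
      - deriv (real_torus_zeta \<alpha>) 0)) \<longlonglongrightarrow> 0"
    unfolding J by (simp add: algebra_simps)
  \<comment> \<open>The two error terms are equal as soon as all sides exceed the dimension, by the
    exact identity \<open>ln_torus_det\<close>.\<close>
  have "\<forall>\<^sub>F u in sequentially.
     complex_of_real (torus_H0 (N u)) - (complex_of_real (ln ((real u)\<^sup>2))
         - deriv (real_torus_zeta \<alpha>) 0) =
     complex_of_real (ln (torus_det (N u))) - (complex_of_real (torus_volume (N u)
         * lattice_I0 CARD('d))
                 + complex_of_real (ln ((real u)\<^sup>2)) - deriv (real_torus_zeta \<alpha>) 0)"
    using eventually_large[OF assms(1,3)] by eventually_elim (simp add: ln_torus_det)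
  then have "(\<lambda>u. complex_of_real (ln (torus_det (N u))) - (complex_of_real (torus_volume (N u)
      * lattice_I0 CARD('d))
                 + complex_of_real (ln ((real u)\<^sup>2)) - deriv (real_torus_zeta \<alpha>) 0)) \<longlonglongrightarrow> 0"
    by (rule Lim_transform_eventually[OF lim])
  with lim show ?thesis by (auto intro!: smalloI_tendsto)
qed

end
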